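(* Let $\Omega\subset\mathbb{R}^d$, $d\ge3$, be a bounded open set and let $z_0\in\partial\Omega$ be a singular point of $\Omega$. Then there exists an open set $\Omega_0\subset\mathbb{R}^d$ such that $\overline{\Omega_0}\subset\Omega\cup\{z_0\}$, $z_0\in\partial\Omega_0$, and $z_0$ is a singular point of $\Omega_0$.
   Context: For a bounded open set $U$ and $\phi\in C(\partial U)$, let $u_\phi$ be the Perron solution of the Dirichlet problem on $U$ (equivalently, the unique harmonic function on $U$ such that $\Phi-u_\phi\in H^1_0(U)$ for some extension $\Phi\in C(\overline U)$ of $\phi$). A point $z\in\partial U$ is regular for $U$ if $\lim_{x\to z}u_\phi(x)=\phi(z)$ for all $\phi\in C(\partial U)$, and singular otherwise. Wiener's criterion (known, $d\ge3$): $z\in\partial U$ is regular iff $\sum_{j\ge0}2^{j(d-2)}\mathrm{cap}(\overline{B(z,2^{-j})}\setminus U)=\infty$, where $\mathrm{cap}(A)=\inf\{\|u\|^2_{H^1(\mathbb{R}^d)}: u\in H^1(\mathbb{R}^d),\ u\ge1$ a.e. in a neighbourhood of $A\}$. *)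

theory Defs
  imports "HOL-Analysis.Analysis"
begin

definition subharmonic_on :: "'a::euclidean_space set \<Rightarrow> ('a \<Rightarrow> real) \<Rightarrow> bool" where
  "subharmonic_on U v \<longleftrightarrow>
     continuous_on U v \<and>
     (\<forall>x r. 0 < r \<and> cball x r \<subseteq> U \<longrightarrow>
        v x * measure lborel (cball x r) \<le> integral (cball x r) v)"

definition perron_solution :: "'a::euclidean_space set \<Rightarrow> ('a \<Rightarrow> real) \<Rightarrow> 'a \<Rightarrow> real" where
  "perron_solution U \<phi> x =
     Sup {v x | v. continuous_on (closure U) v \<and> subharmonic_on U v \<and>
                   (\<forall>z\<in>frontier U. v z \<le> \<phi> z)}"

definition regular_point :: "'a::euclidean_space set \<Rightarrow> 'a \<Rightarrow> bool" where
  "regular_point U z \<longleftrightarrow> z \<in> frontier U \<and>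
     (\<forall>\<phi>. continuous_on (frontier U) \<phi> \<longrightarrow>
        (perron_solution U \<phi> \<longlongrightarrow> \<phi> z) (at z within U))"

definition singular_point :: "'a::euclidean_space set \<Rightarrow> 'a \<Rightarrow> bool" where
  "singular_point U z \<longleftrightarrow> z \<in> frontier U \<and> \<not> regular_point U z"

end

theory Submission
  imports Defs "HOL-Complex_Analysis.Great_Picard"
begin

text \<open>Write $P(U)$ for the lower functions of $U$ with boundary values $s(x) = -|x - z_0|^2$. By the maximum
  principle $z_0$ is singular iff there are points $x_n \to z_0$ of $U$ and $\delta > 0$ with $v(x_n) \le -\delta$
  for all $v \in P(U)$. Fix such $x_n$ for $\Omega$ and let $K$ be the set of boundary points where every lower function
  stays below $s - \epsilon$. Then $K$ is polar (Kellogg): a non-polar compact piece of $K$ carries a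
  continuous potential, and a multiple of it plus a constant would be a lower function violating the definition of $K$. Hence there
  are continuous superharmonic $W_j \ge 0$ with $W_j > 1$ on the part of $K$ at distance at least $1/(j+1)$ from $z_0$ and
  $\sum_j W_j(x_n)$ tiny. Let $\Omega_0$ be $\Omega$ without a thin closed neighbourhood of
  $\partial\Omega \setminus \{z_0\}$ in which some $W_j$ exceeds $1$ or some lower function of $\Omega$ exceeds
  $s - 2\epsilon$. For a lower function $v$ of $\Omega_0$ the function
  $v - 2\epsilon - C \sum_{j \in J} W_j - \eta |x - z_0|^{2-d}$ with a suitable finite $J$
  lies strictly below some $b \in P(\Omega)$ near $\partial\Omega_0$, so it can be glued
  into $b$; the result is in $P(\Omega)$, hence is at most $-\delta$ at $x_n$, and $v(x_n) \le -\delta/2$ follows.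

  The potential on a non-polar compact set comes from energy: the Newton kernel is a mixture of Gaussians, hence positive
  definite, so nearly energy-minimizing densities on shrinking neighbourhoods form a Cauchy sequence in energy. Their Gaussian tails
  are then uniformly small, and cutting the densities down to where the tail potentials are small makes the potentials equicontinuous.
  If instead the minimal energies tend to infinity, the potentials of near minimizers show that the set is polar.\<close>


subsection \<open>Second moments of balls and the ball defect\<close>

text \<open>Subharmonicity demands the mean value inequality on every closed ball inside the set. A
  function glued from two pieces visibly satisfies it only on small balls, so the gluing at the end
  rests on a passage from small balls to all balls; this is what the ball defect serves. Regularity
  speaks of all boundary data, but \<open>neg_sqdist z0\<close> alone decides it, because every
  continuous \<open>\<phi>\<close> differs from \<open>\<phi> z0\<close> by at most
  \<open>e - C * neg_sqdist z0 y\<close> on the boundary.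

  The boundary of the thinned domain meets that of \<Omega> only at the singular point. Away from
  this point it is compact inside \<Omega>, hence covered by finitely many of the open sets where
  some potential or some lower function is large; no infinite sum has to converge. At the point
  itself a small multiple of the Newton kernel forces the comparison, and the multiple may depend on
  \<open>n\<close>.

  No equilibrium measure is formed. The limit is taken of potentials, by Arzela-Ascoli, so a bound
  on energies must first be turned into a modulus of continuity common to all the densities.\<close>

lemma borel_cball [measurable]: "cball x r \<in> sets (borel :: 'a::euclidean_space measure)"
  by (intro borel_closed closed_cball)

lemma cball_integrable_continuous:
  fixes f :: "'a::euclidean_space \<Rightarrow> real"
  assumes "continuous_on (cball x r) f"
  shows "set_integrable lborel (cball x r) f"
  unfolding set_integrable_def using borel_integrable_compact[OF compact_cball assms] by simp

lemma cball_integral_isometry: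
  fixes g :: "'a::euclidean_space \<Rightarrow> real"
  assumes d: "distr lborel borel T = (lborel :: 'a measure)" and T: "T \<in> borel_measurable borel"
    and n: "\<And>h. norm (T h) = norm h" and g[measurable]: "g \<in> borel_measurable borel"
  shows "(LINT h:cball 0 \<rho>|lborel. g (T h)) = (LINT h:cball 0 \<rho>|lborel. g h)"
proof -
  have "(LINT h:cball 0 \<rho>|lborel. g h) = (LINT h:cball 0 \<rho>|distr lborel borel T. g h)"
    using d by simp
  also have "\<dots> = (\<integral>h. indicator (cball 0 \<rho>) (T h) *\<^sub>R g (T h) \<partial>lborel)"
    unfolding set_lebesgue_integral_def using T by (subst integral_distr) simp_all
  also have "\<dots> = (LINT h:cball 0 \<rho>|lborel. g (T h))"
    unfolding set_lebesgue_integral_def using n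
    by (intro Bochner_Integration.integral_cong) (auto simp: indicator_def)
  finally show ?thesis by simp
qed

lemma lborel_distr_minus: "distr lborel borel uminus = (lborel :: 'a::euclidean_space measure)"
proof -
  have "density (distr lborel borel (\<lambda>x::'a. 0 + (-1) *\<^sub>R x)) (\<lambda>_. ennreal (\<bar>-1\<bar>^DIM('a))) = (lborel :: 'a measure)"
    by (rule lborel_affine[of "-1" "0::'a", symmetric]) simp
  then show ?thesis by (simp add: density_1)
qed

lemma lborel_distr_reflect:
  fixes i :: "'a::euclidean_space" assumes i: "i \<in> Basis"
  shows "distr lborel borel (\<lambda>h. h - (2 * (h \<bullet> i)) *\<^sub>R i) = (lborel :: 'a measure)"
proof -
  define c where "c = (\<lambda>j::'a. if j = i then -1 else (1::real))"
  have T: "(\<lambda>x. 0 + (\<Sum>j\<in>Basis. (c j * (x \<bullet> j)) *\<^sub>R j)) = (\<lambda>h::'a. h - (2 * (h \<bullet> i)) *\<^sub>R i)"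
  proof
    fix x :: 'a
    have "(\<Sum>j\<in>Basis. (c j * (x \<bullet> j)) *\<^sub>R j) = (\<Sum>j\<in>Basis. (x \<bullet> j) *\<^sub>R j - (if j = i then (2 * (x \<bullet> i)) *\<^sub>R i else 0))"
      by (rule sum.cong) (auto simp: c_def scaleR_diff_left[symmetric])
    also have "\<dots> = x - (2 * (x \<bullet> i)) *\<^sub>R i"
      using i by (simp add: sum_subtractf euclidean_representation)
    finally show "0 + (\<Sum>j\<in>Basis. (c j * (x \<bullet> j)) *\<^sub>R j) = x - (2 * (x \<bullet> i)) *\<^sub>R i" by simp
  qed
  have "lborel = density (distr lborel borel (\<lambda>x. 0 + (\<Sum>j\<in>Basis. (c j * (x \<bullet> j)) *\<^sub>R j))) (\<lambda>_. (\<Prod>j\<in>Basis. \<bar>c j\<bar>))"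
    by (rule lborel_affine_euclidean) (auto simp: c_def)
  moreover have "(\<Prod>j\<in>Basis. \<bar>c j\<bar>) = 1" by (rule prod.neutral) (auto simp: c_def)
  ultimately show ?thesis unfolding T by (simp add: density_1)
qed

text \<open>Exchanging two coordinates is not a diagonal map, so the affine substitution behind
  \<open>lborel_distr_reflect\<close> does not cover it. Instead boxes pull back to boxes whose side
  lengths are permuted.\<close>

lemma lborel_distr_swap:
  fixes i j :: "'a::euclidean_space" assumes i: "i \<in> Basis" and j: "j \<in> Basis" and ij: "i \<noteq> j"
  shows "distr lborel borel (\<lambda>h. h + (h \<bullet> j - h \<bullet> i) *\<^sub>R (i - j)) = (lborel :: 'a measure)"
proof -
  define T where "T = (\<lambda>h::'a. h + (h \<bullet> j - h \<bullet> i) *\<^sub>R (i - j))"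
  define p where "p = (\<lambda>b. if b = i then j else if b = j then i else b)"
  have Tb: "T h \<bullet> b = h \<bullet> p b" if "b \<in> Basis" for h b
    using that i j ij by (auto simp: T_def p_def inner_simps inner_Basis)
  have pB: "p b \<in> Basis" if "b \<in> Basis" for b using that i j by (auto simp: p_def)
  have pp: "p (p b) = b" for b by (auto simp: p_def)
  have Tm[measurable]: "T \<in> borel_measurable borel" unfolding T_def by measurable
  have "lborel = distr lborel borel T"
  proof (rule lborel_eqI)
    fix l u :: 'a assume lu: "\<And>b. b \<in> Basis \<Longrightarrow> l \<bullet> b \<le> u \<bullet> b"
    have "T -` box l u = box (T l) (T u)"
    proof (intro set_eqI iffI)
      fix x assume "x \<in> T -` box l u"
      then have "\<And>b. b \<in> Basis \<Longrightarrow> l \<bullet> b < x \<bullet> p b \<and> x \<bullet> p b < u \<bullet> b" by (auto simp: mem_box Tb)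
      from this[OF pB] show "x \<in> box (T l) (T u)" by (auto simp: mem_box Tb pp)
    next
      fix x assume "x \<in> box (T l) (T u)"
      then have "\<And>b. b \<in> Basis \<Longrightarrow> l \<bullet> p b < x \<bullet> b \<and> x \<bullet> b < u \<bullet> p b" by (auto simp: mem_box Tb)
      from this[OF pB] show "x \<in> T -` box l u" by (auto simp: mem_box Tb pp)
    qed
    then have "emeasure (distr lborel borel T) (box l u) = emeasure lborel (box (T l) (T u))"
      by (subst emeasure_distr) auto
    also have "\<dots> = (\<Prod>b\<in>Basis. (T u - T l) \<bullet> b)"
      by (rule emeasure_lborel_box) (auto simp: Tb lu pB)
    also have "(\<Prod>b\<in>Basis. (T u - T l) \<bullet> b) = (\<Prod>b\<in>Basis. (u - l) \<bullet> p b)"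
      by (rule prod.cong) (auto simp: Tb inner_diff_left)
    also have "\<dots> = (\<Prod>b\<in>Basis. (u - l) \<bullet> b)"
      by (rule prod.reindex_bij_witness[of _ p p]) (auto simp: pp pB)
    finally show "emeasure (distr lborel borel T) (box l u) = ennreal (\<Prod>b\<in>Basis. (u - l) \<bullet> b)" by simp
  qed simp
  then show ?thesis unfolding T_def by simp
qed

text \<open>The natural scale of the defect of a smooth function: to leading order the defect is
  this number times the Laplacian divided by twice the dimension. Its value is never computed;
  positivity is enough.\<close>

definition ball_moment :: "'a::euclidean_space itself \<Rightarrow> real \<Rightarrow> real" where
  "ball_moment _ \<rho> = (LINT h:cball (0::'a) \<rho>|lborel. h \<bullet> h)"

text \<open>The ball defect, divided by the ball moment, is a discrete substitute for the Laplacian (up to a constant factor). It is left unnormalized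
  so that it is additive and self-adjoint without side conditions.\<close>

definition ball_defect :: "real \<Rightarrow> ('a::euclidean_space \<Rightarrow> real) \<Rightarrow> 'a \<Rightarrow> real" where
  "ball_defect \<rho> g y = (LINT h:cball 0 \<rho>|lborel. g (y + h) - g y)"

lemma measure_cball_pos: "r > 0 \<Longrightarrow> measure lborel (cball (x::'a::euclidean_space) r) > 0"
  by (simp add: content_cball)

lemma ball_moment_pos:
  assumes r: "\<rho> > 0" shows "ball_moment TYPE('a::euclidean_space) \<rho> > 0"
proof -
  obtain b :: 'a where b: "b \<in> Basis" using nonempty_Basis by blast
  \<comment> \<open>The ball of radius \<open>\<rho>/4\<close> around this point lies in the large
    ball and keeps distance \<open>\<rho>/4\<close> from the origin, which bounds the moment below
    without any exact integration.\<close>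
  define c :: 'a where "c = (\<rho>/2) *\<^sub>R b"
  have nc: "norm c = \<rho>/2" using b r by (simp add: c_def)
  have sub: "cball c (\<rho>/4) \<subseteq> cball 0 \<rho>"
  proof
    fix h assume "h \<in> cball c (\<rho>/4)"
    then have "norm (c - h) \<le> \<rho>/4" by (simp add: dist_norm)
    with nc norm_triangle_ineq2[of h c] r show "h \<in> cball 0 \<rho>" by (simp add: norm_minus_commute)
  qed
  have low: "(\<rho>/4)^2 \<le> h \<bullet> h" if "h \<in> cball c (\<rho>/4)" for h
  proof -
    have "norm (c - h) \<le> \<rho>/4" using that by (simp add: dist_norm)
    with nc norm_triangle_ineq2[of c h] have "\<rho>/4 \<le> norm h" by linarith
    then have "(\<rho>/4)^2 \<le> norm h ^2" using r by (intro power_mono) auto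
    then show ?thesis by (simp add: power2_norm_eq_inner)
  qed
  have "0 < (\<rho>/4)^2 * measure lborel (cball c (\<rho>/4))" using r measure_cball_pos[of "\<rho>/4" c] by simp
  also have "\<dots> = (LINT h:cball c (\<rho>/4)|lborel. (\<rho>/4)^2)"
    using emeasure_lborel_cball_finite[of c "\<rho>/4"] by (simp add: set_lebesgue_integral_def)
  also have "\<dots> \<le> (LINT h:cball c (\<rho>/4)|lborel. h \<bullet> h)"
    by (rule set_integral_mono) (auto intro!: cball_integrable_continuous continuous_intros low)
  also have "\<dots> \<le> (LINT h:cball (0::'a) \<rho>|lborel. h \<bullet> h)"
    unfolding set_lebesgue_integral_def
  proof (rule Bochner_Integration.integral_mono)
    show "integrable lborel (\<lambda>h. indicat_real (cball c (\<rho>/4)) h *\<^sub>R (h \<bullet> h))" "integrable lborel (\<lambda>h::'a. indicat_real (cball 0 \<rho>) h *\<^sub>R (h \<bullet> h))"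
      unfolding set_integrable_def[symmetric] by (intro cball_integrable_continuous continuous_intros)+
    show "indicat_real (cball c (\<rho>/4)) h *\<^sub>R (h \<bullet> h) \<le> indicat_real (cball 0 \<rho>) h *\<^sub>R (h \<bullet> h)" for h
      using sub by (auto simp: indicator_def)
  qed
  finally show ?thesis by (simp add: ball_moment_def)
qed

lemma ball_integral_linear: "(LINT h:cball (0::'a::euclidean_space) \<rho>|lborel. y \<bullet> h) = 0"
  using cball_integral_isometry[OF lborel_distr_minus, of "\<lambda>h. y \<bullet> h" \<rho>]
  by (simp add: set_lebesgue_integral_def)

lemma ball_integral_offdiag:
  assumes "i \<in> Basis" "j \<in> Basis" "i \<noteq> j"
  shows "(LINT h:cball (0::'a::euclidean_space) \<rho>|lborel. (h \<bullet> i) * (h \<bullet> j)) = 0"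
proof -
  define T where "T = (\<lambda>h::'a. h - (2 * (h \<bullet> i)) *\<^sub>R i)"
  have n: "norm (T h) = norm h" for h
    using assms by (simp add: norm_eq T_def inner_simps inner_commute[of i h])
  have "(LINT h:cball 0 \<rho>|lborel. (T h \<bullet> i) * (T h \<bullet> j)) = (LINT h:cball 0 \<rho>|lborel. (h \<bullet> i) * (h \<bullet> j))"
    by (rule cball_integral_isometry[of T "\<lambda>h. (h \<bullet> i) * (h \<bullet> j)"]) (use n lborel_distr_reflect[OF assms(1)] in \<open>auto simp: T_def\<close>)
  moreover have "T h \<bullet> i = - (h \<bullet> i)" "T h \<bullet> j = h \<bullet> j" for h
    using assms by (auto simp: T_def inner_simps inner_Basis)
  ultimately show ?thesis by (simp add: set_lebesgue_integral_def)
qed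

lemma ball_integral_diag:
  assumes "i \<in> Basis" "j \<in> Basis"
  shows "(LINT h:cball (0::'a::euclidean_space) \<rho>|lborel. (h \<bullet> i) * (h \<bullet> i)) = (LINT h:cball (0::'a) \<rho>|lborel. (h \<bullet> j) * (h \<bullet> j))"
proof (cases "i = j")
  case False
  define T where "T = (\<lambda>h::'a. h + (h \<bullet> j - h \<bullet> i) *\<^sub>R (i - j))"
  have n: "norm (T h) = norm h" for h
    using assms False by (simp add: norm_eq T_def inner_simps inner_commute[of i h] inner_commute[of j h] inner_Basis algebra_simps)
  have "(LINT h:cball 0 \<rho>|lborel. (T h \<bullet> i) * (T h \<bullet> i)) = (LINT h:cball 0 \<rho>|lborel. (h \<bullet> i) * (h \<bullet> i))"
    by (rule cball_integral_isometry[of T "\<lambda>h. (h \<bullet> i) * (h \<bullet> i)"]) (use n lborel_distr_swap[OF assms False] in \<open>auto simp: T_def\<close>)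
  moreover have "T h \<bullet> i = h \<bullet> j" for h
    using assms False by (auto simp: T_def inner_simps inner_Basis)
  ultimately show ?thesis by simp
qed simp

text \<open>Reflections kill the mixed second moments and swaps equate the diagonal ones, so the
  quadratic form is isotropic; its constant is read off from the trace, which is the ball
  moment.\<close>

lemma ball_integral_square:
  fixes y :: "'a::euclidean_space"
  shows "(LINT h:cball (0::'a) \<rho>|lborel. (y \<bullet> h)^2) = (y \<bullet> y) * ball_moment TYPE('a) \<rho> / DIM('a)"
proof -
  define D where "D = (LINT h:cball (0::'a) \<rho>|lborel. (h \<bullet> (SOME b. b \<in> Basis)) * (h \<bullet> (SOME b. b \<in> Basis)))"
  have D: "(LINT h:cball (0::'a) \<rho>|lborel. (h \<bullet> i) * (h \<bullet> i)) = D" if "i \<in> Basis" for i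
    unfolding D_def by (rule ball_integral_diag) (auto simp: that SOME_Basis)
  have int: "set_integrable lborel (cball 0 \<rho>) (\<lambda>h::'a. (h \<bullet> i) * (h \<bullet> j))" for i j
    by (intro cball_integrable_continuous continuous_intros)
  have "ball_moment TYPE('a) \<rho> = (\<Sum>i\<in>Basis. (LINT h:cball (0::'a) \<rho>|lborel. (h \<bullet> i) * (h \<bullet> i)))"
    unfolding ball_moment_def set_lebesgue_integral_def
    by (subst Bochner_Integration.integral_sum[symmetric])
       (use int in \<open>simp_all add: set_integrable_def sum_distrib_left[symmetric] euclidean_inner[symmetric]\<close>)
  then have M: "ball_moment TYPE('a) \<rho> = DIM('a) * D" by (simp add: D)
  have "(LINT h:cball (0::'a) \<rho>|lborel. (y \<bullet> h)^2)
      = (LINT h:cball (0::'a) \<rho>|lborel. (\<Sum>i\<in>Basis. \<Sum>j\<in>Basis. ((y \<bullet> i) * (y \<bullet> j)) * ((h \<bullet> i) * (h \<bullet> j))))"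
    by (intro arg_cong[where f="\<lambda>f. set_lebesgue_integral lborel (cball 0 \<rho>) f"] ext,
        subst euclidean_inner) (simp add: power2_eq_square sum_product mult_ac)
  also have "\<dots> = (\<Sum>i\<in>Basis. \<Sum>j\<in>Basis. ((y \<bullet> i) * (y \<bullet> j)) * (LINT h:cball (0::'a) \<rho>|lborel. (h \<bullet> i) * (h \<bullet> j)))"
    using int[unfolded set_integrable_def]
    by (simp add: set_lebesgue_integral_def scaleR_sum_right sum_distrib_left mult.left_commute[of "indicator _ _"])
  also have "\<dots> = (\<Sum>i\<in>Basis. \<Sum>j\<in>Basis. if i = j then (y \<bullet> i) * (y \<bullet> i) * D else 0)"
    by (intro sum.cong refl) (auto simp: D ball_integral_offdiag)
  also have "\<dots> = (y \<bullet> y) * D" by (simp add: euclidean_inner[of y y] sum_distrib_right)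
  finally show ?thesis by (simp add: M)
qed

text \<open>Here \<open>u h\<close> is the increment of the squared norm from \<open>y\<close> to
  \<open>y + h\<close>. Its linear part integrates to zero and the squares are known. For smooth
  \<open>\<Gamma>\<close> one takes \<open>p\<close> as the first derivative and \<open>q\<close> as
  twice the second one; then \<open>p + q * (y \<bullet> y) / DIM('a)\<close> is the Laplacian
  divided by twice the dimension. The estimate is left as a hypothesis so that smooth and merely
  once differentiable profiles share one proof.\<close>

lemma ball_defect_radial:
  fixes y :: "'a::euclidean_space"
  defines "u \<equiv> \<lambda>h. h \<bullet> h + 2 * (y \<bullet> h)"
  assumes cont: "continuous_on (cball y \<rho>) (\<lambda>x. \<Gamma> (x \<bullet> x))"
    and est: "\<And>h. norm h \<le> \<rho> \<Longrightarrow> \<bar>\<Gamma> (y \<bullet> y + u h) - \<Gamma> (y \<bullet> y) - p * u h - q * (y \<bullet> h)^2\<bar> \<le> K * (h \<bullet> h)"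
  shows "\<bar>ball_defect \<rho> (\<lambda>x. \<Gamma> (x \<bullet> x)) y - ball_moment TYPE('a) \<rho> * (p + q * (y \<bullet> y) / DIM('a))\<bar> \<le> K * ball_moment TYPE('a) \<rho>"
proof -
  let ?B = "cball (0::'a) \<rho>"
  have yh: "(y + h) \<bullet> (y + h) = y \<bullet> y + u h" for h by (simp add: u_def inner_simps inner_commute)
  have c1: "continuous_on ?B (\<lambda>h. \<Gamma> (y \<bullet> y + u h))"
  proof -
    have "continuous_on ?B (\<lambda>h. (\<lambda>x. \<Gamma> (x \<bullet> x)) (y + h))"
      by (rule continuous_on_compose2[OF cont]) (auto intro!: continuous_intros simp: dist_norm)
    then show ?thesis by (simp add: yh)
  qed
  have cu: "continuous_on ?B u" unfolding u_def by (intro continuous_intros)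
  have i1: "set_integrable lborel ?B (\<lambda>h. \<Gamma> (y \<bullet> y + u h) - \<Gamma> (y \<bullet> y))"
    by (intro cball_integrable_continuous continuous_intros c1)
  have i2: "set_integrable lborel ?B (\<lambda>h. p * u h + q * (y \<bullet> h)^2)"
    by (intro cball_integrable_continuous continuous_intros cu)
  have iu: "set_integrable lborel ?B (\<lambda>h. p * (h \<bullet> h))" "set_integrable lborel ?B (\<lambda>h. 2 * p * (y \<bullet> h))"
    "set_integrable lborel ?B (\<lambda>h. q * (y \<bullet> h)^2)" 
    by (intro cball_integrable_continuous continuous_intros)+
  have "(LINT h:?B|lborel. p * u h + q * (y \<bullet> h)^2) = (LINT h:?B|lborel. p * (h \<bullet> h) + (2 * p * (y \<bullet> h) + q * (y \<bullet> h)^2))"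
    by (simp add: u_def algebra_simps)
  also have "\<dots> = p * ball_moment TYPE('a) \<rho> + (2 * p * 0 + q * ((y \<bullet> y) * ball_moment TYPE('a) \<rho> / DIM('a)))"
    using iu by (subst set_integral_add, simp, simp add: set_integral_add)
      (simp add: set_integral_add ball_moment_def ball_integral_linear[unfolded ball_moment_def] ball_integral_square[unfolded ball_moment_def])
  finally have e2: "(LINT h:?B|lborel. p * u h + q * (y \<bullet> h)^2) = ball_moment TYPE('a) \<rho> * (p + q * (y \<bullet> y) / DIM('a))"
    by (simp add: algebra_simps)
  have "\<bar>ball_defect \<rho> (\<lambda>x. \<Gamma> (x \<bullet> x)) y - ball_moment TYPE('a) \<rho> * (p + q * (y \<bullet> y) / DIM('a))\<bar>
     = \<bar>LINT h:?B|lborel. (\<Gamma> (y \<bullet> y + u h) - \<Gamma> (y \<bullet> y)) - (p * u h + q * (y \<bullet> h)^2)\<bar>"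
    unfolding ball_defect_def yh e2[symmetric] using i1 i2 by (simp add: set_integral_diff)
  also have "\<dots> \<le> (LINT h:?B|lborel. \<bar>(\<Gamma> (y \<bullet> y + u h) - \<Gamma> (y \<bullet> y)) - (p * u h + q * (y \<bullet> h)^2)\<bar>)"
    using set_integral_norm_bound[OF set_integral_diff(1)[OF i1 i2]] by simp
  also have "\<dots> \<le> (LINT h:?B|lborel. K * (h \<bullet> h))"
  proof (rule set_integral_mono)
    show "set_integrable lborel ?B (\<lambda>h. \<bar>(\<Gamma> (y \<bullet> y + u h) - \<Gamma> (y \<bullet> y)) - (p * u h + q * (y \<bullet> h)^2)\<bar>)"
      "set_integrable lborel ?B (\<lambda>h. K * (h \<bullet> h))"
      by (intro cball_integrable_continuous continuous_intros c1 cu)+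
    show "\<bar>(\<Gamma> (y \<bullet> y + u h) - \<Gamma> (y \<bullet> y)) - (p * u h + q * (y \<bullet> h)^2)\<bar> \<le> K * (h \<bullet> h)" if "h \<in> ?B" for h
      using est[of h] that by (simp add: diff_diff_eq add.assoc)
  qed
  also have "\<dots> = K * ball_moment TYPE('a) \<rho>" by (simp add: ball_moment_def)
  finally show ?thesis .
qed

text \<open>Self-adjointness: Fubini, translation invariance in \<open>y\<close>, and the symmetry
  of the ball under \<open>h \<mapsto> -h\<close>. Boundedness and bounded support provide
  integrability on the product space.\<close>

lemma ball_defect_duality:
  fixes v G :: "'a::euclidean_space \<Rightarrow> real"
  assumes v[measurable]: "v \<in> borel_measurable borel" and G[measurable]: "G \<in> borel_measurable borel"
    and vb: "\<And>x. \<bar>v x\<bar> \<le> A" and v0: "\<And>x. norm x > R \<Longrightarrow> v x = 0"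
    and Gb: "\<And>x. \<bar>G x\<bar> \<le> B" and G0: "\<And>x. norm x > R \<Longrightarrow> G x = 0"
  shows "(\<integral>y. v y * ball_defect \<rho> G y \<partial>lborel) = (\<integral>y. G y * ball_defect \<rho> v y \<partial>lborel)"
    and "integrable lborel (\<lambda>y. G y * ball_defect \<rho> v y)"
proof -
  have Ap: "0 \<le> A" using vb[of 0] by linarith
  have Bp: "0 \<le> B" using Gb[of 0] by linarith
  define I where "I = (\<lambda>h::'a. indicator (cball 0 \<rho>) h :: real)"
  have I[measurable]: "I \<in> borel_measurable borel" unfolding I_def by measurable
  have fin: "integrable (lborel \<Otimes>\<^sub>M lborel) (\<lambda>p. indicator (cball (0::'a) R \<times> cball (0::'a) \<rho>) p * C :: real)" for C
    by (intro integrable_mult_left integrable_real_indicator)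
       (auto simp: lborel.emeasure_pair_measure_Times emeasure_lborel_cball_finite[unfolded infinity_ennreal_def] ennreal_mult_less_top)
  have gen: "integrable (lborel \<Otimes>\<^sub>M lborel) (\<lambda>(y, h). f y * (I h * (g (y + h) - g y)))"
    if f[measurable]: "f \<in> borel_measurable borel" and g[measurable]: "g \<in> borel_measurable borel"
      and fb: "\<And>x. \<bar>f x\<bar> \<le> C" and gb: "\<And>x. \<bar>g x\<bar> \<le> D" and f0: "\<And>x. norm x > R \<Longrightarrow> f x = 0" for f g :: "'a \<Rightarrow> real" and C D
  proof (rule Bochner_Integration.integrable_bound[OF fin[of "C * (D + D)"]])
    show "(\<lambda>(y, h). f y * (I h * (g (y + h) - g y))) \<in> borel_measurable (lborel \<Otimes>\<^sub>M lborel)" by measurable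
    have "\<bar>f y * (I h * (g (y + h) - g y))\<bar> \<le> indicator (cball (0::'a) R \<times> cball (0::'a) \<rho>) (y, h) * \<bar>C * (D + D)\<bar>" for y h
    proof (cases "norm y > R \<or> norm h > \<rho>")
      case True then show ?thesis using f0 by (auto simp: I_def)
    next
      case False
      have "\<bar>f y * (g (y + h) - g y)\<bar> \<le> C * (D + D)"
        unfolding abs_mult using fb[of y] gb[of "y+h"] gb[of y] by (intro mult_mono) auto
      then show ?thesis using False by (simp add: I_def indicator_def)
    qed
    then show "AE x in lborel \<Otimes>\<^sub>M lborel. norm (case x of (y, h) \<Rightarrow> f y * (I h * (g (y + h) - g y)))
         \<le> norm (indicator (cball (0::'a) R \<times> cball (0::'a) \<rho>) x * (C * (D + D)))"
      by (intro AE_I2) (auto simp: abs_mult split: prod.split)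
  qed
  have bd: "ball_defect \<rho> g y = (\<integral>h. I h * (g (y + h) - g y) \<partial>lborel)" for g :: "'a \<Rightarrow> real" and y
    by (simp add: ball_defect_def set_lebesgue_integral_def I_def)
  note i1 = gen[OF v G vb Gb v0] and i2 = gen[OF G v Gb vb G0]
  show "integrable lborel (\<lambda>y. G y * ball_defect \<rho> v y)"
    using lborel_pair.integrable_fst'[OF i2] by (simp add: bd)
  have tr: "(\<integral>y. f (y + h) \<partial>lborel) = (\<integral>y. f y \<partial>lborel)" if [measurable]: "f \<in> borel_measurable borel" for f :: "'a \<Rightarrow> real" and h
  proof -
    have "(\<integral>y. f y \<partial>lborel) = (\<integral>y. f y \<partial>distr lborel borel ((+) h))" by (simp add: lborel_distr_plus)
    also have "\<dots> = (\<integral>y. f (h + y) \<partial>lborel)" by (rule integral_distr) auto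
    finally show ?thesis by (simp add: add.commute)
  qed
  have intp: "integrable lborel (\<lambda>y. v y * G (y + h))" "integrable lborel (\<lambda>y. v y * G y)" "integrable lborel (\<lambda>y. G y * v (y + h))" for h
  proof -
    have f: "integrable lborel (\<lambda>y. indicator (cball (0::'a) R) y * (A * B) :: real)"
      by (intro integrable_mult_left integrable_real_indicator) (simp_all add: emeasure_lborel_cball_finite[unfolded infinity_ennreal_def])
    have "\<bar>v y * G z\<bar> \<le> indicator (cball (0::'a) R) y * (A * B)" for y z
      using v0[of y] vb[of y] Gb[of z] Ap Bp by (auto simp: indicator_def abs_mult intro!: mult_mono)
    moreover have "\<bar>G y * v z\<bar> \<le> indicator (cball (0::'a) R) y * (A * B)" for y z
    proof -
      have "\<bar>v z\<bar> * \<bar>G y\<bar> \<le> A * B" using vb[of z] Gb[of y] Ap by (intro mult_mono) auto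
      then show ?thesis using G0[of y] by (auto simp: indicator_def abs_mult mult.commute)
    qed
    ultimately show "integrable lborel (\<lambda>y. v y * G (y + h))" "integrable lborel (\<lambda>y. v y * G y)" "integrable lborel (\<lambda>y. G y * v (y + h))"
      using Ap Bp by (auto intro!: Bochner_Integration.integrable_bound[OF f] AE_I2 simp: abs_mult)
  qed
  \<comment> \<open>Shifting \<open>y\<close> by \<open>h\<close> carries the correlation of
    \<open>v\<close> and \<open>G\<close> at \<open>-h\<close> into that of \<open>G\<close> and
    \<open>v\<close> at \<open>h\<close>; the terms without shift agree anyway.\<close>
  define J where "J = (\<lambda>h. \<integral>y. v y * G (y + h) - v y * G y \<partial>lborel)"
  define J' where "J' = (\<lambda>h. \<integral>y. G y * v (y + h) - G y * v y \<partial>lborel)"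
  have JJ: "J (- h) = J' h" for h
  proof -
    have "J (- h) = (\<integral>y. v y * G (y + - h) \<partial>lborel) - (\<integral>y. v y * G y \<partial>lborel)"
      unfolding J_def by (rule Bochner_Integration.integral_diff) (rule intp)+
    also have "(\<integral>y. v y * G (y + - h) \<partial>lborel) = (\<integral>y. v (y + h) * G ((y + h) + - h) \<partial>lborel)"
      by (rule tr[symmetric]) measurable
    also have "\<dots> - (\<integral>y. v y * G y \<partial>lborel) = J' h"
      unfolding J'_def using intp(2) by (subst Bochner_Integration.integral_diff[OF intp(3)]) (auto simp: mult.commute)
    finally show ?thesis .
  qed
  have Jm: "J' \<in> borel_measurable borel" unfolding J'_def
    by measurable
  have "(\<integral>y. v y * ball_defect \<rho> G y \<partial>lborel) = (\<integral>y. (\<integral>h. v y * (I h * (G (y + h) - G y)) \<partial>lborel) \<partial>lborel)"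
    by (simp add: bd)
  also have "\<dots> = (\<integral>h. (\<integral>y. v y * (I h * (G (y + h) - G y)) \<partial>lborel) \<partial>lborel)"
    by (rule lborel_pair.Fubini_integral[OF i1, symmetric])
  also have "\<dots> = (\<integral>h. I h * J h \<partial>lborel)"
  proof -
    have "(\<integral>y. v y * (I h * (G (y + h) - G y)) \<partial>lborel) = I h * J h" for h
    proof -
      have "(\<lambda>y. v y * (I h * (G (y + h) - G y))) = (\<lambda>y. I h * (v y * G (y + h) - v y * G y))"
        by (simp add: algebra_simps)
      then show ?thesis unfolding J_def by (simp only: integral_mult_right_zero)
    qed
    then show ?thesis by simp
  qed
  also have "\<dots> = (LINT h:cball 0 \<rho>|lborel. J' (- h))"
    using JJ[of "- h" for h] by (simp add: set_lebesgue_integral_def I_def)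
  also have "\<dots> = (LINT h:cball 0 \<rho>|lborel. J' h)"
    using Jm by (intro cball_integral_isometry lborel_distr_minus) simp_all
  also have "\<dots> = (\<integral>h. (\<integral>y. G y * (I h * (v (y + h) - v y)) \<partial>lborel) \<partial>lborel)"
  proof -
    have "(\<integral>y. G y * (I h * (v (y + h) - v y)) \<partial>lborel) = I h * J' h" for h
    proof -
      have "(\<lambda>y. G y * (I h * (v (y + h) - v y))) = (\<lambda>y. I h * (G y * v (y + h) - G y * v y))"
        by (simp add: algebra_simps)
      then show ?thesis unfolding J'_def by (simp only: integral_mult_right_zero)
    qed
    then show ?thesis by (simp add: set_lebesgue_integral_def I_def)
  qed
  also have "\<dots> = (\<integral>y. (\<integral>h. G y * (I h * (v (y + h) - v y)) \<partial>lborel) \<partial>lborel)"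
    by (rule lborel_pair.Fubini_integral[OF i2])
  also have "\<dots> = (\<integral>y. G y * ball_defect \<rho> v y \<partial>lborel)" by (simp add: bd)
  finally show "(\<integral>y. v y * ball_defect \<rho> G y \<partial>lborel) = (\<integral>y. G y * ball_defect \<rho> v y \<partial>lborel)" .
qed

subsection \<open>The Newton kernel and its tangential truncation\<close>

lemma powr_derivatives:
  fixes m t :: real assumes "t > 0"
  shows "((\<lambda>t. (-1) ^ k * pochhammer m k * t powr (- m - real k)) has_real_derivative
          (-1) ^ Suc k * pochhammer m (Suc k) * t powr (- m - real (Suc k))) (at t)"
  using assms by (auto intro!: derivative_eq_intros simp: pochhammer_Suc algebra_simps)

lemma powr_taylor:
  fixes m a u :: real
  assumes "a > 0" "a + u > 0" "n > 0"
  obtains t where "min a (a + u) \<le> t" "t \<le> max a (a + u)"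
    "(a + u) powr (- m) = (\<Sum>k<n. (-1) ^ k * pochhammer m k * a powr (- m - real k) / fact k * u ^ k)
       + (-1) ^ n * pochhammer m n * t powr (- m - real n) / fact n * u ^ n"
proof (cases "u = 0")
  case True
  have "(\<Sum>k<n. (-1) ^ k * pochhammer m k * a powr (- m - real k) / fact k * u ^ k) = a powr (- m)"
    using assms True by (cases n) (simp_all add: sum.lessThan_Suc_shift del: sum.lessThan_Suc)
  then show ?thesis using that[of a] True assms by simp
next
  case False
  define diff where "diff = (\<lambda>k t. (-1) ^ k * pochhammer m k * t powr (- m - real k))"
  have "\<exists>t. (if a + u < a then a + u < t \<and> t < a else a < t \<and> t < a + u) \<and>
    (a + u) powr (- m) = (\<Sum>k<n. (diff k a / fact k) * (a + u - a)^k) + (diff n t / fact n) * (a + u - a)^n"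
  proof (rule Taylor[where f="\<lambda>t. t powr (-m)" and a="min a (a+u)" and b="max a (a+u)"])
    show "\<forall>k t. k < n \<and> min a (a + u) \<le> t \<and> t \<le> max a (a + u) \<longrightarrow> (diff k has_real_derivative diff (Suc k) t) (at t)"
      unfolding diff_def using assms by (auto intro!: powr_derivatives[simplified])
  qed (use assms False in \<open>auto simp: diff_def\<close>)
  then obtain t where t: "if a + u < a then a + u < t \<and> t < a else a < t \<and> t < a + u"
     and e: "(a + u) powr (- m) = (\<Sum>k<n. (diff k a / fact k) * (a + u - a)^k) + (diff n t / fact n) * (a + u - a)^n"
    by blast
  have "min a (a + u) \<le> t" "t \<le> max a (a + u)" using t by (auto split: if_splits)
  then show ?thesis using that[of t] e unfolding diff_def by simp
qed

lemma powr_taylor2: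
  fixes m a u :: real
  assumes "a > 0" "a + u > 0"
  obtains t where "min a (a + u) \<le> t" "t \<le> max a (a + u)"
    "(a + u) powr (- m) = a powr (-m) - m * a powr (-m-1) * u + m * (m + 1) / 2 * t powr (-m-2) * u\<^sup>2"
proof -
  obtain t where t: "min a (a + u) \<le> t" "t \<le> max a (a + u)"
    "(a + u) powr (- m) = (\<Sum>k<2. (-1) ^ k * pochhammer m k * a powr (- m - real k) / fact k * u ^ k)
       + (-1) ^ 2 * pochhammer m 2 * t powr (- m - real 2) / fact 2 * u ^ 2"
    using powr_taylor[OF assms, of 2 m] by auto
  have s: "(\<Sum>k<2. (-1) ^ k * pochhammer m k * a powr (- m - real k) / fact k * u ^ k) = a powr (-m) - m * a powr (-m-1) * u"
    by (simp add: numeral_2_eq_2)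
  have p: "pochhammer m 2 = m * (m + 1)" by (simp add: numeral_2_eq_2 pochhammer_Suc)
  have "(a + u) powr (- m) = a powr (-m) - m * a powr (-m-1) * u + m * (m + 1) / 2 * t powr (-m-2) * u\<^sup>2"
    unfolding t(3) s p power2_eq_square[of u] by simp
  then show ?thesis using that t by blast
qed

text \<open>With \<open>\<bar>u\<bar> \<le> b/2\<close> the intermediate point stays above
  \<open>b/2\<close>, where the third derivative is bounded; the constant therefore depends on
  \<open>b\<close> only and not on \<open>a\<close>.\<close>

lemma powr_taylor3:
  fixes m a u b :: real
  assumes "m > 0" "b > 0" "a \<ge> b" "\<bar>u\<bar> \<le> b/2"
  shows "\<bar>(a + u) powr (- m) - a powr (-m) + m * a powr (-m-1) * u - m * (m + 1) / 2 * a powr (-m-2) * u\<^sup>2\<bar>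
     \<le> pochhammer m 3 * (b/2) powr (-m-3) / 6 * \<bar>u\<bar>^3"
proof -
  have p: "a > 0" "a + u > 0" using assms by auto
  obtain t where t: "min a (a + u) \<le> t" "t \<le> max a (a + u)"
    "(a + u) powr (- m) = (\<Sum>k<3. (-1) ^ k * pochhammer m k * a powr (- m - real k) / fact k * u ^ k)
       + (-1) ^ 3 * pochhammer m 3 * t powr (- m - real 3) / fact 3 * u ^ 3"
    using powr_taylor[OF p, of 3 m] by auto
  have "(\<Sum>k<3. (-1) ^ k * pochhammer m k * a powr (- m - real k) / fact k * u ^ k)
     = a powr (-m) - m * a powr (-m-1) * u + m * (m + 1) / 2 * a powr (-m-2) * u\<^sup>2"
    by (simp add: numeral_3_eq_3 pochhammer_Suc power2_eq_square)
  then have e: "(a + u) powr (- m) - a powr (-m) + m * a powr (-m-1) * u - m * (m + 1) / 2 * a powr (-m-2) * u\<^sup>2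
     = - (pochhammer m 3 * t powr (-m-3) / 6 * u^3)" using t(3) by (simp add: fact_numeral)
  have tb: "b / 2 \<le> t" using t(1) assms by (auto simp: min_def split: if_splits)
  have "t powr (-m-3) \<le> (b/2) powr (-m-3)" using tb assms by (intro powr_mono2') auto
  then have "pochhammer m 3 * t powr (-m-3) / 6 * \<bar>u\<bar>^3 \<le> pochhammer m 3 * (b/2) powr (-m-3) / 6 * \<bar>u\<bar>^3"
    using assms by (intro mult_right_mono divide_right_mono mult_left_mono) (auto intro: pochhammer_nonneg)
  moreover have "pochhammer m 3 \<ge> 0" using assms by (intro pochhammer_nonneg) auto
  ultimately show ?thesis unfolding e by (simp add: abs_mult power_abs)
qed

text \<open>As a function of the squared norm this is the Newton kernel outside the ball of radius \<open>sqrt T\<close> and its tangent line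
  inside, so the resulting radial function is only once differentiable on the sphere, but with Lipschitz derivative; that suffices for
  dominated convergence of the rescaled defect.\<close>

definition capped :: "real \<Rightarrow> real \<Rightarrow> real \<Rightarrow> real" where
  "capped m T a = (if a \<le> T then T powr (-m) - m * T powr (-m-1) * (a - T) else a powr (-m))"

lemma capped_alt:
  "capped m T a = max a T powr (-m) - m * T powr (-m-1) * (a - max a T)"
  by (auto simp: capped_def max_def)

lemma continuous_capped: "T > 0 \<Longrightarrow> continuous_on A f \<Longrightarrow> continuous_on A (\<lambda>x. capped m T (f x))"
  unfolding capped_alt by (intro continuous_intros) (auto simp: max_def)

lemma powr_above_tangent:
  fixes m x y :: real
  assumes "m > 0" "x > 0" "y > 0"
  shows "y powr (-m) \<ge> x powr (-m) - m * x powr (-m-1) * (y - x)"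
proof -
  obtain t where "y powr (- m) = x powr (-m) - m * x powr (-m-1) * (y - x) + m * (m + 1) / 2 * t powr (-m-2) * (y - x)\<^sup>2"
    using powr_taylor2[of x "y - x" m] assms by auto
  moreover have "m * (m + 1) / 2 * t powr (-m-2) * (y - x)\<^sup>2 \<ge> 0" using assms by auto
  ultimately show ?thesis by linarith
qed

text \<open>A negative power is convex, so its tangents lie below it, and left of both points of
  contact the tangent touching further left is the larger one. This makes the test function of
  \<open>ball_integral_mono\<close> nonnegative.\<close>

lemma capped_mono:
  assumes "m > 0" "T1 > 0" "T1 \<le> T2"
  shows "capped m T2 a \<le> capped m T1 a"
proof -
  consider "a > T2" | "T1 < a" "a \<le> T2" | "a \<le> T1" by linarith
  then show ?thesis
  proof cases
    case 1 then show ?thesis using assms by (simp add: capped_def)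
  next
    case 2 then show ?thesis using assms powr_above_tangent[of m T2 a] by (simp add: capped_def)
  next
    case 3
    have "T2 powr (-m-1) \<le> T1 powr (-m-1)" using assms by (intro powr_mono2') auto
    then have "(m * T2 powr (-m-1)) * (T1 - a) \<le> (m * T1 powr (-m-1)) * (T1 - a)"
      using assms 3 by (intro mult_right_mono mult_left_mono) auto
    then show ?thesis using assms 3 powr_above_tangent[of m T2 T1] by (simp add: capped_def algebra_simps)
  qed
qed

text \<open>The derivative \<open>- m * max a T powr (-m-1)\<close> is Lipschitz with constant
  \<open>L\<close>. The factor 2 collects two errors of size \<open>L * u\<^sup>2\<close>: the
  Taylor remainder between the clamped points \<open>x\<close> and \<open>y\<close>, and the part of
  the increment \<open>u\<close> that clamping removes.\<close>

lemma capped_second_difference: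
  fixes m T a u :: real
  assumes m: "m > 0" and T: "T > 0"
  defines "L \<equiv> m * (m + 1) * T powr (-m-2)"
  shows "\<bar>capped m T (a + u) - capped m T a - (- m * max a T powr (-m-1)) * u\<bar> \<le> 2 * L * u\<^sup>2"
proof -
  define x where "x = max a T"
  define y where "y = max (a + u) T"
  have xy: "x \<ge> T" "y \<ge> T" "x > 0" "y > 0" using T by (auto simp: x_def y_def)
  have L0: "L \<ge> 0" using m by (simp add: L_def)
  have yx: "\<bar>y - x\<bar> \<le> \<bar>u\<bar>" by (auto simp: x_def y_def)
  obtain t where t: "min x (x + (y - x)) \<le> t" and e: "y powr (-m) = x powr (-m) - m * x powr (-m-1) * (y - x) + m * (m + 1) / 2 * t powr (-m-2) * (y - x)\<^sup>2"
    using powr_taylor2[of x "y - x" m] xy by auto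
  have "t \<ge> T" using t xy by auto
  then have "t powr (-m-2) \<le> T powr (-m-2)" using T m by (intro powr_mono2') auto
  then have "m * (m + 1) / 2 * t powr (-m-2) * (y - x)\<^sup>2 \<le> m * (m + 1) / 2 * T powr (-m-2) * u\<^sup>2"
    using m yx by (intro mult_mono) (auto simp: abs_le_square_iff)
  moreover have "m * (m + 1) / 2 * t powr (-m-2) * (y - x)\<^sup>2 \<ge> 0" using m by auto
  ultimately have A: "\<bar>y powr (-m) - x powr (-m) + m * x powr (-m-1) * (y - x)\<bar> \<le> L * u\<^sup>2"
    using e L0 by (simp add: L_def)
  have B: "\<bar>(m * T powr (-m-1) - m * x powr (-m-1)) * (u - (y - x))\<bar> \<le> L * u\<^sup>2" if "a \<le> T \<longrightarrow> False"
  proof -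
    have xa: "x = a" using that by (auto simp: x_def)
    show ?thesis
    proof (cases "a + u \<ge> T")
      case True then have "u - (y - x) = 0" by (simp add: y_def xa)
      then show ?thesis using L0 by simp
    next
      case False
      then have ux: "\<bar>u - (y - x)\<bar> \<le> \<bar>u\<bar>" "\<bar>x - T\<bar> \<le> \<bar>u\<bar>" using that by (auto simp: y_def xa)
      obtain s where s: "min T (T + (x - T)) \<le> s" "(T + (x - T)) powr (- (m+1)) = T powr (- (m+1)) + -1 * (m+1) * s powr (- (m+1) - 1) * (x - T)"
        using powr_taylor[of T "x - T" 1 "m+1"] xy T by auto
      then have "T \<le> s" using xy by auto
      then have sT: "s powr (-m-2) \<le> T powr (-m-2)" using T m by (intro powr_mono2') auto
      have e2: "m * T powr (-m-1) - m * x powr (-m-1) = m * (m+1) * s powr (-m-2) * (x - T)"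
      proof -
        have "- (m + 1) = - m - 1" "- (m + 1) - 1 = - m - 2" "- 2 - m = - m - 2" by simp_all
        with s(2) have X: "x powr (-m-1) = T powr (-m-1) + (- m - 1) * s powr (-m-2) * (x - T)"
          by simp
        show ?thesis unfolding X by (simp add: algebra_simps)
      qed
      have "\<bar>m * T powr (-m-1) - m * x powr (-m-1)\<bar> \<le> L * \<bar>u\<bar>"
        unfolding e2 L_def abs_mult using sT ux m by (intro mult_mono) auto
      then have "\<bar>m * T powr (-m-1) - m * x powr (-m-1)\<bar> * \<bar>u - (y - x)\<bar> \<le> (L * \<bar>u\<bar>) * \<bar>u\<bar>"
        using ux L0 by (intro mult_mono) auto
      moreover have "(L * \<bar>u\<bar>) * \<bar>u\<bar> = L * u\<^sup>2" by (simp add: power2_eq_square mult.assoc)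
      ultimately show ?thesis unfolding abs_mult by linarith
    qed
  qed
  have B': "\<bar>(m * T powr (-m-1) - m * x powr (-m-1)) * (u - (y - x))\<bar> \<le> L * u\<^sup>2"
  proof (cases "a \<le> T")
    case True then have "x = T" by (simp add: x_def)
    then show ?thesis using L0 by simp
  qed (use B in auto)
  have "capped m T (a + u) - capped m T a - (- m * max a T powr (-m-1)) * u
     = (y powr (-m) - x powr (-m) + m * x powr (-m-1) * (y - x)) - (m * T powr (-m-1) - m * x powr (-m-1)) * (u - (y - x))"
    by (simp add: capped_alt x_def[symmetric] y_def[symmetric] algebra_simps)
  then show ?thesis using A B' by linarith
qed

lemma ball_defect_cong:
  assumes "\<And>x. dist y x \<le> \<rho> \<Longrightarrow> f x = g x" "0 \<le> \<rho>"
  shows "ball_defect \<rho> f y = ball_defect \<rho> g y"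
  unfolding ball_defect_def by (rule set_lebesgue_integral_cong) (use assms in \<open>auto simp: dist_norm\<close>)

text \<open>Junk value: \<open>newton 0 = 0\<close> instead of infinity. Integrals do not see it, and pointwise statements exclude the origin.\<close>

definition newton :: "'a::euclidean_space \<Rightarrow> real" where
  "newton x = (x \<bullet> x) powr (- (DIM('a) / 2 - 1))"

section \<open>Defects of the Newton kernel and of its truncation\<close>

lemma abs_inner_shift:
  fixes y h :: "'a::euclidean_space"
  assumes "norm h \<le> \<rho>" "norm y \<le> N"
  shows "\<bar>h \<bullet> h + 2 * (y \<bullet> h)\<bar> \<le> norm h * (\<rho> + 2 * N)" "\<bar>y \<bullet> h\<bar> \<le> N * norm h"
proof -
  show 1: "\<bar>y \<bullet> h\<bar> \<le> N * norm h"
    using Cauchy_Schwarz_ineq2[of y h] mult_right_mono[OF assms(2), of "norm h"] by simp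
  have "\<bar>h \<bullet> h + 2 * (y \<bullet> h)\<bar> \<le> norm h * norm h + 2 * (N * norm h)"
    unfolding dot_square_norm power2_eq_square using 1 mult_nonneg_nonneg[OF norm_ge_zero norm_ge_zero, of h h] by linarith
  also have "\<dots> \<le> norm h * (\<rho> + 2 * N)" using mult_left_mono[OF assms(1), of "norm h"] by (simp add: algebra_simps)
  finally show "\<bar>h \<bullet> h + 2 * (y \<bullet> h)\<bar> \<le> norm h * (\<rho> + 2 * N)" .
qed

text \<open>Harmonicity in infinitesimal form: the second-order terms cancel and the third-order
  remainder gains a factor \<open>\<rho>\<close> over the ball moment, uniformly on the shell given
  by \<open>b\<close> and \<open>N\<close>. The exact mean value property is obtained later, from
  \<open>subharmonic_on_asymptoticI\<close>.\<close>

lemma newton_defect: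
  fixes b N :: real
  assumes d: "DIM('a::euclidean_space) \<ge> 3" and b: "b > 0" and N: "N \<ge> 0"
  obtains C where "C \<ge> 0"
    "\<And>(y::'a) \<rho>. b \<le> y \<bullet> y \<Longrightarrow> norm y \<le> N \<Longrightarrow> 0 < \<rho> \<Longrightarrow> \<rho> \<le> 1 \<Longrightarrow> \<rho> * (\<rho> + 2 * N) \<le> b / 2 \<Longrightarrow>
       \<bar>ball_defect \<rho> newton y\<bar> \<le> C * \<rho> * ball_moment TYPE('a) \<rho>"
proof -
  define m where "m = DIM('a) / 2 - 1"
  have m: "m > 0" using d by (simp add: m_def)
  define C3 where "C3 = pochhammer m 3 * (b/2) powr (-m-3) / 6"
  have C3: "C3 \<ge> 0" using m b by (auto simp: C3_def intro!: mult_nonneg_nonneg divide_nonneg_nonneg pochhammer_nonneg)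
  define C2 where "C2 = m * (m + 1) / 2 * b powr (-m-2)"
  have C2: "C2 \<ge> 0" using m b by (auto simp: C2_def)
  define C where "C = C3 * (1 + 2 * N)^3 + C2 * (1 + 4 * N)"
  have "\<bar>ball_defect \<rho> newton y\<bar> \<le> C * \<rho> * ball_moment TYPE('a) \<rho>"
    if y: "b \<le> y \<bullet> y" "norm y \<le> N" and r: "0 < \<rho>" "\<rho> \<le> 1" "\<rho> * (\<rho> + 2 * N) \<le> b / 2" for y :: 'a and \<rho>
  proof -
    define a where "a = y \<bullet> y"
    have a: "a \<ge> b" "a > 0" using y b by (auto simp: a_def)
    define p where "p = - m * a powr (-m-1)"
    define q where "q = 2 * m * (m + 1) * a powr (-m-2)"
    have ap: "a powr (-m-2) * a = a powr (-m-1)"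
    proof -
      have "- m - 1 = (- m - 2) + 1" by simp
      then show ?thesis using a by (simp only: powr_add) simp
    qed
    \<comment> \<open>The only place where the exponent matters: \<open>m + 1\<close> is half the
      dimension, so \<open>2 * m * (m + 1) / DIM('a)\<close> equals \<open>m\<close>.\<close>
    have "p + q * a / DIM('a) = - m * (a powr (-m-2) * a) + 2 * m * (m + 1) * (a powr (-m-2) * a) / DIM('a)"
      unfolding p_def q_def ap[symmetric] by (simp add: algebra_simps)
    also have "\<dots> = 0" by (simp add: m_def field_simps)
    finally have pq: "p + q * (y \<bullet> y) / DIM('a) = 0" by (simp add: a_def)
    have est: "\<bar>(y \<bullet> y + (h \<bullet> h + 2 * (y \<bullet> h))) powr (-m) - (y \<bullet> y) powr (-m) - p * (h \<bullet> h + 2 * (y \<bullet> h)) - q * (y \<bullet> h)\<^sup>2\<bar> \<le> C * \<rho> * (h \<bullet> h)"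
      if h: "norm h \<le> \<rho>" for h
    proof -
      define u where "u = h \<bullet> h + 2 * (y \<bullet> h)"
      note sh = abs_inner_shift[OF h y(2), folded u_def]
      have hh: "h \<bullet> h = norm h * norm h" by (simp add: dot_square_norm power2_eq_square)
      have u1: "\<bar>u\<bar> \<le> norm h * (1 + 2 * N)" using sh(1) r N by (smt (verit) mult_left_mono norm_ge_zero)
      have "norm h * (\<rho> + 2 * N) \<le> \<rho> * (\<rho> + 2 * N)" using h r N by (intro mult_right_mono) auto
      then have u2: "\<bar>u\<bar> \<le> b / 2" using sh(1) r by linarith
      have T: "\<bar>(a + u) powr (- m) - a powr (-m) + m * a powr (-m-1) * u - m * (m + 1) / 2 * a powr (-m-2) * u\<^sup>2\<bar> \<le> C3 * \<bar>u\<bar>^3"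
        unfolding C3_def by (rule powr_taylor3[OF m b a(1) u2])
      have u3: "\<bar>u\<bar>^3 \<le> (h \<bullet> h) * \<rho> * (1 + 2 * N)^3"
      proof -
        have "\<bar>u\<bar>^3 \<le> (norm h * (1 + 2 * N))^3" using u1 by (intro power_mono) auto
        also have "\<dots> = (norm h * norm h) * norm h * (1 + 2 * N)^3" by (simp add: power3_eq_cube)
        also have "\<dots> \<le> (norm h * norm h) * \<rho> * (1 + 2 * N)^3" using h N by (intro mult_right_mono mult_left_mono) auto
        finally show ?thesis by (simp add: hh)
      qed
      have qd: "\<bar>m * (m + 1) / 2 * a powr (-m-2) * u\<^sup>2 - q * (y \<bullet> h)\<^sup>2\<bar> \<le> C2 * (\<rho> * (1 + 4 * N) * (h \<bullet> h))"
      proof -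
        define c where "c = m * (m + 1) / 2 * a powr (-m-2)"
        have q: "q = 4 * c" by (simp add: q_def c_def)
        have "c * u\<^sup>2 - q * (y \<bullet> h)\<^sup>2 = c * ((h \<bullet> h + 4 * (y \<bullet> h)) * (h \<bullet> h))"
          by (simp add: q u_def power2_eq_square algebra_simps)
        moreover have "\<bar>h \<bullet> h + 4 * (y \<bullet> h)\<bar> \<le> \<rho> * (1 + 4 * N)"
        proof -
          have "\<bar>h \<bullet> h + 4 * (y \<bullet> h)\<bar> \<le> norm h * norm h + 4 * (N * norm h)"
            unfolding hh using sh(2) mult_nonneg_nonneg[OF norm_ge_zero norm_ge_zero, of h h] by linarith
          also have "\<dots> \<le> \<rho> * 1 + 4 * (N * \<rho>)" using h r N by (intro add_mono mult_mono mult_left_mono) auto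
          finally show ?thesis by (simp add: algebra_simps)
        qed
        moreover have "c \<le> C2" "0 \<le> c"
          unfolding C2_def c_def using m a b by (auto intro!: mult_left_mono powr_mono2')
        ultimately have "\<bar>c * u\<^sup>2 - q * (y \<bullet> h)\<^sup>2\<bar> \<le> C2 * (\<rho> * (1 + 4 * N) * (h \<bullet> h))"
          by (auto simp: abs_mult intro!: mult_mono)
        then show ?thesis by (simp add: c_def)
      qed
      have "\<bar>(a + u) powr (-m) - a powr (-m) - p * u - q * (y \<bullet> h)\<^sup>2\<bar> \<le> C3 * \<bar>u\<bar>^3 + C2 * (\<rho> * (1 + 4 * N) * (h \<bullet> h))"
        using T qd unfolding p_def by linarith
      also have "\<dots> \<le> C3 * ((h \<bullet> h) * \<rho> * (1 + 2 * N)^3) + C2 * (\<rho> * (1 + 4 * N) * (h \<bullet> h))"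
        using mult_left_mono[OF u3 C3] by simp
      also have "\<dots> = C * \<rho> * (h \<bullet> h)" by (simp add: C_def algebra_simps)
      finally show ?thesis unfolding a_def u_def .
    qed
    have x0: "x \<bullet> x > 0" if "x \<in> cball y \<rho>" for x
    proof -
      have nh: "norm (x - y) \<le> \<rho>" using that by (simp add: dist_norm norm_minus_commute)
      have "x \<bullet> x = y \<bullet> y + ((x - y) \<bullet> (x - y) + 2 * (y \<bullet> (x - y)))" by (simp add: inner_simps inner_commute)
      moreover have "norm (x - y) * (\<rho> + 2 * N) \<le> \<rho> * (\<rho> + 2 * N)" using nh r N by (intro mult_right_mono) auto
      ultimately show ?thesis using abs_inner_shift(1)[OF nh y(2)] r y b by linarith
    qed
    have "continuous_on (cball y \<rho>) (\<lambda>x. (x \<bullet> x) powr (-m))"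
      by (intro continuous_intros) (use x0 in force)
    from ball_defect_radial[OF this est] pq show ?thesis by (simp add: newton_def[abs_def] m_def)
  qed
  moreover have "C \<ge> 0" using C2 C3 N by (simp add: C_def)
  ultimately show ?thesis using that by blast
qed

text \<open>Taking \<open>q = 0\<close> uses only the Lipschitz derivative, so the bound is valid
  across the sphere where the second derivative jumps. It is the majorant for dominated convergence;
  the pointwise limit is a separate matter.\<close>

lemma capped_defect_bound:
  fixes y :: "'a::euclidean_space"
  assumes m: "m > 0" and T: "T > 0" and y: "norm y \<le> N"
  shows "\<bar>ball_defect \<rho> (\<lambda>x. capped m T (x \<bullet> x)) y - ball_moment TYPE('a) \<rho> * (- m * max (y \<bullet> y) T powr (-m-1))\<bar>
     \<le> 2 * (m * (m + 1) * T powr (-m-2)) * (\<rho> + 2 * N)\<^sup>2 * ball_moment TYPE('a) \<rho>"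
proof -
  define L where "L = m * (m + 1) * T powr (-m-2)"
  have L: "L \<ge> 0" using m by (simp add: L_def)
  have "\<bar>ball_defect \<rho> (\<lambda>x. capped m T (x \<bullet> x)) y - ball_moment TYPE('a) \<rho> * (- m * max (y \<bullet> y) T powr (-m-1) + 0 * (y \<bullet> y) / DIM('a))\<bar>
     \<le> (2 * L * (\<rho> + 2 * N)\<^sup>2) * ball_moment TYPE('a) \<rho>"
  proof (rule ball_defect_radial)
    show "continuous_on (cball y \<rho>) (\<lambda>x. capped m T (x \<bullet> x))" by (intro continuous_capped T continuous_intros)
    fix h :: 'a assume h: "norm h \<le> \<rho>"
    define u where "u = h \<bullet> h + 2 * (y \<bullet> h)"
    have "u\<^sup>2 \<le> (norm h * (\<rho> + 2 * N))\<^sup>2"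
      using power_mono[OF abs_inner_shift(1)[OF h y], of 2] by (simp add: u_def)
    then have "2 * L * u\<^sup>2 \<le> 2 * L * ((\<rho> + 2 * N)\<^sup>2 * (h \<bullet> h))"
      using L by (intro mult_left_mono) (auto simp: power_mult_distrib dot_square_norm mult.commute)
    then show "\<bar>capped m T (y \<bullet> y + (h \<bullet> h + 2 * (y \<bullet> h))) - capped m T (y \<bullet> y) -
            - m * max (y \<bullet> y) T powr (- m - 1) * (h \<bullet> h + 2 * (y \<bullet> h)) - 0 * (y \<bullet> h)\<^sup>2\<bar> \<le> 2 * L * (\<rho> + 2 * N)\<^sup>2 * (h \<bullet> h)"
      using capped_second_difference[OF m T, of "y \<bullet> y" u] by (simp add: u_def L_def mult.assoc)
  qed
  then show ?thesis by (simp add: L_def)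
qed

lemma capped_defect_inside:
  fixes y :: "'a::euclidean_space"
  assumes T: "T > 0" and y: "\<rho> * (\<rho> + 2 * norm y) \<le> T - y \<bullet> y" and r: "\<rho> > 0"
  shows "ball_defect \<rho> (\<lambda>x. capped m T (x \<bullet> x)) y = ball_moment TYPE('a) \<rho> * (- m * T powr (-m-1))"
proof -
  have "\<bar>ball_defect \<rho> (\<lambda>x. capped m T (x \<bullet> x)) y - ball_moment TYPE('a) \<rho> * (- m * T powr (-m-1) + 0 * (y \<bullet> y) / DIM('a))\<bar>
     \<le> 0 * ball_moment TYPE('a) \<rho>"
  proof (rule ball_defect_radial)
    show "continuous_on (cball y \<rho>) (\<lambda>x. capped m T (x \<bullet> x))" by (intro continuous_capped T continuous_intros)
    fix h :: 'a assume h: "norm h \<le> \<rho>"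
    have "norm h * (\<rho> + 2 * norm y) \<le> \<rho> * (\<rho> + 2 * norm y)" using h r by (intro mult_right_mono) auto
    then have "\<bar>h \<bullet> h + 2 * (y \<bullet> h)\<bar> \<le> T - y \<bullet> y" using abs_inner_shift(1)[OF h order_refl, of y] y by linarith
    then show "\<bar>capped m T (y \<bullet> y + (h \<bullet> h + 2 * (y \<bullet> h))) - capped m T (y \<bullet> y) -
            - m * T powr (- m - 1) * (h \<bullet> h + 2 * (y \<bullet> h)) - 0 * (y \<bullet> h)\<^sup>2\<bar> \<le> 0 * (h \<bullet> h)"
    proof -
      assume "\<bar>h \<bullet> h + 2 * (y \<bullet> h)\<bar> \<le> T - y \<bullet> y"
      then have "y \<bullet> y + (h \<bullet> h + 2 * (y \<bullet> h)) \<le> T" "y \<bullet> y \<le> T" by linarith+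
      then show ?thesis by (simp only: capped_def if_True) (simp add: algebra_simps)
    qed
  qed
  then show ?thesis by simp
qed

text \<open>Inside the ball the function is affine in the squared norm and the quotient is
  eventually constant; outside it is eventually the Newton kernel, with quotient of order
  \<open>\<rho>\<close>. The sphere between is left out, since null sets do not count later.\<close>

lemma capped_defect_tendsto:
  fixes y :: "'a::euclidean_space"
  assumes d: "DIM('a) \<ge> 3" and T: "T > 0" and ne: "y \<bullet> y \<noteq> T" 
    and \<rho>: "\<rho> \<longlonglongrightarrow> 0" "\<And>n. \<rho> n > 0"
  defines "m \<equiv> DIM('a) / 2 - 1"
  shows "(\<lambda>n. ball_defect (\<rho> n) (\<lambda>x. capped m T (x \<bullet> x)) y / ball_moment TYPE('a) (\<rho> n))
     \<longlonglongrightarrow> (if y \<bullet> y \<le> T then - m * T powr (-m-1) else 0)"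
proof -
  have M: "ball_moment TYPE('a) (\<rho> n) > 0" for n using \<rho>(2) by (rule ball_moment_pos)
  have small: "\<forall>\<^sub>F n in sequentially. \<rho> n * (\<rho> n + 2 * norm y) \<le> c" if "c > 0" for c
  proof -
    have "(\<lambda>n. \<rho> n * (\<rho> n + 2 * norm y)) \<longlonglongrightarrow> 0 * (0 + 2 * norm y)" by (intro tendsto_intros \<rho>)
    then have "\<forall>\<^sub>F n in sequentially. \<rho> n * (\<rho> n + 2 * norm y) < c" using that by (intro order_tendstoD(2)) auto
    then show ?thesis by eventually_elim simp
  qed
  show ?thesis
  proof (cases "y \<bullet> y < T")
    case True
    have "\<forall>\<^sub>F n in sequentially. ball_defect (\<rho> n) (\<lambda>x. capped m T (x \<bullet> x)) y / ball_moment TYPE('a) (\<rho> n) = - m * T powr (-m-1)"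
      using small[of "T - y \<bullet> y", simplified, OF True]
    proof eventually_elim
      case (elim n) then show ?case using capped_defect_inside[OF T elim \<rho>(2), of m] True M[of n] by simp
    qed
    then show ?thesis using True by (simp add: tendsto_eventually)
  next
    case False
    define b where "b = y \<bullet> y"
    have b: "b > T" "b > 0" using False ne T by (auto simp: b_def)
    obtain C where C: "C \<ge> 0" and H: "\<And>(x::'a) \<rho>. b \<le> x \<bullet> x \<Longrightarrow> norm x \<le> norm y \<Longrightarrow> 0 < \<rho> \<Longrightarrow> \<rho> \<le> 1 \<Longrightarrow> \<rho> * (\<rho> + 2 * norm y) \<le> b / 2 \<Longrightarrow>
       \<bar>ball_defect \<rho> newton x\<bar> \<le> C * \<rho> * ball_moment TYPE('a) \<rho>"
      using newton_defect[OF d b(2), of "norm y"] by auto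
    have "\<forall>\<^sub>F n in sequentially. \<rho> n < 1" using \<rho>(1) by (rule order_tendstoD) simp
    then have "\<forall>\<^sub>F n in sequentially. norm (ball_defect (\<rho> n) (\<lambda>x. capped m T (x \<bullet> x)) y / ball_moment TYPE('a) (\<rho> n)) \<le> C * \<rho> n"
      using small[of "b/2", simplified, OF b(2)] small[of "b - T", simplified, OF b(1)] 
    proof eventually_elim
      case (elim n)
      have "ball_defect (\<rho> n) (\<lambda>x. capped m T (x \<bullet> x)) y = ball_defect (\<rho> n) newton y"
      proof (rule ball_defect_cong)
        fix x assume "dist y x \<le> \<rho> n"
        then have nh: "norm (x - y) \<le> \<rho> n" by (simp add: dist_norm norm_minus_commute)
        have "x \<bullet> x = y \<bullet> y + ((x - y) \<bullet> (x - y) + 2 * (y \<bullet> (x - y)))" by (simp add: inner_simps inner_commute)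
        moreover have "norm (x - y) * (\<rho> n + 2 * norm y) \<le> \<rho> n * (\<rho> n + 2 * norm y)" using nh \<rho>(2)[of n] by (intro mult_right_mono) auto
        ultimately have "x \<bullet> x \<ge> T" using abs_inner_shift(1)[OF nh order_refl, of y] elim by (simp add: b_def)
        then show "capped m T (x \<bullet> x) = newton x" by (auto simp: capped_def newton_def m_def)
      qed (use \<rho>(2)[of n] in simp)
      then show ?case using H[of y "\<rho> n"] elim \<rho>(2)[of n] M[of n] by (simp add: b_def field_simps)
    qed
    moreover have "(\<lambda>n. C * \<rho> n) \<longlonglongrightarrow> 0" using tendsto_mult_right_zero[OF \<rho>(1)] .
    ultimately have "(\<lambda>n. ball_defect (\<rho> n) (\<lambda>x. capped m T (x \<bullet> x)) y / ball_moment TYPE('a) (\<rho> n)) \<longlonglongrightarrow> 0"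
      by (rule Lim_null_comparison)
    then show ?thesis using b by (simp add: b_def)
  qed
qed

subsection \<open>From local to global mean value inequalities\<close>

lemma AE_inner_neq: 
  assumes "T > 0" shows "AE y::'a::euclidean_space in lborel. y \<bullet> y \<noteq> T"
proof -
  have "sphere (0::'a) (sqrt T) \<in> null_sets lebesgue" using negligible_sphere negligible_iff_null_sets by blast
  moreover have "sphere (0::'a) (sqrt T) \<in> sets lborel" by (auto intro: borel_closed)
  ultimately have "sphere (0::'a) (sqrt T) \<in> null_sets lborel" by (simp add: null_sets_completion_iff)
  then have "AE y::'a in lborel. y \<notin> sphere 0 (sqrt T)" by (rule AE_not_in)
  then show ?thesis
    by eventually_elim (use assms in \<open>auto simp: norm_eq_sqrt_inner\<close>)
qed

text \<open>The exponent is minus half the dimension. Hence the limiting defect of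
  \<open>capped\<close> at \<open>T = s\<^sup>2\<close> carries precisely the factor
  \<open>1 / s ^ DIM('a)\<close> that normalizes a ball mean.\<close>

lemma powr_radius:
  assumes "s > 0" shows "(s\<^sup>2) powr (- (DIM('a::euclidean_space) / 2 - 1) - 1) = 1 / s ^ DIM('a)"
proof -
  have "(s\<^sup>2) powr (- (DIM('a) / 2 - 1) - 1) = (s powr 2) powr (- (DIM('a) / 2))"
    using assms by (simp add: powr_numeral)
  also have "\<dots> = s powr (- real DIM('a))" by (simp add: powr_powr)
  also have "\<dots> = 1 / s ^ DIM('a)" using assms by (simp add: powr_minus_divide powr_realpow)
  finally show ?thesis .
qed

text \<open>Test function: \<open>G\<close> is the difference of the Newton kernels capped at radii \<open>s\<close> and \<open>r\<close>. It is nonnegative with support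
  in the larger ball, and its rescaled defect converges to the difference of the normalized indicators of the two balls. Moving the defect from
  \<open>v\<close> to \<open>G\<close> thus gives the mean value inequality without Poisson kernels or polar coordinates.\<close>

lemma ball_integral_mono:
  fixes v :: "'a::euclidean_space \<Rightarrow> real"
  assumes d: "DIM('a) \<ge> 3" and s: "0 < s" "s < r" and r: "r < R" and v: "continuous_on (cball 0 R) v"
    and hyp: "\<And>e. e > 0 \<Longrightarrow> \<exists>\<rho>0>0. \<forall>\<rho> y. 0 < \<rho> \<and> \<rho> < \<rho>0 \<and> norm y \<le> r \<longrightarrow> ball_defect \<rho> v y \<ge> - e * ball_moment TYPE('a) \<rho>"
  shows "(LINT y:cball 0 s|lborel. v y) / s ^ DIM('a) \<le> (LINT y:cball 0 r|lborel. v y) / r ^ DIM('a)"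
proof -
  define m where "m = DIM('a) / 2 - 1"
  have m: "m > 0" using d by (simp add: m_def)
  have r0: "0 < r" using s by simp
  \<comment> \<open>Cutting \<open>v\<close> off outside radius \<open>R\<close> makes duality
    applicable. Once \<open>\<rho>\<close> is below \<open>R - r\<close>, the cut is not seen by the
    defect at points of the support of \<open>G\<close>.\<close>
  define w where "w = (\<lambda>y. indicator (cball 0 R) y * v y)"
  define G where "G = (\<lambda>y::'a. capped m (s\<^sup>2) (y \<bullet> y) - capped m (r\<^sup>2) (y \<bullet> y))"
  have sr2: "s\<^sup>2 > 0" "r\<^sup>2 > 0" "s\<^sup>2 \<le> r\<^sup>2" using s by (auto intro: power_mono)
  have Gc: "continuous_on A G" for A
    unfolding G_def by (intro continuous_intros continuous_capped sr2)
  have Gm[measurable]: "G \<in> borel_measurable borel" by (rule borel_measurable_continuous_onI[OF Gc])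
  have wm[measurable]: "w \<in> borel_measurable borel"
    using borel_measurable_continuous_on_indicator[OF _ v] by (simp add: w_def)
  have G0: "G y \<ge> 0" for y using capped_mono[OF m sr2(1,3)] by (simp add: G_def)
  have Gz: "G y = 0" if "norm y > r" for y
  proof -
    have "r\<^sup>2 < (norm y)\<^sup>2" using that r0 by (intro power_strict_mono) auto
    then have "y \<bullet> y > r\<^sup>2" by (simp add: dot_square_norm)
    then show ?thesis using sr2 by (simp add: G_def capped_def)
  qed
  obtain B where B: "\<And>y. y \<in> cball 0 r \<Longrightarrow> norm (G y) \<le> B"
    using compact_imp_bounded[OF compact_continuous_image[OF Gc compact_cball]] unfolding bounded_iff by (metis imageI)
  have Gb: "\<bar>G y\<bar> \<le> \<bar>B\<bar>" for y
    using B[of y] Gz[of y] by (cases "norm y \<le> r") auto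
  obtain A where A: "\<And>y. y \<in> cball 0 R \<Longrightarrow> norm (v y) \<le> A"
    using compact_imp_bounded[OF compact_continuous_image[OF v compact_cball]] unfolding bounded_iff by (metis imageI)
  have wb: "\<bar>w y\<bar> \<le> \<bar>A\<bar>" for y using A[of y] by (cases "y \<in> cball 0 R") (auto simp: w_def)
  have wz: "w y = 0" if "norm y > R" for y using that by (simp add: w_def)
  have GzR: "G y = 0" if "norm y > R" for y using Gz[of y] that r by simp
  have Gint: "integrable lborel G"
  proof -
    have "integrable lborel (\<lambda>y. indicat_real (cball 0 r) y *\<^sub>R G y)" by (rule borel_integrable_compact) (auto intro: Gc)
    moreover have "(\<lambda>y. indicat_real (cball 0 r) y *\<^sub>R G y) = G" using Gz by (auto simp: indicator_def fun_eq_iff not_le)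
    ultimately show ?thesis by simp
  qed
  define l where "l = (\<lambda>y::'a. (if y \<bullet> y \<le> s\<^sup>2 then - m * (1 / s ^ DIM('a)) else 0) - (if y \<bullet> y \<le> r\<^sup>2 then - m * (1 / r ^ DIM('a)) else 0))"
  define K where "K = (\<lambda>T. m * T powr (-m-1) + 2 * (m * (m + 1) * T powr (-m-2)) * (1 + 2 * R)\<^sup>2)"
  have ps: "(s\<^sup>2) powr (-m-1) = 1 / s ^ DIM('a)" "(r\<^sup>2) powr (-m-1) = 1 / r ^ DIM('a)"
    unfolding m_def using powr_radius s(1) r0 by blast+
  have lim: "- e * integral\<^sup>L lborel G \<le> integral\<^sup>L lborel (\<lambda>y. w y * l y)" if e: "e > 0" for e
  proof -
    obtain \<rho>0 where \<rho>0: "\<rho>0 > 0" "\<And>\<rho> y. 0 < \<rho> \<Longrightarrow> \<rho> < \<rho>0 \<Longrightarrow> norm y \<le> r \<Longrightarrow> ball_defect \<rho> v y \<ge> - e * ball_moment TYPE('a) \<rho>"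
      using hyp[OF e] by blast
    define c where "c = min (min \<rho>0 (R - r)) 1"
    have c: "c > 0" "c \<le> \<rho>0" "c \<le> R - r" "c \<le> 1" using \<rho>0 r by (auto simp: c_def)
    define \<rho> where "\<rho> = (\<lambda>n. c * inverse (real (Suc (Suc n))))"
    have \<rho>: "\<rho> n > 0" "\<rho> n < c" for n
    proof -
      show "\<rho> n > 0" using c by (simp add: \<rho>_def)
      have "c * inverse (real (Suc (Suc n))) < c * 1" using c by (intro mult_strict_left_mono) (auto simp: inverse_less_1_iff)
      then show "\<rho> n < c" by (simp add: \<rho>_def)
    qed
    have \<rho>l: "\<rho> \<longlonglongrightarrow> 0" unfolding \<rho>_def
      by (rule tendsto_mult_right_zero) (rule LIMSEQ_Suc[OF LIMSEQ_inverse_real_of_nat])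
    define M where "M = (\<lambda>n. ball_moment TYPE('a) (\<rho> n))"
    have M: "M n > 0" for n unfolding M_def using \<rho>(1) by (rule ball_moment_pos)
    define q where "q = (\<lambda>n y. ball_defect (\<rho> n) G y / M n)"
    have qs: "q n y = ball_defect (\<rho> n) (\<lambda>x. capped m (s\<^sup>2) (x \<bullet> x)) y / M n - ball_defect (\<rho> n) (\<lambda>x. capped m (r\<^sup>2) (x \<bullet> x)) y / M n" for n y
    proof -
      have "ball_defect (\<rho> n) G y = ball_defect (\<rho> n) (\<lambda>x. capped m (s\<^sup>2) (x \<bullet> x)) y - ball_defect (\<rho> n) (\<lambda>x. capped m (r\<^sup>2) (x \<bullet> x)) y"
        unfolding ball_defect_def
        by (subst set_integral_diff(2)[symmetric])
           (auto intro!: cball_integrable_continuous continuous_intros continuous_capped sr2 simp: G_def algebra_simps)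
      then show ?thesis by (simp add: q_def diff_divide_distrib)
    qed
    have qb1: "\<bar>ball_defect (\<rho> n) (\<lambda>x. capped m T (x \<bullet> x)) y / M n\<bar> \<le> K T" if T: "T > 0" and y: "norm y \<le> R" for T n and y :: 'a
    proof -
      have "(\<rho> n + 2 * R)\<^sup>2 \<le> (1 + 2 * R)\<^sup>2" using \<rho>[of n] c r r0 by (intro power_mono) auto
      then have 1: "2 * (m * (m + 1) * T powr (-m-2)) * (\<rho> n + 2 * R)\<^sup>2 \<le> 2 * (m * (m + 1) * T powr (-m-2)) * (1 + 2 * R)\<^sup>2"
        using m by (intro mult_left_mono) auto
      have "max (y \<bullet> y) T powr (-m-1) \<le> T powr (-m-1)" using m T by (intro powr_mono2') auto
      then have 2: "\<bar>- m * max (y \<bullet> y) T powr (-m-1)\<bar> \<le> m * T powr (-m-1)" using m by (simp add: abs_mult)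
      have "\<bar>ball_defect (\<rho> n) (\<lambda>x. capped m T (x \<bullet> x)) y / M n - (- m * max (y \<bullet> y) T powr (-m-1))\<bar>
         = \<bar>ball_defect (\<rho> n) (\<lambda>x. capped m T (x \<bullet> x)) y - M n * (- m * max (y \<bullet> y) T powr (-m-1))\<bar> / M n"
        using M[of n] by (simp add: abs_divide[symmetric] field_simps)
      also have "\<dots> \<le> 2 * (m * (m + 1) * T powr (-m-2)) * (\<rho> n + 2 * R)\<^sup>2"
        using capped_defect_bound[OF m T y, of "\<rho> n"] M[of n] unfolding M_def by (simp only: pos_divide_le_eq)
      finally show ?thesis using 1 2 unfolding K_def by linarith
    qed
    have qm: "(\<lambda>y. q n y) \<in> borel_measurable borel" for n
    proof -
      have "(\<lambda>y. ball_defect (\<rho> n) G y) = (\<lambda>y. \<integral>h. indicator (cball 0 (\<rho> n)) h * (G (y + h) - G y) \<partial>lborel)"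
        by (simp add: ball_defect_def set_lebesgue_integral_def)
      moreover have "(\<lambda>y. \<integral>h. indicator (cball 0 (\<rho> n)) h * (G (y + h) - G y) \<partial>lborel) \<in> borel_measurable borel" by measurable
      ultimately show ?thesis unfolding q_def by simp
    qed
    have lm: "l \<in> borel_measurable borel" unfolding l_def by measurable
    have conv: "(\<lambda>n. \<integral>y. w y * q n y \<partial>lborel) \<longlonglongrightarrow> (\<integral>y. w y * l y \<partial>lborel)"
    proof (rule integral_dominated_convergence[where w="\<lambda>y. indicator (cball 0 R) y * (\<bar>A\<bar> * (K (s\<^sup>2) + K (r\<^sup>2)))"])
      show "(\<lambda>y. w y * l y) \<in> borel_measurable lborel" using lm by simp
      show "(\<lambda>y. w y * q n y) \<in> borel_measurable lborel" for n using qm[of n] by simp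
      show "integrable lborel (\<lambda>y::'a. indicator (cball 0 R) y * (\<bar>A\<bar> * (K (s\<^sup>2) + K (r\<^sup>2))))"
        by (intro integrable_mult_left integrable_real_indicator) (simp_all add: emeasure_lborel_cball_finite[unfolded infinity_ennreal_def])
      show "AE y in lborel. norm (w y * q n y) \<le> indicator (cball 0 R) y * (\<bar>A\<bar> * (K (s\<^sup>2) + K (r\<^sup>2)))" for n
      proof (intro AE_I2)
        fix y :: 'a
        show "norm (w y * q n y) \<le> indicator (cball 0 R) y * (\<bar>A\<bar> * (K (s\<^sup>2) + K (r\<^sup>2)))"
        proof (cases "norm y \<le> R")
          case True
          have "\<bar>q n y\<bar> \<le> K (s\<^sup>2) + K (r\<^sup>2)" unfolding qs using qb1[OF sr2(1) True, of n] qb1[OF sr2(2) True, of n] by linarith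
          then have "\<bar>w y\<bar> * \<bar>q n y\<bar> \<le> \<bar>A\<bar> * (K (s\<^sup>2) + K (r\<^sup>2))" using wb[of y] by (intro mult_mono) auto
          then show ?thesis using True by (simp add: abs_mult)
        qed (simp add: wz)
      qed
      show "AE y in lborel. (\<lambda>n. w y * q n y) \<longlonglongrightarrow> w y * l y"
        using AE_inner_neq[OF sr2(1)] AE_inner_neq[OF sr2(2)]
      proof eventually_elim
        case (elim y)
        have t: "(\<lambda>n. ball_defect (\<rho> n) (\<lambda>x. capped m T (x \<bullet> x)) y / M n) \<longlonglongrightarrow> (if y \<bullet> y \<le> T then - m * T powr (-m-1) else 0)"
          if "T > 0" "y \<bullet> y \<noteq> T" for T
          unfolding M_def m_def by (rule capped_defect_tendsto[OF d that \<rho>l \<rho>(1)])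
        have "(\<lambda>n. q n y) \<longlonglongrightarrow> l y"
          using tendsto_diff[OF t[OF sr2(1) elim(1)] t[OF sr2(2) elim(2)]] unfolding qs l_def ps .
        then show ?case by (intro tendsto_intros)
      qed
    qed
    \<comment> \<open>Duality moves the defect onto \<open>w\<close>, where the hypothesis bounds it
      from below; \<open>G \<ge> 0\<close> preserves the inequality. Dividing by the ball moment
      removes the scale.\<close>
    have low: "- e * integral\<^sup>L lborel G \<le> (\<integral>y. w y * q n y \<partial>lborel)" for n
    proof -
      have dual: "(\<integral>y. w y * ball_defect (\<rho> n) G y \<partial>lborel) = (\<integral>y. G y * ball_defect (\<rho> n) w y \<partial>lborel)"
        "integrable lborel (\<lambda>y. G y * ball_defect (\<rho> n) w y)"
        by (rule ball_defect_duality[OF wm Gm wb wz Gb GzR]; assumption)+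
      have "- e * M n * integral\<^sup>L lborel G = (\<integral>y. G y * (- e * M n) \<partial>lborel)" by simp
      also have "\<dots> \<le> (\<integral>y. G y * ball_defect (\<rho> n) w y \<partial>lborel)"
      proof (rule Bochner_Integration.integral_mono)
        show "integrable lborel (\<lambda>y. G y * (- e * M n))" using Gint by (rule integrable_mult_left)
        show "G y * (- e * M n) \<le> G y * ball_defect (\<rho> n) w y" for y
        proof (cases "norm y \<le> r")
          case True
          have "ball_defect (\<rho> n) w y = ball_defect (\<rho> n) v y"
          proof (rule ball_defect_cong)
            fix x assume "dist y x \<le> \<rho> n"
            then have "norm x \<le> norm y + \<rho> n" using norm_triangle_ineq2[of x y] by (simp add: dist_norm norm_minus_commute)
            then show "w x = v x" using True \<rho>[of n] c by (simp add: w_def)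
          qed (use \<rho>[of n] in simp)
          moreover have "ball_defect (\<rho> n) v y \<ge> - e * M n" unfolding M_def using \<rho>[of n] c True by (intro \<rho>0) auto
          ultimately show ?thesis using G0[of y] by (intro mult_left_mono) auto
        qed (use Gz[of y] in simp)
      qed (rule dual)
      also have "\<dots> = (\<integral>y. w y * q n y * M n \<partial>lborel)" using M[of n] by (simp add: dual(1)[symmetric] q_def)
      also have "\<dots> = (\<integral>y. w y * q n y \<partial>lborel) * M n" by simp
      finally have "(- e * integral\<^sup>L lborel G) * M n \<le> (\<integral>y. w y * q n y \<partial>lborel) * M n" by (simp add: mult_ac)
      then show ?thesis using M[of n] by (simp only: mult_le_cancel_right_pos)
    qed
    show ?thesis by (rule LIMSEQ_le_const[OF conv]) (use low in blast)
  qed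
  have "0 \<le> integral\<^sup>L lborel (\<lambda>y. w y * l y)"
  proof (rule ccontr)
    assume neg: "\<not> 0 \<le> integral\<^sup>L lborel (\<lambda>y. w y * l y)"
    define X where "X = - integral\<^sup>L lborel (\<lambda>y. w y * l y)"
    have X: "X > 0" using neg by (simp add: X_def)
    have g: "0 \<le> integral\<^sup>L lborel G" by (rule Bochner_Integration.integral_nonneg) (rule G0)
    define e where "e = X / (2 * (integral\<^sup>L lborel G + 1))"
    have "e > 0" using X g by (simp add: e_def)
    from lim[OF this] have "X \<le> e * integral\<^sup>L lborel G" by (simp add: X_def)
    also have "\<dots> \<le> e * (integral\<^sup>L lborel G + 1)" using \<open>e > 0\<close> by simp
    also have "\<dots> = X / 2" using g by (simp add: e_def field_simps)
    finally show False using X by simp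
  qed
  also have "integral\<^sup>L lborel (\<lambda>y. w y * l y) = m * ((LINT y:cball 0 r|lborel. v y) / r ^ DIM('a) - (LINT y:cball 0 s|lborel. v y) / s ^ DIM('a))"
  proof -
    have le: "y \<bullet> y \<le> t\<^sup>2 \<longleftrightarrow> y \<in> cball 0 t" if "t > 0" for y :: 'a and t
      using that by (simp add: dot_square_norm power2_le_iff_abs_le)
    have i: "set_integrable lborel (cball 0 t) v" if "t \<le> R" for t
      by (rule cball_integrable_continuous) (rule continuous_on_subset[OF v], use that in auto)
    have "w y * l y = (indicator (cball 0 r) y *\<^sub>R v y) * (m / r ^ DIM('a)) - (indicator (cball 0 s) y *\<^sub>R v y) * (m / s ^ DIM('a))" for y
      using s r by (auto simp: w_def l_def le[OF s(1)] le[OF r0] indicator_def algebra_simps)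
    then have "integral\<^sup>L lborel (\<lambda>y. w y * l y) = (LINT y:cball 0 r|lborel. v y) * (m / r ^ DIM('a)) - (LINT y:cball 0 s|lborel. v y) * (m / s ^ DIM('a))"
      using i[of r, unfolded set_integrable_def] i[of s, unfolded set_integrable_def] s r
      by (simp add: set_lebesgue_integral_def Bochner_Integration.integral_diff integrable_mult_left)
    then show ?thesis by (simp add: algebra_simps)
  qed
  finally show ?thesis using m by (simp add: zero_le_mult_iff)
qed

lemma cball_integral_shift:
  fixes v :: "'a::euclidean_space \<Rightarrow> real"
  assumes "continuous_on (cball x r) v"
  shows "(LINT h:cball 0 r|lborel. v (x + h)) = integral (cball x r) v"
proof -
  have "integral (cball x r) v = (LINT y:cball x r|lborel. v y)"
    using set_borel_integral_eq_integral(2)[OF cball_integrable_continuous[OF assms]] by simp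
  also have "\<dots> = (\<integral>y. indicator (cball x r) y *\<^sub>R v y \<partial>distr lborel borel ((+) x))"
    by (simp add: lborel_distr_plus set_lebesgue_integral_def)
  also have "\<dots> = (\<integral>h. indicator (cball x r) (x + h) *\<^sub>R v (x + h) \<partial>lborel)"
    by (rule integral_distr) (use borel_measurable_continuous_on_indicator[OF _ assms] in auto)
  also have "\<dots> = (LINT h:cball 0 r|lborel. v (x + h))"
    by (simp add: set_lebesgue_integral_def indicator_def dist_norm)
  finally show ?thesis by simp
qed

lemma ball_defect_eq:
  fixes v :: "'a::euclidean_space \<Rightarrow> real"
  assumes c: "continuous_on (cball y r) v"
  shows "ball_defect r v y = integral (cball y r) v - v y * measure lborel (cball y r)"
proof -
  have c': "continuous_on (cball 0 r) (\<lambda>h. v (y + h))"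
    by (rule continuous_on_compose2[OF c]) (auto intro!: continuous_intros simp: dist_norm)
  have "ball_defect r v y = (LINT h:cball 0 r|lborel. v (y + h)) - (LINT h:cball (0::'a) r|lborel. v y)"
    unfolding ball_defect_def by (intro set_integral_diff cball_integrable_continuous c' continuous_intros)
  also have "(LINT h:cball (0::'a) r|lborel. v y) = v y * measure lborel (cball y r)"
  proof -
    have "measure lborel (cball (0::'a) r) = measure lborel (cball y r)"
      by (cases "r \<ge> 0") (simp_all add: content_cball)
    then show ?thesis using emeasure_lborel_cball_finite[of "0::'a" r] by (simp add: set_lebesgue_integral_def)
  qed
  finally show ?thesis using cball_integral_shift[OF c] by simp
qed

lemma cball_enlarge:
  fixes x :: "'a::euclidean_space"
  assumes "open U" "cball x r \<subseteq> U" "r > 0"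
  obtains R where "R > r" "cball x R \<subseteq> U"
proof -
  have "closed (- U)" "cball x r \<inter> - U = {}" using assms by auto
  then obtain d where d: "d > 0" "\<And>y z. y \<in> cball x r \<Longrightarrow> z \<in> - U \<Longrightarrow> d \<le> dist y z"
    using separate_compact_closed[OF compact_cball[of x r]] by metis
  have "cball x (r + d/2) \<subseteq> U"
  proof
    fix z assume z: "z \<in> cball x (r + d/2)"
    show "z \<in> U"
    proof (cases "dist x z \<le> r")
      case True then show ?thesis using assms by auto
    next
      case False
      define n where "n = norm (z - x)"
      have n: "n > r" "n \<le> r + d/2" using False z by (auto simp: n_def dist_norm norm_minus_commute)
      define y where "y = x + (r / n) *\<^sub>R (z - x)"
      have "dist x y = r" using n assms by (simp add: y_def dist_norm n_def[symmetric])
      moreover have "dist y z = n - r"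
      proof -
        have "y - z = (r / n - 1) *\<^sub>R (z - x)" by (simp add: y_def algebra_simps)
        then have "dist y z = \<bar>r / n - 1\<bar> * n" by (simp add: dist_norm n_def)
        also have "\<dots> = n - r" using n assms by (simp add: abs_if field_simps)
        finally show ?thesis .
      qed
      ultimately show ?thesis using d(2)[of y z] n d(1) by auto
    qed
  qed
  then show ?thesis using that[of "r + d/2"] d by simp
qed

text \<open>The hypothesis says that a discrete Laplacian is asymptotically nonnegative, locally
  uniformly. By \<open>ball_integral_mono\<close> ball means then increase with the radius, and the
  mean over a small ball is close to \<open>v x\<close> by continuity. The ball is enlarged first
  because the cutoff in that lemma needs room.\<close>

lemma subharmonic_on_asymptoticI:
  fixes v :: "'a::euclidean_space \<Rightarrow> real"
  assumes d: "DIM('a) \<ge> 3" and U: "open U" and c: "continuous_on U v"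
    and hyp: "\<And>x r e. r > 0 \<Longrightarrow> cball x r \<subseteq> U \<Longrightarrow> e > 0 \<Longrightarrow> 
       \<exists>\<rho>0>0. \<forall>\<rho> y. 0 < \<rho> \<and> \<rho> < \<rho>0 \<and> y \<in> cball x r \<longrightarrow> ball_defect \<rho> v y \<ge> - e * ball_moment TYPE('a) \<rho>"
  shows "subharmonic_on U v"
  unfolding subharmonic_on_def
proof (intro conjI allI impI c)
  fix x r assume r: "0 < r \<and> cball x r \<subseteq> U"
  then obtain R where R: "R > r" "cball x R \<subseteq> U" using cball_enlarge[OF U] by blast
  define V where "V = measure lborel (cball (0::'a) 1)"
  have V: "measure lborel (cball y t) = V * t ^ DIM('a)" if "t > 0" for t and y :: 'a
    using that by (simp add: V_def content_cball)
  have V0: "V > 0" unfolding V_def by (rule measure_cball_pos) simp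
  define f where "f = (\<lambda>h. v (x + h))"
  have fc: "continuous_on (cball 0 R) f" unfolding f_def
    by (rule continuous_on_compose2[OF continuous_on_subset[OF c R(2)]]) (auto intro!: continuous_intros simp: dist_norm)
  have fd: "ball_defect \<rho> f y = ball_defect \<rho> v (x + y)" for \<rho> y by (simp add: ball_defect_def f_def add.assoc)
  have mono: "(LINT y:cball 0 s|lborel. f y) / s ^ DIM('a) \<le> (LINT y:cball 0 r|lborel. f y) / r ^ DIM('a)" if s: "0 < s" "s < r" for s
  proof (rule ball_integral_mono[OF d s R(1) fc])
    fix e :: real assume "e > 0"
    then obtain \<rho>0 where "\<rho>0 > 0" "\<forall>\<rho> y. 0 < \<rho> \<and> \<rho> < \<rho>0 \<and> y \<in> cball x r \<longrightarrow> ball_defect \<rho> v y \<ge> - e * ball_moment TYPE('a) \<rho>"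
      using hyp r by blast
    then show "\<exists>\<rho>0>0. \<forall>\<rho> y. 0 < \<rho> \<and> \<rho> < \<rho>0 \<and> norm y \<le> r \<longrightarrow> ball_defect \<rho> f y \<ge> - e * ball_moment TYPE('a) \<rho>"
      by (intro exI[of _ \<rho>0]) (auto simp: fd dist_norm)
  qed
  have "v x * V \<le> (LINT y:cball 0 r|lborel. f y) / r ^ DIM('a) + e" if e: "e > 0" for e
  proof -
    have "x \<in> U" using r by auto
    then have "isCont v x" using continuous_on_interior[of U v x] c U by (auto simp: interior_open)
    then obtain t where t: "t > 0" "\<And>y. dist y x < t \<Longrightarrow> dist (v y) (v x) < e / V"
      unfolding continuous_at_eps_delta using e V0 by (metis dist_real_def dist_norm real_norm_def divide_pos_pos)
    define s where "s = min t r / 2"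
    have s: "0 < s" "s < r" "s < t" using t r by (auto simp: s_def)
    have "(v x - e / V) * (V * s ^ DIM('a)) = (LINT y:cball (0::'a) s|lborel. v x - e / V)"
      using V[OF s(1), of 0] emeasure_lborel_cball_finite[of "0::'a" s] by (simp add: set_lebesgue_integral_def)
    also have "\<dots> \<le> (LINT y:cball 0 s|lborel. f y)"
    proof (rule set_integral_mono)
      show "set_integrable lborel (cball 0 s) f" using s R by (intro cball_integrable_continuous continuous_on_subset[OF fc]) auto
      show "set_integrable lborel (cball (0::'a) s) (\<lambda>y. v x - e / V)" by (intro cball_integrable_continuous continuous_intros)
      show "v x - e / V \<le> f y" if "y \<in> cball 0 s" for y
        using t(2)[of "x + y"] that s by (auto simp: f_def dist_norm abs_if split: if_splits)
    qed
    finally have "(v x - e / V) * V \<le> (LINT y:cball 0 s|lborel. f y) / s ^ DIM('a)"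
      using s by (simp add: pos_le_divide_eq mult.assoc)
    moreover have "(v x - e / V) * V = v x * V - e" using V0 by (simp add: left_diff_distrib)
    ultimately show ?thesis using mono[OF s(1,2)] by linarith
  qed
  then have "v x * V \<le> (LINT y:cball 0 r|lborel. f y) / r ^ DIM('a)" by (rule field_le_epsilon)
  then have "v x * (V * r ^ DIM('a)) \<le> (LINT y:cball 0 r|lborel. f y)" using r by (simp add: field_simps)
  also have "(LINT y:cball 0 r|lborel. f y) = integral (cball x r) v"
    unfolding f_def using r by (intro cball_integral_shift continuous_on_subset[OF c]) auto
  finally show "v x * measure lborel (cball x r) \<le> integral (cball x r) v" using V r by simp
qed

lemma subharmonic_on_defect:
  "subharmonic_on U v \<longleftrightarrow> continuous_on U v \<and> (\<forall>x r. 0 < r \<and> cball x r \<subseteq> U \<longrightarrow> 0 \<le> ball_defect r v x)"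
  unfolding subharmonic_on_def using ball_defect_eq continuous_on_subset by (metis diff_ge_0_iff_ge)

text \<open>A Lebesgue number for the cover of a closed ball by good neighbourhoods is a radius
  below which all defects centred in the ball are nonnegative, which is more than the asymptotic
  criterion asks.\<close>

lemma subharmonic_on_local:
  fixes v :: "'a::euclidean_space \<Rightarrow> real"
  assumes d: "DIM('a) \<ge> 3" and U: "open U"
    and loc: "\<And>x. x \<in> U \<Longrightarrow> \<exists>N. open N \<and> x \<in> N \<and> subharmonic_on N v"
  shows "subharmonic_on U v"
proof (rule subharmonic_on_asymptoticI[OF d U])
  show "continuous_on U v"
  proof (intro continuous_at_imp_continuous_on ballI)
    fix x assume "x \<in> U"
    then obtain N where "open N" "x \<in> N" "subharmonic_on N v" using loc by blast
    then show "isCont v x" using continuous_on_interior[of N v x] by (auto simp: interior_open subharmonic_on_def)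
  qed
  fix x and r e :: real assume r: "r > 0" "cball x r \<subseteq> U" and e: "e > 0"
  define \<G> where "\<G> = {N. open N \<and> subharmonic_on N v}"
  have sub: "cball x r \<subseteq> \<Union>\<G>" unfolding \<G>_def using loc r by blast
  have op: "\<And>N. N \<in> \<G> \<Longrightarrow> open N" by (simp add: \<G>_def)
  obtain \<rho>0 where \<rho>0: "0 < \<rho>0" "\<And>y. y \<in> cball x r \<Longrightarrow> \<exists>N\<in>\<G>. ball y \<rho>0 \<subseteq> N"
    by (rule Heine_Borel_lemma[OF compact_cball sub op]) blast+
  show "\<exists>\<rho>0>0. \<forall>\<rho> y. 0 < \<rho> \<and> \<rho> < \<rho>0 \<and> y \<in> cball x r \<longrightarrow> ball_defect \<rho> v y \<ge> - e * ball_moment TYPE('a) \<rho>"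
  proof (intro exI[of _ \<rho>0] conjI allI impI \<rho>0(1))
    fix \<rho> y assume y: "0 < \<rho> \<and> \<rho> < \<rho>0 \<and> y \<in> cball x r"
    then obtain N where "subharmonic_on N v" "ball y \<rho>0 \<subseteq> N" using \<rho>0(2) unfolding \<G>_def by blast
    moreover have "cball y \<rho> \<subseteq> ball y \<rho>0" using y by auto
    ultimately have "0 \<le> ball_defect \<rho> v y" using y by (auto simp: subharmonic_on_defect)
    moreover have "e * ball_moment TYPE('a) \<rho> > 0" using e ball_moment_pos y by (intro mult_pos_pos) auto
    ultimately show "ball_defect \<rho> v y \<ge> - e * ball_moment TYPE('a) \<rho>" by linarith
  qed
qed

subsection \<open>Subharmonic functions\<close>

lemma subharmonic_onI_defect:
  "continuous_on U v \<Longrightarrow> (\<And>x r. 0 < r \<Longrightarrow> cball x r \<subseteq> U \<Longrightarrow> 0 \<le> ball_defect r v x) \<Longrightarrow> subharmonic_on U v"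
  by (simp add: subharmonic_on_defect)

lemma subharmonic_on_continuous: "subharmonic_on U v \<Longrightarrow> continuous_on U v"
  by (simp add: subharmonic_on_def)

lemma subharmonic_on_subset: "subharmonic_on U v \<Longrightarrow> V \<subseteq> U \<Longrightarrow> subharmonic_on V v"
  by (auto simp: subharmonic_on_def intro: continuous_on_subset)

lemma subharmonic_on_cong:
  assumes "\<And>x. x \<in> U \<Longrightarrow> f x = g x" shows "subharmonic_on U f \<longleftrightarrow> subharmonic_on U g"
proof -
  have "ball_defect r f x = ball_defect r g x" if "0 < r \<and> cball x r \<subseteq> U" for x r
    by (rule ball_defect_cong) (use that assms in auto)
  then show ?thesis unfolding subharmonic_on_defect using assms by (auto cong: continuous_on_cong)
qed

lemma set_integrable_defect:
  fixes f :: "'a::euclidean_space \<Rightarrow> real"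
  assumes "continuous_on U f" "cball x r \<subseteq> U"
  shows "set_integrable lborel (cball 0 r) (\<lambda>h. f (x + h) - f x)"
proof -
  have "continuous_on (cball 0 r) (\<lambda>h. f (x + h))"
    by (rule continuous_on_compose2[OF continuous_on_subset[OF assms]]) (auto intro!: continuous_intros simp: dist_norm)
  then show ?thesis by (intro cball_integrable_continuous continuous_intros)
qed

lemma ball_defect_add:
  assumes "continuous_on U f" "continuous_on U g" "cball x r \<subseteq> U"
  shows "ball_defect r (\<lambda>x. f x + g x) x = ball_defect r f x + ball_defect r g x"
proof -
  have "ball_defect r (\<lambda>x. f x + g x) x = (LINT h:cball 0 r|lborel. (f (x + h) - f x) + (g (x + h) - g x))"
    by (simp add: ball_defect_def algebra_simps)
  also have "\<dots> = ball_defect r f x + ball_defect r g x"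
    unfolding ball_defect_def by (intro set_integral_add set_integrable_defect[of U] assms)
  finally show ?thesis .
qed

lemma ball_defect_cmult: "ball_defect r (\<lambda>x. c * f x) x = c * ball_defect r f x"
  by (simp add: ball_defect_def right_diff_distrib[symmetric])

lemma ball_defect_minus: "ball_defect r (\<lambda>x. - f x) x = - ball_defect r f x"
  using ball_defect_cmult[of r "-1" f x] by simp

lemma ball_defect_const: "ball_defect r (\<lambda>x. c) x = 0"
  by (simp add: ball_defect_def set_lebesgue_integral_def)

lemma ball_defect_mono:
  assumes "continuous_on U f" "continuous_on U g" "cball x r \<subseteq> U" 
    and "\<And>y. y \<in> cball x r \<Longrightarrow> f y \<le> g y" "f x = g x"
  shows "ball_defect r f x \<le> ball_defect r g x"
  unfolding ball_defect_def
proof (rule set_integral_mono)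
  show "set_integrable lborel (cball 0 r) (\<lambda>h. f (x + h) - f x)" "set_integrable lborel (cball 0 r) (\<lambda>h. g (x + h) - g x)"
    by (intro set_integrable_defect[of U] assms)+
  show "f (x + h) - f x \<le> g (x + h) - g x" if "h \<in> cball 0 r" for h
    using assms(4)[of "x + h"] assms(5) that by (simp add: dist_norm)
qed

lemma subharmonic_on_const: "subharmonic_on U (\<lambda>_. c)"
  by (rule subharmonic_onI_defect) (auto simp: ball_defect_const)

lemma subharmonic_on_add:
  "subharmonic_on U f \<Longrightarrow> subharmonic_on U g \<Longrightarrow> subharmonic_on U (\<lambda>x. f x + g x)"
  by (rule subharmonic_onI_defect)
     (auto intro!: continuous_intros simp: ball_defect_add[of U] subharmonic_on_defect)

lemma subharmonic_on_cmult:
  "subharmonic_on U f \<Longrightarrow> c \<ge> 0 \<Longrightarrow> subharmonic_on U (\<lambda>x. c * f x)"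
  by (rule subharmonic_onI_defect)
     (auto intro!: continuous_intros simp: ball_defect_cmult subharmonic_on_defect)

lemma subharmonic_on_sum:
  "finite J \<Longrightarrow> (\<And>j. j \<in> J \<Longrightarrow> subharmonic_on U (f j)) \<Longrightarrow> subharmonic_on U (\<lambda>x. \<Sum>j\<in>J. f j x)"
  by (induction J rule: finite_induct) (auto intro: subharmonic_on_const subharmonic_on_add)

lemma subharmonic_on_max:
  assumes f: "subharmonic_on U f" and g: "subharmonic_on U g"
  shows "subharmonic_on U (\<lambda>x. max (f x) (g x))"
proof (rule subharmonic_onI_defect)
  note fc = subharmonic_on_continuous[OF f] and gc = subharmonic_on_continuous[OF g]
  show mc: "continuous_on U (\<lambda>x. max (f x) (g x))" using fc gc by (intro continuous_intros)
  fix x and r :: real assume r: "0 < r" "cball x r \<subseteq> U"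
  show "0 \<le> ball_defect r (\<lambda>x. max (f x) (g x)) x"
  proof (cases "f x \<le> g x")
    case True
    have "0 \<le> ball_defect r g x" using g r by (auto simp: subharmonic_on_defect)
    also have "\<dots> \<le> ball_defect r (\<lambda>x. max (f x) (g x)) x"
      by (rule ball_defect_mono[OF gc mc r(2)]) (use True in auto)
    finally show ?thesis .
  next
    case False
    have "0 \<le> ball_defect r f x" using f r by (auto simp: subharmonic_on_defect)
    also have "\<dots> \<le> ball_defect r (\<lambda>x. max (f x) (g x)) x"
      by (rule ball_defect_mono[OF fc mc r(2)]) (use False in auto)
    finally show ?thesis .
  qed
qed

lemma subharmonic_on_translate:
  fixes f :: "'a::euclidean_space \<Rightarrow> real"
  assumes "subharmonic_on U f" shows "subharmonic_on ((+) p ` U) (\<lambda>x. f (x - p))"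
proof (rule subharmonic_onI_defect)
  have m: "x - p \<in> U" if "x \<in> (+) p ` U" for x using that by auto
  show "continuous_on ((+) p ` U) (\<lambda>x. f (x - p))"
    by (rule continuous_on_compose2[OF subharmonic_on_continuous[OF assms]]) (auto intro!: continuous_intros)
  fix x and r :: real assume r: "0 < r" "cball x r \<subseteq> (+) p ` U"
  have "cball (x - p) r \<subseteq> U"
  proof
    fix y assume "y \<in> cball (x - p) r"
    then have "p + y \<in> cball x r" by (simp add: dist_norm algebra_simps)
    then show "y \<in> U" using m[of "p + y"] r by auto
  qed
  then have "0 \<le> ball_defect r f (x - p)" using assms r by (auto simp: subharmonic_on_defect)
  then show "0 \<le> ball_defect r (\<lambda>x. f (x - p)) x" by (simp add: ball_defect_def algebra_simps)
qed

section \<open>The maximum principle\<close>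

lemma subharmonic_local_max:
  fixes v :: "'a::euclidean_space \<Rightarrow> real"
  assumes c: "continuous_on (cball x r) v" and r: "r > 0" and sub: "0 \<le> ball_defect r v x"
    and le: "\<And>y. y \<in> cball x r \<Longrightarrow> v y \<le> v x" and z: "z \<in> ball x r"
  shows "v z = v x"
proof (rule ccontr)
  assume "v z \<noteq> v x"
  then have lt: "v z < v x" using le[of z] z by auto
  define e where "e = (v x - v z) / 2"
  have e: "e > 0" using lt by (simp add: e_def)
  have "isCont v z" using continuous_on_interior[OF c, of z] z by simp
  then obtain t where t: "t > 0" "\<And>y. dist y z < t \<Longrightarrow> dist (v y) (v z) < e"
    unfolding continuous_at_eps_delta using e by (metis dist_real_def dist_norm)
  obtain t' where t': "t' > 0" "cball z t' \<subseteq> ball x r" using z open_ball open_contains_cball by blast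
  define s where "s = min (t/2) t'"
  have s: "s > 0" "s < t" "s \<le> t'" using t t' by (auto simp: s_def)
  have "cball z s \<subseteq> cball z t'" using s(3) by auto
  then have sub_x: "cball z s \<subseteq> cball x r" using t'(2) ball_subset_cball by blast
  have ci: "set_integrable lborel (cball x r) (\<lambda>y. v x - v y)" by (intro cball_integrable_continuous continuous_intros c)
  have "0 < e * measure lborel (cball z s)" using e s measure_cball_pos by (intro mult_pos_pos)
  also have "\<dots> = (LINT y:cball z s|lborel. e)"
    using emeasure_lborel_cball_finite[of z s] by (simp add: set_lebesgue_integral_def)
  also have "\<dots> \<le> (LINT y:cball z s|lborel. v x - v y)"
  proof (rule set_integral_mono)
    show "e \<le> v x - v y" if "y \<in> cball z s" for y
      using t(2)[of y] that s(2) by (auto simp: e_def dist_commute dist_real_def abs_if split: if_splits)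
    show "set_integrable lborel (cball z s) (\<lambda>y. e)" "set_integrable lborel (cball z s) (\<lambda>y. v x - v y)"
      by (intro cball_integrable_continuous continuous_intros continuous_on_subset[OF c] sub_x)+
  qed
  also have "\<dots> \<le> (LINT y:cball x r|lborel. v x - v y)"
    unfolding set_lebesgue_integral_def
  proof (rule Bochner_Integration.integral_mono)
    show "integrable lborel (\<lambda>y. indicat_real (cball z s) y *\<^sub>R (v x - v y))"
      unfolding set_integrable_def[symmetric]
      by (intro cball_integrable_continuous continuous_intros continuous_on_subset[OF c] sub_x)
    show "integrable lborel (\<lambda>y. indicat_real (cball x r) y *\<^sub>R (v x - v y))"
      using ci by (simp add: set_integrable_def)
    show "indicat_real (cball z s) y *\<^sub>R (v x - v y) \<le> indicat_real (cball x r) y *\<^sub>R (v x - v y)" for y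
      using sub_x le[of y] by (auto simp: indicator_def)
  qed
  also have "\<dots> = integral (cball x r) (\<lambda>y. v x - v y)"
    using set_borel_integral_eq_integral(2)[OF ci] by simp
  also have "\<dots> = ball_defect r (\<lambda>y. - v y) x"
  proof -
    have c2: "continuous_on (cball x r) (\<lambda>y. - v y)" "continuous_on (cball x r) (\<lambda>y. v x)" by (intro continuous_intros c)+
    have "ball_defect r (\<lambda>y. v x - v y) x = ball_defect r (\<lambda>y. v x) x + ball_defect r (\<lambda>y. - v y) x"
      using ball_defect_add[OF c2(2,1)] by simp
    then show ?thesis using ball_defect_eq[of x r "\<lambda>y. v x - v y"] c by (simp add: ball_defect_const continuous_intros)
  qed
  also have "\<dots> = - ball_defect r v x" by (rule ball_defect_minus)
  finally show False using sub by simp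
qed

text \<open>Components of \<open>U\<close> play no part: among the maximum points one of largest
  norm is chosen. If it were in \<open>U\<close>, the function would be constant on a ball around
  it, and that ball contains points of larger norm.\<close>

lemma subharmonic_maximum_principle:
  fixes v :: "'a::euclidean_space \<Rightarrow> real"
  assumes b: "bounded U" and U: "open U" and c: "continuous_on (closure U) v" and sub: "subharmonic_on U v"
    and fr: "\<And>z. z \<in> frontier U \<Longrightarrow> v z \<le> c0" and x: "x \<in> closure U"
  shows "v x \<le> c0"
proof (rule ccontr)
  assume "\<not> v x \<le> c0"
  have K: "compact (closure U)" using b by simp
  have ne: "closure U \<noteq> {}" using x by (metis empty_iff)
  obtain m where m: "m \<in> closure U" "\<And>y. y \<in> closure U \<Longrightarrow> v y \<le> v m"
    using continuous_attains_sup[OF K ne c] by blast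
  define S where "S = {y \<in> closure U. v y = v m}"
  have "S = closure U \<inter> v -` {v m}" by (auto simp: S_def)
  then have "closed S" using continuous_closed_preimage[OF c, of "{v m}"] by simp
  then have "compact (closure U \<inter> S)" by (rule compact_Int_closed[OF K])
  moreover have "closure U \<inter> S = S" by (auto simp: S_def)
  ultimately have "compact S" by simp
  moreover have "m \<in> S" using m by (simp add: S_def)
  ultimately obtain p where p: "p \<in> S" "\<And>y. y \<in> S \<Longrightarrow> norm y \<le> norm p"
    using continuous_attains_sup[of S norm] by (auto intro: continuous_intros)
  have pm: "v p = v m" "p \<in> closure U" using p by (auto simp: S_def)
  have "v m > c0" using m(2)[OF x] \<open>\<not> v x \<le> c0\<close> by simp
  then have "p \<notin> frontier U" using fr[of p] pm by auto
  then have pU: "p \<in> U" using pm U by (simp add: frontier_def interior_open)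
  then obtain r where r: "r > 0" "cball p r \<subseteq> U" using U open_contains_cball by blast
  obtain b0 :: 'a where b0: "b0 \<in> Basis" using nonempty_Basis by blast
  \<comment> \<open>The outward unit direction at \<open>p\<close>; at the origin every unit vector
    points outward.\<close>
  define w where "w = (if p = 0 then b0 else (1 / norm p) *\<^sub>R p)"
  have w: "norm w = 1" "norm (p + (r/2) *\<^sub>R w) = norm p + r/2"
  proof -
    show "norm w = 1" using b0 by (simp add: w_def)
    show "norm (p + (r/2) *\<^sub>R w) = norm p + r/2"
    proof (cases "p = 0")
      case True then show ?thesis using b0 r by (simp add: w_def)
    next
      case False
      have "p + (r/2) *\<^sub>R w = (1 + r / 2 / norm p) *\<^sub>R p" using False by (simp add: w_def algebra_simps)
      then have "norm (p + (r/2) *\<^sub>R w) = \<bar>1 + r / 2 / norm p\<bar> * norm p" by simp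
      also have "\<dots> = norm p + r/2" using False r by (simp add: abs_of_pos add_pos_pos distrib_right)
      finally show ?thesis .
    qed
  qed
  define z where "z = p + (r/2) *\<^sub>R w"
  have cU: "U \<subseteq> closure U" by (rule closure_subset)
  have zb: "z \<in> ball p r" using w r by (simp add: z_def dist_norm)
  have "v z = v p"
  proof (rule subharmonic_local_max[of p r])
    show "continuous_on (cball p r) v" using c r cU by (auto intro: continuous_on_subset)
    show "0 \<le> ball_defect r v p" using sub r by (auto simp: subharmonic_on_defect)
    show "v y \<le> v p" if "y \<in> cball p r" for y
    proof -
      have "y \<in> closure U" using that r(2) cU by blast
      then show ?thesis using m(2) pm by simp
    qed
  qed (use r zb in auto)
  moreover have "z \<in> closure U" using zb r(2) cU ball_subset_cball by blast
  ultimately have "z \<in> S" using pm by (simp add: S_def)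
  then have "norm z \<le> norm p" by (rule p(2))
  then show False using w(2) r by (simp add: z_def)
qed

section \<open>Harmonicity of the Newton kernel and superharmonic truncations\<close>

lemma continuous_newton: "continuous_on (- {0}) (newton :: 'a::euclidean_space \<Rightarrow> real)"
  unfolding newton_def[abs_def] by (intro continuous_intros) auto

lemma newton_harmonic:
  assumes d: "DIM('a::euclidean_space) \<ge> 3"
  shows "subharmonic_on (- {0::'a}) newton" "subharmonic_on (- {0::'a}) (\<lambda>x. - newton x)"
proof -
  have key: "\<exists>\<rho>0>0. \<forall>\<rho> y. 0 < \<rho> \<and> \<rho> < \<rho>0 \<and> y \<in> cball x r \<longrightarrow> \<bar>ball_defect \<rho> newton y\<bar> \<le> e * ball_moment TYPE('a) \<rho>"
    if r: "r > 0" "cball x r \<subseteq> - {0}" and e: "e > 0" for x :: 'a and r e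
  proof -
    define b where "b = (norm x - r)\<^sup>2"
    have nx: "norm x > r" using r(2) by (auto simp: subset_iff dist_norm dest: spec[of _ 0])
    define N where "N = norm x + r"
    have b: "b > 0" "N \<ge> 0" using nx r by (auto simp: b_def N_def)
    obtain C where C: "C \<ge> 0" "\<And>(y::'a) \<rho>. b \<le> y \<bullet> y \<Longrightarrow> norm y \<le> N \<Longrightarrow> 0 < \<rho> \<Longrightarrow> \<rho> \<le> 1 \<Longrightarrow> \<rho> * (\<rho> + 2 * N) \<le> b / 2 \<Longrightarrow>
       \<bar>ball_defect \<rho> newton y\<bar> \<le> C * \<rho> * ball_moment TYPE('a) \<rho>" using newton_defect[OF d b] by metis
    define \<rho>0 where "\<rho>0 = min 1 (min (b / 2 / (1 + 2 * N)) (e / (C + 1)))"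
    have p: "\<rho>0 > 0" using b e C by (auto simp: \<rho>0_def)
    have "\<bar>ball_defect \<rho> newton y\<bar> \<le> e * ball_moment TYPE('a) \<rho>" if y: "0 < \<rho>" "\<rho> < \<rho>0" "y \<in> cball x r" for \<rho> y
    proof -
      have xy: "norm (x - y) \<le> r" using y by (simp add: dist_norm)
      have ny: "norm y \<le> N" unfolding N_def using norm_triangle_ineq2[of y x] xy by (simp add: norm_minus_commute)
      have "norm x - r \<le> norm y" using norm_triangle_ineq2[of x y] xy by simp
      then have "(norm x - r)\<^sup>2 \<le> (norm y)\<^sup>2" using nx by (intro power_mono) auto
      then have yb: "b \<le> y \<bullet> y" by (simp add: b_def dot_square_norm)
      have l: "\<rho> \<le> 1" "\<rho> \<le> b / 2 / (1 + 2 * N)" "\<rho> \<le> e / (C + 1)" using y by (auto simp: \<rho>0_def)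
      have "\<rho> * (\<rho> + 2 * N) \<le> \<rho> * (1 + 2 * N)" using l y b by (intro mult_left_mono) auto
      also have "\<dots> \<le> b / 2" using l(2) b by (simp only: pos_le_divide_eq)
      finally have l2: "\<rho> * (\<rho> + 2 * N) \<le> b / 2" .
      have "C * \<rho> \<le> (C + 1) * \<rho>" using y by simp
      also have "\<dots> \<le> e" using l(3) C by (simp add: pos_le_divide_eq mult.commute)
      finally have "C * \<rho> * ball_moment TYPE('a) \<rho> \<le> e * ball_moment TYPE('a) \<rho>"
        using ball_moment_pos[OF y(1), where 'a='a] by (intro mult_right_mono) auto
      then show ?thesis using C(2)[OF yb ny y(1) l(1) l2] by linarith
    qed
    then show ?thesis using p by blast
  qed
  have cn: "continuous_on (- {0::'a}) (\<lambda>x. - newton x)" by (intro continuous_intros continuous_newton)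
  show "subharmonic_on (- {0::'a}) newton"
  proof (rule subharmonic_on_asymptoticI[OF d _ continuous_newton])
    fix x :: 'a and r e :: real assume "r > 0" "cball x r \<subseteq> - {0}" "e > 0"
    from key[OF this] show "\<exists>\<rho>0>0. \<forall>\<rho> y. 0 < \<rho> \<and> \<rho> < \<rho>0 \<and> y \<in> cball x r \<longrightarrow> ball_defect \<rho> newton y \<ge> - e * ball_moment TYPE('a) \<rho>"
      by (metis abs_le_iff minus_le_iff mult_minus_left)
  qed auto
  show "subharmonic_on (- {0::'a}) (\<lambda>x. - newton x)"
  proof (rule subharmonic_on_asymptoticI[OF d _ cn])
    fix x :: 'a and r e :: real assume "r > 0" "cball x r \<subseteq> - {0}" "e > 0"
    from key[OF this] show "\<exists>\<rho>0>0. \<forall>\<rho> y. 0 < \<rho> \<and> \<rho> < \<rho>0 \<and> y \<in> cball x r \<longrightarrow> ball_defect \<rho> (\<lambda>x. - newton x) y \<ge> - e * ball_moment TYPE('a) \<rho>"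
      unfolding ball_defect_minus by (metis abs_le_iff minus_le_iff neg_le_iff_le mult_minus_left)
  qed auto
qed

text \<open>In spirit a minimum of two superharmonic functions, but the kernel has a junk value at
  the origin. On the plateau the truncation is maximal, so its negative has nonnegative defect. Off
  the plateau it is compared with the kernel on balls of radius below \<open>sqrt T\<close>, which
  miss the origin.\<close>

lemma truncated_newton_superharmonic:
  assumes d: "DIM('a::euclidean_space) \<ge> 3" and T: "T > 0"
  shows "subharmonic_on UNIV (\<lambda>x::'a. - (max (x \<bullet> x) T powr (- (DIM('a) / 2 - 1))))"
proof -
  define m where "m = DIM('a) / 2 - 1"
  have m: "m > 0" using d by (simp add: m_def)
  define g where "g = (\<lambda>x::'a. max (x \<bullet> x) T powr (-m))"
  have gc: "continuous_on A (\<lambda>x. - g x)" for A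
    unfolding g_def by (intro continuous_intros) (use T in \<open>auto simp: max_def\<close>)
  have "subharmonic_on UNIV (\<lambda>x. - g x)"
  proof (rule subharmonic_on_asymptoticI[OF d open_UNIV gc])
    fix x :: 'a and r e :: real assume e: "e > 0"
    show "\<exists>\<rho>0>0. \<forall>\<rho> y. 0 < \<rho> \<and> \<rho> < \<rho>0 \<and> y \<in> cball x r \<longrightarrow> ball_defect \<rho> (\<lambda>x. - g x) y \<ge> - e * ball_moment TYPE('a) \<rho>"
    proof (intro exI[of _ "sqrt T"] conjI allI impI)
      fix \<rho> y assume y: "0 < \<rho> \<and> \<rho> < sqrt T \<and> y \<in> cball x r"
      have "0 \<le> ball_defect \<rho> (\<lambda>x. - g x) y"
      proof (cases "y \<bullet> y \<le> T")
        case True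
        have "g z \<le> g y" for z using True m T by (auto simp: g_def intro!: powr_mono2')
        then have "ball_defect \<rho> (\<lambda>x. - g y) y \<le> ball_defect \<rho> (\<lambda>x. - g x) y"
          by (intro ball_defect_mono[of UNIV]) (auto intro: gc)
        then show ?thesis by (simp add: ball_defect_const)
      next
        case False
        then have "sqrt T < norm y" by (simp add: norm_eq_sqrt_inner)
        then have 0: "cball y \<rho> \<subseteq> - {0}" using y by (auto simp: dist_norm)
        have "0 \<le> ball_defect \<rho> (\<lambda>x. - newton x) y"
          using newton_harmonic(2)[OF d] 0 y by (auto simp: subharmonic_on_defect)
        also have "\<dots> \<le> ball_defect \<rho> (\<lambda>x. - g x) y"
        proof (rule ball_defect_mono[of "- {0}", OF _ gc 0])
          show "continuous_on (- {0::'a}) (\<lambda>x. - newton x)" by (intro continuous_intros continuous_newton)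
          show "- newton y = - g y" using False by (simp add: newton_def g_def m_def max_def)
          fix z assume "z \<in> cball y \<rho>" then have "z \<noteq> 0" using 0 by auto
          then have "g z \<le> newton z" unfolding g_def newton_def m_def[symmetric] using m by (intro powr_mono2') auto
          then show "- newton z \<le> - g z" by simp
        qed
        finally show ?thesis .
      qed
      moreover have "e * ball_moment TYPE('a) \<rho> > 0" using e ball_moment_pos y by (intro mult_pos_pos) auto
      ultimately show "ball_defect \<rho> (\<lambda>x. - g x) y \<ge> - e * ball_moment TYPE('a) \<rho>" by linarith
    qed (use T in auto)
  qed
  then show ?thesis by (simp add: g_def m_def)
qed

subsection \<open>Gaussian energies\<close>

lemma nn_integral_exp_abs:
  assumes c: "c > 0" shows "(\<integral>\<^sup>+x. ennreal (exp (- c * \<bar>x::real\<bar>)) \<partial>lborel) < \<infinity>"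
proof -
  have 1: "(\<integral>\<^sup>+x. ennreal (exp (- c * x)) * indicator {0..} x \<partial>lborel) = ennreal (0 - (- exp (- c * 0) / c))"
  proof (rule nn_integral_FTC_atLeast)
    show "((\<lambda>x. - exp (- c * x) / c) has_real_derivative exp (- c * x)) (at x)" for x
      using c by (auto intro!: derivative_eq_intros)
    have "filterlim (\<lambda>x::real. (- c) * x) at_bot at_top"
      by (rule filterlim_tendsto_neg_mult_at_bot[OF tendsto_const _ filterlim_ident]) (use c in auto)
    then have "((\<lambda>x. exp (- c * x)) \<longlongrightarrow> 0) at_top"
      by (rule filterlim_compose[OF exp_at_bot])
    from tendsto_divide[OF tendsto_minus[OF this] tendsto_const[of c]] show "((\<lambda>x. - exp (- c * x) / c) \<longlongrightarrow> 0) at_top" using c by simp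
  qed auto
  have 2: "(\<integral>\<^sup>+x. ennreal (exp (- c * x)) * indicator {0..} x \<partial>lborel) = (\<integral>\<^sup>+x. ennreal (exp (- c * (-x))) * indicator {0..} (-x) \<partial>lborel)"
    using nn_integral_real_affine[of "\<lambda>x. ennreal (exp (- c * x)) * indicator {0..} x" "-1" 0] by simp
  have "(\<integral>\<^sup>+x. ennreal (exp (- c * \<bar>x::real\<bar>)) \<partial>lborel) 
     \<le> (\<integral>\<^sup>+x. ennreal (exp (- c * x)) * indicator {0..} x + ennreal (exp (- c * (-x))) * indicator {0..} (-x) \<partial>lborel)"
    by (rule nn_integral_mono) (auto simp: indicator_def abs_if)
  also have "\<dots> = (\<integral>\<^sup>+x. ennreal (exp (- c * x)) * indicator {0..} x \<partial>lborel) + (\<integral>\<^sup>+x. ennreal (exp (- c * (-x))) * indicator {0..} (-x) \<partial>lborel)"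
    by (rule nn_integral_add) measurable
  also have "\<dots> < \<infinity>" unfolding 2[symmetric] 1 by simp
  finally show ?thesis .
qed

text \<open>Only finiteness is used later. Since \<open>t\<^sup>2 \<ge> \<bar>t\<bar> - 1/4\<close>,
  the Gaussian lies below a product of one-dimensional exponentials with elementary
  integrals.\<close>

lemma nn_integral_gaussian_finite:
  assumes c: "c > 0" shows "(\<integral>\<^sup>+z. ennreal (exp (- c * ((z::'a::euclidean_space) \<bullet> z))) \<partial>lborel) < \<infinity>"
proof -
  have "(\<integral>\<^sup>+z. ennreal (exp (- c * ((z::'a) \<bullet> z))) \<partial>lborel) \<le> (\<integral>\<^sup>+z. (\<Prod>b\<in>Basis. ennreal (exp (c / 4) * exp (- c * \<bar>(z::'a) \<bullet> b\<bar>))) \<partial>lborel)"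
  proof (rule nn_integral_mono)
    fix z :: 'a
    have "exp (- c * (z \<bullet> z)) = (\<Prod>b\<in>Basis. exp (- c * ((z \<bullet> b) * (z \<bullet> b))))"
      by (simp add: exp_sum[symmetric] sum_distrib_left[symmetric] sum_negf euclidean_inner[of z z])
    also have "\<dots> \<le> (\<Prod>b\<in>Basis. exp (c / 4) * exp (- c * \<bar>z \<bullet> b\<bar>))"
    proof (intro prod_mono conjI)
      fix b
      have "0 \<le> (\<bar>z \<bullet> b\<bar> - 1/2)\<^sup>2" by simp
      then have "\<bar>z \<bullet> b\<bar> - 1/4 \<le> (z \<bullet> b) * (z \<bullet> b)" by (simp add: power2_eq_square algebra_simps)
      then have "c * (\<bar>z \<bullet> b\<bar> - 1/4) \<le> c * ((z \<bullet> b) * (z \<bullet> b))" using c by (intro mult_left_mono) auto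
      then show "exp (- c * ((z \<bullet> b) * (z \<bullet> b))) \<le> exp (c / 4) * exp (- c * \<bar>z \<bullet> b\<bar>)"
        by (simp add: exp_add[symmetric] algebra_simps)
    qed auto
    finally show "ennreal (exp (- c * (z \<bullet> z))) \<le> (\<Prod>b\<in>Basis. ennreal (exp (c / 4) * exp (- c * \<bar>z \<bullet> b\<bar>)))"
      by (subst prod_ennreal) (auto intro: ennreal_leI)
  qed
  also have "\<dots> = (\<Prod>b\<in>(Basis::'a set). (\<integral>\<^sup>+x. ennreal (exp (c / 4) * exp (- c * \<bar>x\<bar>)) \<partial>lborel))"
    by (rule nn_integral_lborel_prod) auto
  also have "\<dots> < \<infinity>"
    using nn_integral_exp_abs[OF c] by (simp add: ennreal_mult nn_integral_cmult ennreal_mult_less_top power_less_top_ennreal)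
  finally show ?thesis .
qed

lemma nn_integral_lborel_shift:
  fixes f :: "'a::euclidean_space \<Rightarrow> ennreal"
  assumes [measurable]: "f \<in> borel_measurable borel"
  shows "(\<integral>\<^sup>+z. f (z - a) \<partial>lborel) = (\<integral>\<^sup>+z. f z \<partial>lborel)"
proof -
  have "(\<integral>\<^sup>+z. f z \<partial>lborel) = (\<integral>\<^sup>+z. f z \<partial>distr lborel borel ((+) (- a)))" by (simp add: lborel_distr_plus)
  also have "\<dots> = (\<integral>\<^sup>+z. f (- a + z) \<partial>lborel)" by (rule nn_integral_distr) auto
  finally show ?thesis by simp
qed

section \<open>Potentials and energies restricted to a set of scales\<close>

definition gauss_pot :: "real \<Rightarrow> ('a::euclidean_space \<Rightarrow> ennreal) \<Rightarrow> 'a \<Rightarrow> ennreal" where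
  "gauss_pot s f x = (\<integral>\<^sup>+y. ennreal (exp (- s * ((x - y) \<bullet> (x - y)))) * f y \<partial>lborel)"

definition gauss_energy :: "real \<Rightarrow> ('a::euclidean_space \<Rightarrow> ennreal) \<Rightarrow> ('a \<Rightarrow> ennreal) \<Rightarrow> ennreal" where
  "gauss_energy s f g = (\<integral>\<^sup>+x. f x * gauss_pot s g x \<partial>lborel)"

text \<open>\<open>J\<close> selects Gaussian scales. The weight is such that all scales together
  give the Newtonian potential, up to a Gamma factor. Scales up to \<open>S\<close> form a smooth
  part, while \<open>{S<..}\<close> carries the short range singularity.\<close>

definition pot :: "real set \<Rightarrow> ('a::euclidean_space \<Rightarrow> ennreal) \<Rightarrow> 'a \<Rightarrow> ennreal" where
  "pot J f x = (\<integral>\<^sup>+s. indicator J s * ennreal (s powr (DIM('a) / 2 - 2)) * gauss_pot s f x \<partial>lborel)"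

definition energy :: "real set \<Rightarrow> ('a::euclidean_space \<Rightarrow> ennreal) \<Rightarrow> ('a \<Rightarrow> ennreal) \<Rightarrow> ennreal" where
  "energy J f g = (\<integral>\<^sup>+x. f x * pot J g x \<partial>lborel)"

lemma measurable_gauss_pot2 [measurable]:
  assumes [measurable]: "f \<in> borel_measurable borel"
  shows "(\<lambda>(s, x). gauss_pot s f x) \<in> borel_measurable (lborel \<Otimes>\<^sub>M (lborel :: 'a::euclidean_space measure))"
  unfolding gauss_pot_def by measurable

lemma measurable_gauss_pot [measurable]:
  assumes [measurable]: "f \<in> borel_measurable borel"
  shows "(\<lambda>x::'a::euclidean_space. gauss_pot s f x) \<in> borel_measurable borel" "(\<lambda>s. gauss_pot s f x) \<in> borel_measurable borel"
  unfolding gauss_pot_def by measurable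

lemma measurable_gauss_energy [measurable]:
  assumes [measurable]: "f \<in> borel_measurable borel" "g \<in> borel_measurable borel"
  shows "(\<lambda>s. gauss_energy s f (g :: 'a::euclidean_space \<Rightarrow> ennreal)) \<in> borel_measurable borel"
proof -
  have "(\<lambda>(s, x). f x * gauss_pot s g x) \<in> borel_measurable (lborel \<Otimes>\<^sub>M (lborel :: 'a measure))"
    using measurable_gauss_pot2[of g] by (simp add: split_beta') 
  from lborel.borel_measurable_nn_integral[OF this] show ?thesis unfolding gauss_energy_def by simp
qed

lemma measurable_pot [measurable]:
  assumes [measurable]: "f \<in> borel_measurable borel" "J \<in> sets borel"
  shows "(pot J f :: 'a::euclidean_space \<Rightarrow> _) \<in> borel_measurable borel"
proof -
  have "(\<lambda>(x, s). indicator J s * ennreal (s powr (DIM('a) / 2 - 2)) * gauss_pot s f x) \<in> borel_measurable ((lborel :: 'a measure) \<Otimes>\<^sub>M lborel)"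
    using measurable_compose[OF measurable_pair_swap' measurable_gauss_pot2[of f]] by (simp add: split_beta')
  from lborel.borel_measurable_nn_integral[OF this] show ?thesis unfolding pot_def[abs_def] by simp
qed

lemma energy_eq:
  assumes [measurable]: "f \<in> borel_measurable borel" "g \<in> borel_measurable borel" "J \<in> sets borel"
  shows "energy J f (g :: 'a::euclidean_space \<Rightarrow> ennreal) = (\<integral>\<^sup>+s. indicator J s * ennreal (s powr (DIM('a) / 2 - 2)) * gauss_energy s f g \<partial>lborel)"
proof -
  have m: "(\<lambda>(x, s). f x * (indicator J s * ennreal (s powr (DIM('a) / 2 - 2)) * gauss_pot s g x)) \<in> borel_measurable ((lborel :: 'a measure) \<Otimes>\<^sub>M lborel)"
    using measurable_compose[OF measurable_pair_swap' measurable_gauss_pot2[of g]] by (simp add: split_beta')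
  have "energy J f g = (\<integral>\<^sup>+x. (\<integral>\<^sup>+s. f x * (indicator J s * ennreal (s powr (DIM('a) / 2 - 2)) * gauss_pot s g x) \<partial>lborel) \<partial>lborel)"
    unfolding energy_def pot_def by (subst nn_integral_cmult) auto
  also have "\<dots> = (\<integral>\<^sup>+s. (\<integral>\<^sup>+x. f x * (indicator J s * ennreal (s powr (DIM('a) / 2 - 2)) * gauss_pot s g x) \<partial>lborel) \<partial>lborel)"
    by (rule lborel_pair.Fubini'[OF m, symmetric])
  also have "\<dots> = (\<integral>\<^sup>+s. indicator J s * ennreal (s powr (DIM('a) / 2 - 2)) * gauss_energy s f g \<partial>lborel)"
    unfolding gauss_energy_def by (subst nn_integral_cmult[symmetric]) (auto simp: mult_ac)
  finally show ?thesis .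
qed

lemma gauss_energy_commute:
  assumes [measurable]: "f \<in> borel_measurable borel" "g \<in> borel_measurable borel"
  shows "gauss_energy s f (g :: 'a::euclidean_space \<Rightarrow> ennreal) = gauss_energy s g f"
proof -
  have m: "(\<lambda>(x, y). f x * (ennreal (exp (- s * ((x - y) \<bullet> (x - y)))) * g y)) \<in> borel_measurable ((lborel :: 'a measure) \<Otimes>\<^sub>M lborel)" by measurable
  have "gauss_energy s f g = (\<integral>\<^sup>+x. (\<integral>\<^sup>+y. f x * (ennreal (exp (- s * ((x - y) \<bullet> (x - y)))) * g y) \<partial>lborel) \<partial>lborel)"
    unfolding gauss_energy_def gauss_pot_def by (subst nn_integral_cmult) auto
  also have "\<dots> = (\<integral>\<^sup>+y. (\<integral>\<^sup>+x. f x * (ennreal (exp (- s * ((x - y) \<bullet> (x - y)))) * g y) \<partial>lborel) \<partial>lborel)"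
    by (rule lborel_pair.Fubini'[OF m, symmetric])
  also have "\<dots> = gauss_energy s g f"
    unfolding gauss_energy_def gauss_pot_def
    by (subst nn_integral_cmult[symmetric]) (auto simp: mult_ac inner_diff_left inner_diff_right inner_commute intro!: nn_integral_cong arg_cong2[where f="(*)"])
  finally show ?thesis .
qed

lemma energy_commute:
  assumes [measurable]: "f \<in> borel_measurable borel" "g \<in> borel_measurable borel" "J \<in> sets borel"
  shows "energy J f (g :: 'a::euclidean_space \<Rightarrow> ennreal) = energy J g f"
  by (simp add: energy_eq gauss_energy_commute)

lemma ennreal_AM_GM: "2 * (x * y) \<le> x * x + y * (y::ennreal)"
proof (cases x; cases y)
  fix a b assume "x = ennreal a" "0 \<le> a" "y = ennreal b" "0 \<le> b"
  moreover have "2 * (a * b) \<le> a * a + b * b" using sum_squares_bound[of a b] by (simp add: power2_eq_square)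
  ultimately show ?thesis
    by (simp add: ennreal_mult[symmetric] ennreal_plus[symmetric] ennreal_numeral[symmetric] del: ennreal_numeral ennreal_plus)
qed auto

text \<open>A Gaussian is, up to a constant, the convolution of a narrower Gaussian with itself.\<close>

lemma gauss_energy_pos_def:
  fixes f g :: "'a::euclidean_space \<Rightarrow> ennreal"
  assumes s: "s > 0" and [measurable]: "f \<in> borel_measurable borel" "g \<in> borel_measurable borel"
  shows "2 * gauss_energy s f g \<le> gauss_energy s f f + gauss_energy s g g"
proof -
  define C where "C = (\<integral>\<^sup>+z. ennreal (exp (- (4 * s) * ((z::'a) \<bullet> z))) \<partial>lborel)"
  have C: "C \<noteq> \<infinity>" unfolding C_def using nn_integral_gaussian_finite[of "4 * s", where 'a='a] s by auto
  have C0: "C \<noteq> 0"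
  proof
    assume "C = 0"
    then have "AE z::'a in lborel. ennreal (exp (- (4 * s) * (z \<bullet> z))) = 0" unfolding C_def by (subst (asm) nn_integral_0_iff_AE) auto
    then have "AE z::'a in lborel. False" by simp
    then have "ae_filter (lborel :: 'a measure) = bot" by (simp add: trivial_limit_def)
    then show False by (simp add: ae_filter_eq_bot_iff)
  qed
  have key: "C * ennreal (exp (- s * ((x - y) \<bullet> (x - y)))) = (\<integral>\<^sup>+z. ennreal (exp (- (2 * s) * ((x - z) \<bullet> (x - z)))) * ennreal (exp (- (2 * s) * ((y - z) \<bullet> (y - z)))) \<partial>lborel)" for x y :: 'a
  proof -
    define q where "q = (1/2) *\<^sub>R (x + y)"
    have id: "2 * ((x - z) \<bullet> (x - z)) + 2 * ((y - z) \<bullet> (y - z)) = (x - y) \<bullet> (x - y) + 4 * ((z - q) \<bullet> (z - q))" for z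
      by (simp add: q_def inner_simps inner_commute algebra_simps)
    have "(\<integral>\<^sup>+z. ennreal (exp (- (2 * s) * ((x - z) \<bullet> (x - z)))) * ennreal (exp (- (2 * s) * ((y - z) \<bullet> (y - z)))) \<partial>lborel)
       = (\<integral>\<^sup>+z. ennreal (exp (- s * ((x - y) \<bullet> (x - y)))) * ennreal (exp (- (4 * s) * ((z - q) \<bullet> (z - q)))) \<partial>lborel)"
    proof (rule nn_integral_cong)
      fix z
      have "- (2 * s) * ((x - z) \<bullet> (x - z)) + - (2 * s) * ((y - z) \<bullet> (y - z)) = - s * (2 * ((x - z) \<bullet> (x - z)) + 2 * ((y - z) \<bullet> (y - z)))"
        by (simp add: algebra_simps)
      also have "\<dots> = - s * ((x - y) \<bullet> (x - y)) + - (4 * s) * ((z - q) \<bullet> (z - q))" unfolding id by (simp add: algebra_simps)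
      finally show "ennreal (exp (- (2 * s) * ((x - z) \<bullet> (x - z)))) * ennreal (exp (- (2 * s) * ((y - z) \<bullet> (y - z))))
         = ennreal (exp (- s * ((x - y) \<bullet> (x - y)))) * ennreal (exp (- (4 * s) * ((z - q) \<bullet> (z - q))))"
        by (simp only: ennreal_mult[symmetric] exp_ge_zero exp_add[symmetric])
    qed
    also have "\<dots> = ennreal (exp (- s * ((x - y) \<bullet> (x - y)))) * (\<integral>\<^sup>+z. ennreal (exp (- (4 * s) * ((z - q) \<bullet> (z - q)))) \<partial>lborel)"
      by (rule nn_integral_cmult) measurable
    also have "(\<integral>\<^sup>+z. ennreal (exp (- (4 * s) * ((z - q) \<bullet> (z - q)))) \<partial>lborel) = C"
      unfolding C_def by (rule nn_integral_lborel_shift[of "\<lambda>z. ennreal (exp (- (4 * s) * (z \<bullet> z)))"]) measurable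
    finally show ?thesis by (simp add: mult.commute)
  qed
  define \<Phi> where "\<Phi> f z = (\<integral>\<^sup>+x. ennreal (exp (- (2 * s) * ((x - z) \<bullet> (x - z)))) * f x \<partial>lborel)" for f and z :: 'a
  have \<Phi>m[measurable]: "\<Phi> f \<in> borel_measurable borel" if [measurable]: "f \<in> borel_measurable borel" for f
    unfolding \<Phi>_def[abs_def] by measurable
  have rep: "C * gauss_energy s f g = (\<integral>\<^sup>+z. \<Phi> f z * \<Phi> g z \<partial>lborel)"
    if [measurable]: "f \<in> borel_measurable borel" "g \<in> borel_measurable borel" for f g
  proof -
    let ?e = "\<lambda>x z::'a. ennreal (exp (- (2 * s) * ((x - z) \<bullet> (x - z))))"
    have "C * gauss_energy s f g = (\<integral>\<^sup>+x. (\<integral>\<^sup>+y. f x * g y * (C * ennreal (exp (- s * ((x - y) \<bullet> (x - y))))) \<partial>lborel) \<partial>lborel)"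
    proof -
      have "(\<integral>\<^sup>+y. f x * g y * (C * ennreal (exp (- s * ((x - y) \<bullet> (x - y))))) \<partial>lborel) = C * (f x * gauss_pot s g x)" for x
      proof -
        have "(\<integral>\<^sup>+y. f x * g y * (C * ennreal (exp (- s * ((x - y) \<bullet> (x - y))))) \<partial>lborel)
           = (\<integral>\<^sup>+y. (C * f x) * (ennreal (exp (- s * ((x - y) \<bullet> (x - y)))) * g y) \<partial>lborel)" by (simp add: mult_ac)
        also have "\<dots> = (C * f x) * gauss_pot s g x" unfolding gauss_pot_def by (rule nn_integral_cmult) measurable
        finally show ?thesis by (simp add: mult_ac)
      qed
      then show ?thesis unfolding gauss_energy_def by (simp only:) (rule nn_integral_cmult[symmetric], measurable)
    qed
    also have "\<dots> = (\<integral>\<^sup>+x. (\<integral>\<^sup>+y. (\<integral>\<^sup>+z. (f x * ?e x z) * (g y * ?e y z) \<partial>lborel) \<partial>lborel) \<partial>lborel)"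
    proof (intro nn_integral_cong)
      fix x y :: 'a
      have "f x * g y * (C * ennreal (exp (- s * ((x - y) \<bullet> (x - y))))) = (\<integral>\<^sup>+z. (f x * g y) * (?e x z * ?e y z) \<partial>lborel)"
        unfolding key by (rule nn_integral_cmult[symmetric]) measurable
      then show "f x * g y * (C * ennreal (exp (- s * ((x - y) \<bullet> (x - y))))) = (\<integral>\<^sup>+z. (f x * ?e x z) * (g y * ?e y z) \<partial>lborel)"
        by (simp add: mult_ac)
    qed
    also have "\<dots> = (\<integral>\<^sup>+x. (\<integral>\<^sup>+z. (\<integral>\<^sup>+y. (f x * ?e x z) * (g y * ?e y z) \<partial>lborel) \<partial>lborel) \<partial>lborel)"
      by (intro nn_integral_cong lborel_pair.Fubini'[symmetric]) measurable
    also have "\<dots> = (\<integral>\<^sup>+x. (\<integral>\<^sup>+z. (f x * ?e x z) * \<Phi> g z \<partial>lborel) \<partial>lborel)"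
    proof (intro nn_integral_cong)
      fix x z :: 'a
      have "(\<integral>\<^sup>+y. (f x * ?e x z) * (?e y z * g y) \<partial>lborel) = (f x * ?e x z) * \<Phi> g z"
        unfolding \<Phi>_def by (rule nn_integral_cmult) measurable
      then show "(\<integral>\<^sup>+y. (f x * ?e x z) * (g y * ?e y z) \<partial>lborel) = (f x * ?e x z) * \<Phi> g z" by (simp add: mult.commute)
    qed
    also have "\<dots> = (\<integral>\<^sup>+z. (\<integral>\<^sup>+x. (f x * ?e x z) * \<Phi> g z \<partial>lborel) \<partial>lborel)"
      by (intro lborel_pair.Fubini'[symmetric]) measurable
    also have "\<dots> = (\<integral>\<^sup>+z. \<Phi> f z * \<Phi> g z \<partial>lborel)"
    proof (intro nn_integral_cong)
      fix z :: 'a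
      have "(\<integral>\<^sup>+x. (?e x z * f x) * \<Phi> g z \<partial>lborel) = \<Phi> f z * \<Phi> g z"
        unfolding \<Phi>_def[of f] by (rule nn_integral_multc) measurable
      then show "(\<integral>\<^sup>+x. (f x * ?e x z) * \<Phi> g z \<partial>lborel) = \<Phi> f z * \<Phi> g z" by (simp add: mult.commute)
    qed
    finally show ?thesis .
  qed
  have "C * (2 * gauss_energy s f g) = 2 * (\<integral>\<^sup>+z. \<Phi> f z * \<Phi> g z \<partial>lborel)" by (simp add: rep[symmetric] mult_ac)
  also have "\<dots> = (\<integral>\<^sup>+z. 2 * (\<Phi> f z * \<Phi> g z) \<partial>lborel)" by (rule nn_integral_cmult[symmetric]) measurable
  also have "\<dots> \<le> (\<integral>\<^sup>+z. \<Phi> f z * \<Phi> f z + \<Phi> g z * \<Phi> g z \<partial>lborel)" by (intro nn_integral_mono ennreal_AM_GM)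
  also have "\<dots> = C * gauss_energy s f f + C * gauss_energy s g g"
    by (simp add: rep) (rule nn_integral_add; measurable)
  also have "\<dots> = C * (gauss_energy s f f + gauss_energy s g g)" by (simp add: distrib_left)
  finally show ?thesis using C C0 by (subst (asm) ennreal_mult_le_mult_iff) auto
qed

text \<open>Positivity holds at every scale and so on every band of scales. This is the reason for
  working with mixtures of Gaussians: the tail estimate discards the low band by its own
  positivity.\<close>

lemma energy_pos_def:
  fixes f g :: "'a::euclidean_space \<Rightarrow> ennreal"
  assumes [measurable]: "f \<in> borel_measurable borel" "g \<in> borel_measurable borel" "J \<in> sets borel" and J: "J \<subseteq> {0<..}"
  shows "2 * energy J f g \<le> energy J f f + energy J g g"
proof -
  have "2 * energy J f g = (\<integral>\<^sup>+s. indicator J s * ennreal (s powr (DIM('a) / 2 - 2)) * (2 * gauss_energy s f g) \<partial>lborel)"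
    by (simp add: energy_eq nn_integral_cmult[symmetric] mult_ac)
  also have "\<dots> \<le> (\<integral>\<^sup>+s. indicator J s * ennreal (s powr (DIM('a) / 2 - 2)) * (gauss_energy s f f + gauss_energy s g g) \<partial>lborel)"
  proof (rule nn_integral_mono)
    fix s :: real
    show "indicator J s * ennreal (s powr (DIM('a) / 2 - 2)) * (2 * gauss_energy s f g)
       \<le> indicator J s * ennreal (s powr (DIM('a) / 2 - 2)) * (gauss_energy s f f + gauss_energy s g g)"
      by (cases "s \<in> J") (use J gauss_energy_pos_def[of s f g] in \<open>auto intro!: mult_left_mono\<close>)
  qed
  also have "\<dots> = energy J f f + energy J g g"
    by (simp add: energy_eq nn_integral_add[symmetric] distrib_left)
  finally show ?thesis .
qed

lemma pot_linear:
  fixes f g :: "'a::euclidean_space \<Rightarrow> ennreal"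
  assumes [measurable]: "f \<in> borel_measurable borel" "g \<in> borel_measurable borel" "J \<in> sets borel"
  shows "pot J (\<lambda>x. a * f x + b * g x) x = a * pot J f x + b * pot J g x"
proof -
  have "gauss_pot s (\<lambda>x. a * f x + b * g x) x = a * gauss_pot s f x + b * gauss_pot s g x" for s
    by (simp add: gauss_pot_def nn_integral_cmult[symmetric] nn_integral_add[symmetric] distrib_left distrib_right mult_ac)
  then show ?thesis
    by (simp add: pot_def nn_integral_cmult[symmetric] nn_integral_add[symmetric] distrib_left distrib_right mult_ac)
qed

lemma energy_linear:
  fixes f g h :: "'a::euclidean_space \<Rightarrow> ennreal"
  assumes [measurable]: "f \<in> borel_measurable borel" "g \<in> borel_measurable borel" "h \<in> borel_measurable borel" "J \<in> sets borel"
  shows "energy J h (\<lambda>x. a * f x + b * g x) = a * energy J h f + b * energy J h g"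
  by (simp add: energy_def pot_linear nn_integral_cmult[symmetric] nn_integral_add[symmetric] distrib_left mult_ac)

lemma energy_quadratic:
  fixes f g :: "'a::euclidean_space \<Rightarrow> ennreal"
  assumes [measurable]: "f \<in> borel_measurable borel" "g \<in> borel_measurable borel" "J \<in> sets borel"
  shows "energy J (\<lambda>x. a * f x + b * g x) (\<lambda>x. a * f x + b * g x) = a * a * energy J f f + 2 * a * b * energy J f g + b * b * energy J g g"
  by (simp add: energy_linear energy_commute[of "\<lambda>x. a * f x + b * g x"] energy_commute[of g f] algebra_simps mult_2)

lemma energy_split:
  fixes f g :: "'a::euclidean_space \<Rightarrow> ennreal"
  assumes [measurable]: "f \<in> borel_measurable borel" "g \<in> borel_measurable borel" and "S \<ge> 0"
  shows "energy {0<..} f g = energy {0<..S} f g + energy {S<..} f g"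
proof -
  have "indicator {0<..} s = (indicator {0<..S} s + indicator {S<..} s :: ennreal)" for s
    using assms(3) by (auto simp: indicator_def)
  then show ?thesis by (simp add: energy_eq distrib_right nn_integral_add[symmetric])
qed

text \<open>The parallelogram identity: when the midpoint has energy at least \<open>I\<close>, the
  energy of \<open>f - g\<close> is at most \<open>2 * ef + 2 * eg - 4 * I\<close>. Its low band is
  nonnegative, so the tail of \<open>f - g\<close> obeys the same bound. Positivity of the tail
  energy of \<open>f - 2 * g\<close> then bounds the tail of \<open>f\<close> by twice that of
  \<open>g\<close> plus twice that of \<open>f - g\<close>. Signed densities are not formed; both
  positivity facts enter as inequalities for the mixed energy.\<close>

lemma energy_tail_estimate:
  fixes f g :: "'a::euclidean_space \<Rightarrow> ennreal"
  assumes [measurable]: "f \<in> borel_measurable borel" "g \<in> borel_measurable borel" and S: "S \<ge> 0"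
    and f: "energy {0<..} f f \<le> ennreal ef" and g: "energy {0<..} g g \<le> ennreal eg" and nn: "ef \<ge> 0" "eg \<ge> 0" "I \<ge> 0"
    and I: "ennreal I \<le> energy {0<..} (\<lambda>x. ennreal (1/2) * f x + ennreal (1/2) * g x) (\<lambda>x. ennreal (1/2) * f x + ennreal (1/2) * g x)"
  shows "energy {S<..} f f \<le> 2 * energy {S<..} g g + ennreal (2 * (2 * ef + 2 * eg - 4 * I))"
proof -
  define A1 A2 B1 B2 C1 C2 where d: "A1 = energy {0<..S} f f" "A2 = energy {S<..} f f" "B1 = energy {0<..S} g g" "B2 = energy {S<..} g g"
     "C1 = energy {0<..S} f g" "C2 = energy {S<..} f g"
  have A: "A1 + A2 \<le> ennreal ef" and B: "B1 + B2 \<le> ennreal eg"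
    using f g S by (simp_all add: d energy_split)
  have P1: "2 * C1 \<le> A1 + B1" unfolding d by (rule energy_pos_def) auto
  have P1': "2 * C2 \<le> A2 + B2" unfolding d by (rule energy_pos_def) (use S in auto)
  have "energy {S<..} f (\<lambda>x. 2 * g x) = 2 * C2" using energy_linear[of g g f "{S<..}" 2 0] by (simp add: d)
  moreover have "energy {S<..} (\<lambda>x. 2 * g x) (\<lambda>x. 2 * g x) = 4 * B2" using energy_quadratic[of g g "{S<..}" 2 0] by (simp add: d)
  moreover have "2 * energy {S<..} f (\<lambda>x. 2 * g x) \<le> energy {S<..} f f + energy {S<..} (\<lambda>x. 2 * g x) (\<lambda>x. 2 * g x)"
    by (rule energy_pos_def) (use S in auto)
  ultimately have P2: "4 * C2 \<le> A2 + 4 * B2" by (simp add: d mult.assoc[symmetric])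
  have J: "ennreal I \<le> ennreal (1/2) * ennreal (1/2) * (A1 + A2) + 2 * ennreal (1/2) * ennreal (1/2) * (C1 + C2) + ennreal (1/2) * ennreal (1/2) * (B1 + B2)"
    using I S by (simp add: energy_quadratic energy_split d)
  \<comment> \<open>All six energies are finite, so the argument can continue with subtraction in
    the reals.\<close>
  have fin: "A1 \<noteq> \<infinity>" "A2 \<noteq> \<infinity>" "B1 \<noteq> \<infinity>" "B2 \<noteq> \<infinity>" using A B by (auto simp: top_unique)
  have "2 * C1 \<noteq> \<infinity>" "2 * C2 \<noteq> \<infinity>" using P1 P1' fin by (auto simp: top_unique)
  then have fC: "C1 \<noteq> \<infinity>" "C2 \<noteq> \<infinity>" by auto
  have r: "\<exists>x\<ge>0. X = ennreal x" if "X \<noteq> \<infinity>" for X using that by (cases X) auto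
  obtain a1 where a1: "0 \<le> a1" "A1 = ennreal a1" using r[OF fin(1)] by blast
  obtain a2 where a2: "0 \<le> a2" "A2 = ennreal a2" using r[OF fin(2)] by blast
  obtain b1 where b1: "0 \<le> b1" "B1 = ennreal b1" using r[OF fin(3)] by blast
  obtain b2 where b2: "0 \<le> b2" "B2 = ennreal b2" using r[OF fin(4)] by blast
  obtain c1 where c1: "0 \<le> c1" "C1 = ennreal c1" using r[OF fC(1)] by blast
  obtain c2 where c2: "0 \<le> c2" "C2 = ennreal c2" using r[OF fC(2)] by blast
  note e = a1(2) a2(2) b1(2) b2(2) c1(2) c2(2) and p = a1(1) a2(1) b1(1) b2(1) c1(1) c2(1)
  note es = e ennreal_mult[symmetric] ennreal_plus[symmetric] ennreal_numeral[symmetric] 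
  have 1: "a1 + a2 \<le> ef" "b1 + b2 \<le> eg" using A B p nn by (simp_all add: e ennreal_plus[symmetric] del: ennreal_plus)
  have 2: "2 * c1 \<le> a1 + b1" "4 * c2 \<le> a2 + 4 * b2"
    using P1 P2 p by (simp_all add: es del: ennreal_plus ennreal_numeral)
  define h :: real where "h = 1/2"
  have h: "h \<ge> 0" by (simp add: h_def)
  have "I \<le> h * h * (a1 + a2) + 2 * h * h * (c1 + c2) + h * h * (b1 + b2)"
    using J[folded h_def] p h by (simp add: es del: ennreal_plus ennreal_numeral)
  then have 3: "I \<le> 1/4 * (a1 + a2) + 1/2 * (c1 + c2) + 1/4 * (b1 + b2)" by (simp add: h_def)
  have "a2 \<le> 2 * b2 + 2 * (2 * ef + 2 * eg - 4 * I)" using 1 2 3 by argo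
  moreover have "2 * c2 \<le> a2 + b2" using P1' p by (simp add: es del: ennreal_plus ennreal_numeral)
  then have "0 \<le> 2 * ef + 2 * eg - 4 * I" using 1 2 3 p by argo
  ultimately show ?thesis using p by (simp add: d(2)[symmetric] d(4)[symmetric] es del: ennreal_plus ennreal_numeral)
qed

lemma nn_integral_tail:
  fixes F :: "real \<Rightarrow> ennreal"
  assumes [measurable]: "F \<in> borel_measurable borel" and fin: "(\<integral>\<^sup>+s. indicator {0<..} s * F s \<partial>lborel) < \<infinity>" and t: "\<tau> > 0"
  obtains S where "S > 0" "(\<integral>\<^sup>+s. indicator {S<..} s * F s \<partial>lborel) < \<tau>"
proof -
  define f where "f = (\<lambda>n s. indicator {real n<..} s * F s)"
  have "(\<integral>\<^sup>+s. (INF n. f n s) \<partial>lborel) = (INF n. \<integral>\<^sup>+s. f n s \<partial>lborel)"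
  proof (rule nn_integral_monotone_convergence_INF_decseq[where i=0])
    show "decseq f" unfolding f_def
      by (intro monotoneI le_funI mult_right_mono) (auto simp: indicator_def)
    show "f n \<in> borel_measurable lborel" for n unfolding f_def by measurable
    show "integral\<^sup>N lborel (f 0) < \<infinity>" using fin by (simp add: f_def)
  qed
  moreover have "(INF n. f n s) = 0" for s
  proof -
    obtain n where "real n > s" using reals_Archimedean2 by blast
    then have "f n s = 0" by (simp add: f_def)
    then show ?thesis by (metis INF_lower UNIV_I le_zero_eq)
  qed
  ultimately have "(INF n. \<integral>\<^sup>+s. f n s \<partial>lborel) < \<tau>" using t by simp
  then obtain n where n: "(\<integral>\<^sup>+s. f n s \<partial>lborel) < \<tau>" by (auto simp: INF_less_iff)
  have "(\<integral>\<^sup>+s. indicator {real n + 1<..} s * F s \<partial>lborel) \<le> (\<integral>\<^sup>+s. f n s \<partial>lborel)"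
    by (rule nn_integral_mono) (auto simp: f_def indicator_def)
  then show ?thesis using that[of "real n + 1"] n by (simp add: le_less_trans)
qed

subsection \<open>Newtonian potentials\<close>

lemma nn_integral_gamma:
  assumes m: "m > 0" and a: "a > 0"
  shows "(\<integral>\<^sup>+s. indicator {0<..} s * ennreal (s powr (m - 1) * exp (- s * a)) \<partial>lborel) = ennreal (Gamma m * a powr (- m))"
proof -
  have G: "(\<integral>\<^sup>+t\<in>{0..}. ennreal (t powr (m - 1) / exp t) \<partial>lborel) = ennreal (Gamma m)"
    by (rule nn_integral_has_integral_lebesgue'[OF _ Gamma_integral_real[OF m]]) auto
  have "(\<integral>\<^sup>+t\<in>{0..}. ennreal (t powr (m - 1) / exp t) \<partial>lborel) 
      = \<bar>a\<bar> * (\<integral>\<^sup>+s. ennreal ((0 + a * s) powr (m - 1) / exp (0 + a * s)) * indicator {0..} (0 + a * s) \<partial>lborel)"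
    by (rule nn_integral_real_affine) (use a in auto)
  also have "(\<integral>\<^sup>+s. ennreal ((0 + a * s) powr (m - 1) / exp (0 + a * s)) * indicator {0..} (0 + a * s) \<partial>lborel)
     = (\<integral>\<^sup>+s. ennreal (a powr (m - 1)) * (indicator {0<..} s * ennreal (s powr (m - 1) * exp (- s * a))) \<partial>lborel)"
  proof (rule nn_integral_cong_AE, use AE_lborel_singleton[of 0] in eventually_elim)
    case (elim s)
    have "(a * s) powr (m - 1) = a powr (m - 1) * s powr (m - 1)" if "s > 0" using that a by (simp add: powr_mult)
    then show ?case using a elim
      by (auto simp: indicator_def zero_le_mult_iff ennreal_mult[symmetric] exp_minus field_simps)
  qed
  also have "\<dots> = ennreal (a powr (m - 1)) * (\<integral>\<^sup>+s. indicator {0<..} s * ennreal (s powr (m - 1) * exp (- s * a)) \<partial>lborel)"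
    by (rule nn_integral_cmult) measurable
  finally have e: "ennreal (Gamma m) = ennreal (a powr m) * (\<integral>\<^sup>+s. indicator {0<..} s * ennreal (s powr (m - 1) * exp (- s * a)) \<partial>lborel)"
    unfolding G using a by (simp add: mult.assoc[symmetric] ennreal_mult[symmetric] powr_mult_base)
  have one: "ennreal (a powr (-m)) * ennreal (a powr m) = 1" using a by (simp add: ennreal_mult[symmetric] powr_add[symmetric])
  have "ennreal (Gamma m * a powr (- m)) = ennreal (a powr (-m)) * ennreal (Gamma m)" using m by (simp add: ennreal_mult[symmetric] mult.commute Gamma_real_pos less_imp_le)
  also have "\<dots> = (\<integral>\<^sup>+s. indicator {0<..} s * ennreal (s powr (m - 1) * exp (- s * a)) \<partial>lborel)"
    unfolding e mult.assoc[symmetric] one by simp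
  finally show ?thesis by simp
qed

lemma newton_measurable [measurable]: "newton \<in> borel_measurable borel"
  unfolding newton_def[abs_def] by measurable

lemma newton_nonneg [simp]: "newton x \<ge> 0" by (simp add: newton_def)

lemma pot_newton:
  fixes f :: "'a::euclidean_space \<Rightarrow> ennreal"
  assumes d: "DIM('a) \<ge> 3" and [measurable]: "f \<in> borel_measurable borel"
  shows "pot {0<..} f x = (\<integral>\<^sup>+y. ennreal (Gamma (DIM('a) / 2 - 1) * newton (x - y)) * f y \<partial>lborel)"
proof -
  define m where "m = DIM('a) / 2 - 1"
  have m: "m > 0" using d by (simp add: m_def)
  have m1: "DIM('a) / 2 - 2 = m - 1" by (simp add: m_def)
  have mm: "(\<lambda>(y, s). indicator {0<..} s * ennreal (s powr (m - 1)) * (ennreal (exp (- s * ((x - y) \<bullet> (x - y)))) * f y)) \<in> borel_measurable ((lborel :: 'a measure) \<Otimes>\<^sub>M lborel)"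
    by measurable
  have "pot {0<..} f x = (\<integral>\<^sup>+s. (\<integral>\<^sup>+y. indicator {0<..} s * ennreal (s powr (m - 1)) * (ennreal (exp (- s * ((x - y) \<bullet> (x - y)))) * f y) \<partial>lborel) \<partial>lborel)"
    unfolding pot_def gauss_pot_def m1 by (intro nn_integral_cong nn_integral_cmult[symmetric]) measurable
  also have "\<dots> = (\<integral>\<^sup>+y. (\<integral>\<^sup>+s. indicator {0<..} s * ennreal (s powr (m - 1)) * (ennreal (exp (- s * ((x - y) \<bullet> (x - y)))) * f y) \<partial>lborel) \<partial>lborel)"
    by (rule lborel_pair.Fubini'[OF mm])
  also have "\<dots> = (\<integral>\<^sup>+y. ennreal (Gamma m * newton (x - y)) * f y \<partial>lborel)"
  proof (rule nn_integral_cong_AE, use AE_lborel_singleton[of x] in eventually_elim)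
    case (elim y)
    have "(\<integral>\<^sup>+s. indicator {0<..} s * ennreal (s powr (m - 1)) * (ennreal (exp (- s * ((x - y) \<bullet> (x - y)))) * f y) \<partial>lborel)
       = (\<integral>\<^sup>+s. (indicator {0<..} s * ennreal (s powr (m - 1) * exp (- s * ((x - y) \<bullet> (x - y))))) * f y \<partial>lborel)"
      by (intro nn_integral_cong) (simp add: ennreal_mult mult.assoc)
    also have "\<dots> = (\<integral>\<^sup>+s. indicator {0<..} s * ennreal (s powr (m - 1) * exp (- s * ((x - y) \<bullet> (x - y)))) \<partial>lborel) * f y"
      by (rule nn_integral_multc) measurable
    also have "\<dots> = ennreal (Gamma m * newton (x - y)) * f y"
      using nn_integral_gamma[OF m, of "(x - y) \<bullet> (x - y)"] elim by (simp add: newton_def m_def)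
    finally show ?case .
  qed
  finally show ?thesis by (simp add: m_def)
qed

section \<open>Mean values of the Newton kernel and of potentials\<close>

lemma nn_integral_cball:
  fixes f :: "'a::euclidean_space \<Rightarrow> real"
  assumes c: "continuous_on (cball x r) f" and p: "\<And>y. y \<in> cball x r \<Longrightarrow> 0 \<le> f y"
  shows "(\<integral>\<^sup>+z. indicator (cball x r) z * ennreal (f z) \<partial>lborel) = ennreal (integral (cball x r) f)"
proof -
  have i: "integrable lborel (\<lambda>z. indicator (cball x r) z *\<^sub>R f z)"
    using cball_integrable_continuous[OF c] by (simp add: set_integrable_def)
  have "(\<integral>\<^sup>+z. indicator (cball x r) z * ennreal (f z) \<partial>lborel) = (\<integral>\<^sup>+z. ennreal (indicator (cball x r) z *\<^sub>R f z) \<partial>lborel)"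
    by (intro nn_integral_cong) (auto simp: indicator_def)
  also have "\<dots> = ennreal (LINT z:cball x r|lborel. f z)"
    unfolding set_lebesgue_integral_def by (rule nn_integral_eq_integral[OF i]) (use p in \<open>auto simp: indicator_def\<close>)
  also have "(LINT z:cball x r|lborel. f z) = integral (cball x r) f"
    by (rule set_borel_integral_eq_integral(2)[OF cball_integrable_continuous[OF c]])
  finally show ?thesis .
qed

text \<open>The ball may contain the pole. The truncations are continuous, superharmonic and below
  the kernel, and they converge to it off the origin; Fatou's lemma gives the limit.\<close>

lemma newton_mean_le:
  fixes x :: "'a::euclidean_space"
  assumes d: "DIM('a) \<ge> 3" and x: "x \<noteq> 0" and r: "r > 0"
  shows "(\<integral>\<^sup>+z. indicator (cball x r) z * ennreal (newton z) \<partial>lborel) \<le> ennreal (measure lborel (cball x r) * newton x)"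
proof -
  define m where "m = DIM('a) / 2 - 1"
  have m: "m > 0" using d by (simp add: m_def)
  define T where "T = (\<lambda>n. inverse (real (Suc n)))"
  have T: "T n > 0" for n by (simp add: T_def)
  define g where "g = (\<lambda>n z::'a. max (z \<bullet> z) (T n) powr (-m))"
  have gc: "continuous_on A (g n)" for A n
    unfolding g_def by (intro continuous_intros) (use T[of n] in \<open>auto simp: max_def\<close>)
  have gl: "g n z \<le> newton z" if "z \<noteq> 0" for n z
    unfolding g_def newton_def m_def[symmetric] using m that by (intro powr_mono2') auto
  have bound: "(\<integral>\<^sup>+z. indicator (cball x r) z * ennreal (g n z) \<partial>lborel) \<le> ennreal (measure lborel (cball x r) * newton x)" for n
  proof -
    have "0 \<le> ball_defect r (\<lambda>z. - g n z) x"
      using truncated_newton_superharmonic[OF d T[of n]] r by (auto simp: subharmonic_on_defect g_def m_def)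
    then have "integral (cball x r) (g n) \<le> measure lborel (cball x r) * g n x"
      unfolding ball_defect_minus using ball_defect_eq[OF gc[of "cball x r"], of n] by (simp add: mult.commute)
    also have "\<dots> \<le> measure lborel (cball x r) * newton x" using gl[OF x] by (intro mult_left_mono) auto
    finally show ?thesis by (subst nn_integral_cball[OF gc]) (auto simp: g_def intro!: ennreal_leI)
  qed
  have "(\<integral>\<^sup>+z. indicator (cball x r) z * ennreal (newton z) \<partial>lborel) = (\<integral>\<^sup>+z. liminf (\<lambda>n. indicator (cball x r) z * ennreal (g n z)) \<partial>lborel)"
  proof (rule nn_integral_cong_AE, use AE_lborel_singleton[of 0] in eventually_elim)
    case (elim z)
    have "T \<longlonglongrightarrow> 0" unfolding T_def by (rule LIMSEQ_inverse_real_of_nat)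
    then have "\<forall>\<^sub>F n in sequentially. T n < z \<bullet> z" by (rule order_tendstoD) (use elim in simp)
    then have "\<forall>\<^sub>F n in sequentially. indicator (cball x r) z * ennreal (g n z) = indicator (cball x r) z * ennreal (newton z)"
      by eventually_elim (simp add: g_def newton_def m_def max_def)
    then have "(\<lambda>n. indicator (cball x r) z * ennreal (g n z)) \<longlonglongrightarrow> indicator (cball x r) z * ennreal (newton z)"
      by (rule tendsto_eventually)
    then show ?case by (simp add: lim_imp_Liminf)
  qed
  also have "\<dots> \<le> liminf (\<lambda>n. \<integral>\<^sup>+z. indicator (cball x r) z * ennreal (g n z) \<partial>lborel)"
  proof (rule nn_integral_liminf)
    have [measurable]: "g n \<in> borel_measurable borel" for n by (rule borel_measurable_continuous_onI[OF gc])
    show "(\<lambda>z. indicator (cball x r) z * ennreal (g n z)) \<in> borel_measurable lborel" for n by measurable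
  qed
  also have "\<dots> \<le> ennreal (measure lborel (cball x r) * newton x)"
    by (rule Liminf_le) (use bound in auto)
  finally show ?thesis .
qed

lemma newton_mean_eq:
  fixes x :: "'a::euclidean_space"
  assumes d: "DIM('a) \<ge> 3" and r: "0 < r" "r < norm x"
  shows "(\<integral>\<^sup>+z. indicator (cball x r) z * ennreal (newton z) \<partial>lborel) = ennreal (measure lborel (cball x r) * newton x)"
proof -
  have sub: "cball x r \<subseteq> - {0}" using r by (auto simp: dist_norm)
  have c: "continuous_on (cball x r) newton" by (rule continuous_on_subset[OF continuous_newton sub])
  have "0 \<le> ball_defect r newton x" "0 \<le> ball_defect r (\<lambda>z. - newton z) x"
    using newton_harmonic[OF d] r sub by (auto simp: subharmonic_on_defect)
  then have "integral (cball x r) newton = measure lborel (cball x r) * newton x"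
    unfolding ball_defect_minus ball_defect_eq[OF c] by (simp add: mult.commute)
  then show ?thesis using nn_integral_cball[OF c] by simp
qed

lemma cball_shift_measure: "measure lborel (cball (x - y) r) = measure lborel (cball (x :: 'a::euclidean_space) r)"
  by (cases "r \<ge> 0") (simp_all add: content_cball)

lemma newton_mean_shift:
  fixes x y :: "'a::euclidean_space"
  shows "(\<integral>\<^sup>+z. indicator (cball x r) z * ennreal (newton (z - y)) \<partial>lborel) = (\<integral>\<^sup>+z. indicator (cball (x - y) r) z * ennreal (newton z) \<partial>lborel)"
proof -
  have "(\<integral>\<^sup>+z. indicator (cball (x - y) r) z * ennreal (newton z) \<partial>lborel) = (\<integral>\<^sup>+z. indicator (cball (x - y) r) (z - y) * ennreal (newton (z - y)) \<partial>lborel)"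
    by (rule nn_integral_lborel_shift[symmetric]) measurable
  then show ?thesis by (simp add: indicator_def dist_norm)
qed

lemma pot_mean_swap:
  fixes f :: "'a::euclidean_space \<Rightarrow> ennreal"
  assumes d: "DIM('a) \<ge> 3" and [measurable]: "f \<in> borel_measurable borel"
  shows "(\<integral>\<^sup>+z. indicator (cball x r) z * pot {0<..} f z \<partial>lborel)
    = (\<integral>\<^sup>+y. ennreal (Gamma (DIM('a) / 2 - 1)) * f y * (\<integral>\<^sup>+z. indicator (cball (x - y) r) z * ennreal (newton z) \<partial>lborel) \<partial>lborel)"
proof -
  define G where "G = Gamma (DIM('a) / 2 - 1)"
  have G: "G \<ge> 0" using d by (simp add: G_def Gamma_real_pos less_imp_le)
  have "(\<integral>\<^sup>+z. indicator (cball x r) z * pot {0<..} f z \<partial>lborel) = (\<integral>\<^sup>+z. (\<integral>\<^sup>+y. indicator (cball x r) z * (ennreal (G * newton (z - y)) * f y) \<partial>lborel) \<partial>lborel)"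
    unfolding pot_newton[OF d assms(2)] G_def by (intro nn_integral_cong nn_integral_cmult[symmetric]) measurable
  also have "\<dots> = (\<integral>\<^sup>+y. (\<integral>\<^sup>+z. indicator (cball x r) z * (ennreal (G * newton (z - y)) * f y) \<partial>lborel) \<partial>lborel)"
    by (intro lborel_pair.Fubini'[symmetric]) measurable
  also have "\<dots> = (\<integral>\<^sup>+y. (ennreal G * f y) * (\<integral>\<^sup>+z. indicator (cball x r) z * ennreal (newton (z - y)) \<partial>lborel) \<partial>lborel)"
  proof (rule nn_integral_cong)
    fix y :: 'a
    have "(\<integral>\<^sup>+z. indicator (cball x r) z * (ennreal (G * newton (z - y)) * f y) \<partial>lborel) = (\<integral>\<^sup>+z. (ennreal G * f y) * (indicator (cball x r) z * ennreal (newton (z - y))) \<partial>lborel)"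
      using G by (intro nn_integral_cong) (simp add: ennreal_mult mult_ac)
    also have "\<dots> = (ennreal G * f y) * (\<integral>\<^sup>+z. indicator (cball x r) z * ennreal (newton (z - y)) \<partial>lborel)"
      by (rule nn_integral_cmult) measurable
    finally show "(\<integral>\<^sup>+z. indicator (cball x r) z * (ennreal (G * newton (z - y)) * f y) \<partial>lborel) = \<dots>" .
  qed
  finally show ?thesis unfolding newton_mean_shift G_def .
qed

lemma measure_cball_times_pot:
  fixes f :: "'a::euclidean_space \<Rightarrow> ennreal"
  assumes d: "DIM('a) \<ge> 3" and [measurable]: "f \<in> borel_measurable borel"
  shows "ennreal (measure lborel (cball x r)) * pot {0<..} f x = (\<integral>\<^sup>+y. ennreal (Gamma (DIM('a) / 2 - 1)) * f y * ennreal (measure lborel (cball (x - y) r) * newton (x - y)) \<partial>lborel)"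
proof -
  have "ennreal (measure lborel (cball x r)) * pot {0<..} f x = (\<integral>\<^sup>+y. ennreal (measure lborel (cball x r)) * (ennreal (Gamma (DIM('a) / 2 - 1) * newton (x - y)) * f y) \<partial>lborel)"
    unfolding pot_newton[OF d assms(2)] by (rule nn_integral_cmult[symmetric]) measurable
  then show ?thesis using d
    by (simp add: cball_shift_measure ennreal_mult Gamma_real_pos less_imp_le mult_ac)
qed

lemma pot_mean_le:
  fixes f :: "'a::euclidean_space \<Rightarrow> ennreal"
  assumes d: "DIM('a) \<ge> 3" and f: "f \<in> borel_measurable borel" and r: "r > 0"
  shows "(\<integral>\<^sup>+z. indicator (cball x r) z * pot {0<..} f z \<partial>lborel) \<le> ennreal (measure lborel (cball x r)) * pot {0<..} f x"
  unfolding pot_mean_swap[OF d f] measure_cball_times_pot[OF d f]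
proof (rule nn_integral_mono_AE, use AE_lborel_singleton[of x] in eventually_elim)
  case (elim y)
  then show ?case by (intro mult_left_mono newton_mean_le[OF d _ r]) auto
qed

lemma pot_mean_eq:
  fixes f :: "'a::euclidean_space \<Rightarrow> ennreal"
  assumes d: "DIM('a) \<ge> 3" and f: "f \<in> borel_measurable borel" and r: "r > 0" and far: "\<And>y. f y \<noteq> 0 \<Longrightarrow> r < dist x y"
  shows "(\<integral>\<^sup>+z. indicator (cball x r) z * pot {0<..} f z \<partial>lborel) = ennreal (measure lborel (cball x r)) * pot {0<..} f x"
  unfolding pot_mean_swap[OF d f] measure_cball_times_pot[OF d f]
proof (rule nn_integral_cong)
  fix y
  show "ennreal (Gamma (DIM('a) / 2 - 1)) * f y * (\<integral>\<^sup>+z. indicator (cball (x - y) r) z * ennreal (newton z) \<partial>lborel)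
     = ennreal (Gamma (DIM('a) / 2 - 1)) * f y * ennreal (measure lborel (cball (x - y) r) * newton (x - y))"
    using newton_mean_eq[OF d r, of "x - y"] far[of y] by (cases "f y = 0") (auto simp: dist_norm)
qed

section \<open>Size and oscillation of potentials\<close>

lemma pot_upper:
  fixes f :: "'a::euclidean_space \<Rightarrow> ennreal"
  assumes d: "DIM('a) \<ge> 3" and [measurable]: "f \<in> borel_measurable borel" and t: "t > 0"
    and far: "\<And>y. f y \<noteq> 0 \<Longrightarrow> t \<le> dist x y"
  shows "pot {0<..} f x \<le> ennreal (Gamma (DIM('a) / 2 - 1) * (t\<^sup>2) powr (- (DIM('a) / 2 - 1))) * (\<integral>\<^sup>+y. f y \<partial>lborel)"
proof -
  have "pot {0<..} f x \<le> (\<integral>\<^sup>+y. ennreal (Gamma (DIM('a) / 2 - 1) * (t\<^sup>2) powr (- (DIM('a) / 2 - 1))) * f y \<partial>lborel)"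
    unfolding pot_newton[OF d assms(2)]
  proof (rule nn_integral_mono)
    fix y
    show "ennreal (Gamma (DIM('a) / 2 - 1) * newton (x - y)) * f y \<le> ennreal (Gamma (DIM('a) / 2 - 1) * (t\<^sup>2) powr (- (DIM('a) / 2 - 1))) * f y"
    proof (cases "f y = 0")
      case False
      have "t\<^sup>2 \<le> (norm (x - y))\<^sup>2" using far[OF False] t by (intro power_mono) (auto simp: dist_norm)
      then have "newton (x - y) \<le> (t\<^sup>2) powr (- (DIM('a) / 2 - 1))"
        unfolding newton_def using t d by (intro powr_mono2') (auto simp: dot_square_norm)
      then show ?thesis using d by (intro mult_right_mono ennreal_leI mult_left_mono) (auto simp: Gamma_real_pos less_imp_le)
    qed simp
  qed
  also have "\<dots> = ennreal (Gamma (DIM('a) / 2 - 1) * (t\<^sup>2) powr (- (DIM('a) / 2 - 1))) * (\<integral>\<^sup>+y. f y \<partial>lborel)"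
    by (rule nn_integral_cmult) measurable
  finally show ?thesis .
qed

lemma pot_lower:
  fixes f :: "'a::euclidean_space \<Rightarrow> ennreal"
  assumes d: "DIM('a) \<ge> 3" and [measurable]: "f \<in> borel_measurable borel" and t: "t > 0"
    and near: "\<And>y. f y \<noteq> 0 \<Longrightarrow> dist x y \<le> t"
  shows "ennreal (Gamma (DIM('a) / 2 - 1) * (t\<^sup>2) powr (- (DIM('a) / 2 - 1))) * (\<integral>\<^sup>+y. f y \<partial>lborel) \<le> pot {0<..} f x"
proof -
  have "ennreal (Gamma (DIM('a) / 2 - 1) * (t\<^sup>2) powr (- (DIM('a) / 2 - 1))) * (\<integral>\<^sup>+y. f y \<partial>lborel)
     = (\<integral>\<^sup>+y. ennreal (Gamma (DIM('a) / 2 - 1) * (t\<^sup>2) powr (- (DIM('a) / 2 - 1))) * f y \<partial>lborel)"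
    by (rule nn_integral_cmult[symmetric]) measurable
  also have "\<dots> \<le> pot {0<..} f x"
    unfolding pot_newton[OF d assms(2)]
  proof (rule nn_integral_mono_AE, use AE_lborel_singleton[of x] in eventually_elim)
    case (elim y)
    show ?case
    proof (cases "f y = 0")
      case False
      have "(norm (x - y))\<^sup>2 \<le> t\<^sup>2" using near[OF False] by (intro power_mono) (auto simp: dist_norm)
      then have "(t\<^sup>2) powr (- (DIM('a) / 2 - 1)) \<le> newton (x - y)"
        unfolding newton_def using elim d by (intro powr_mono2') (auto simp: dot_square_norm)
      then show ?thesis using d by (intro mult_right_mono ennreal_leI mult_left_mono) (auto simp: Gamma_real_pos less_imp_le)
    qed simp
  qed
  finally show ?thesis .
qed

text \<open>The map \<open>exp (- p)\<close> is 1-Lipschitz for nonnegative \<open>p\<close>. The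
  squared norms of \<open>x - y\<close> and \<open>x' - y\<close> differ by the inner product of
  \<open>x - x'\<close> with their sum, whose norm is at most \<open>4 * R\<close>.\<close>

lemma gauss_pot_lipschitz:
  fixes f :: "'a::euclidean_space \<Rightarrow> ennreal"
  assumes [measurable]: "f \<in> borel_measurable borel" and s: "s \<ge> 0" and R: "R \<ge> 0"
    and near: "\<And>y. f y \<noteq> 0 \<Longrightarrow> y \<in> cball a R" and x: "x \<in> cball a R" "x' \<in> cball a R"
  shows "gauss_pot s f x \<le> gauss_pot s f x' + ennreal (s * (4 * R * norm (x - x'))) * (\<integral>\<^sup>+y. f y \<partial>lborel)"
proof -
  have ex: "exp (- p) \<le> exp (- q) + \<bar>p - q\<bar>" if "p \<ge> 0" "q \<ge> 0" for p q :: real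
  proof (cases "p \<ge> q")
    case True then show ?thesis by (simp add: add_increasing2)
  next
    case False
    have "exp (- p) - exp (- q) = exp (- p) * (1 - exp (- (q - p)))" by (simp add: right_diff_distrib exp_add[symmetric])
    also have "\<dots> \<le> 1 * (q - p)"
    proof (rule mult_mono)
      have "1 + - (q - p) \<le> exp (- (q - p))" by (rule exp_ge_add_one_self)
      then show "1 - exp (- (q - p)) \<le> q - p" by linarith
    qed (use that False in auto)
    finally show ?thesis using False by simp
  qed
  have "gauss_pot s f x \<le> (\<integral>\<^sup>+y. ennreal (exp (- s * ((x' - y) \<bullet> (x' - y)))) * f y + ennreal (s * (4 * R * norm (x - x'))) * f y \<partial>lborel)"
    unfolding gauss_pot_def
  proof (rule nn_integral_mono)
    fix y
    show "ennreal (exp (- s * ((x - y) \<bullet> (x - y)))) * f y \<le> ennreal (exp (- s * ((x' - y) \<bullet> (x' - y)))) * f y + ennreal (s * (4 * R * norm (x - x'))) * f y"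
    proof (cases "f y = 0")
      case False
      have y: "dist a y \<le> R" using near[OF False] by simp
      have "norm (x - y) \<le> 2 * R" "norm (x' - y) \<le> 2 * R"
        using x y dist_triangle3[of x y a] dist_triangle3[of x' y a] by (auto simp: dist_norm)
      then have "norm (x - y + (x' - y)) \<le> 4 * R" using norm_triangle_ineq[of "x - y" "x' - y"] by linarith
      then have n: "norm (x - x') * norm (x - y + (x' - y)) \<le> norm (x - x') * (4 * R)" by (intro mult_left_mono) auto
      have "(x - y) \<bullet> (x - y) - (x' - y) \<bullet> (x' - y) = (x - x') \<bullet> (x - y + (x' - y))"
        by (simp add: inner_simps inner_commute algebra_simps)
      then have "\<bar>(x - y) \<bullet> (x - y) - (x' - y) \<bullet> (x' - y)\<bar> \<le> 4 * R * norm (x - x')"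
        using Cauchy_Schwarz_ineq2[of "x - x'" "x - y + (x' - y)"] n by (simp add: mult.commute)
      then have "s * \<bar>(x - y) \<bullet> (x - y) - (x' - y) \<bullet> (x' - y)\<bar> \<le> s * (4 * R * norm (x - x'))" using s by (intro mult_left_mono)
      moreover have "\<bar>s * ((x - y) \<bullet> (x - y)) - s * ((x' - y) \<bullet> (x' - y))\<bar> = s * \<bar>(x - y) \<bullet> (x - y) - (x' - y) \<bullet> (x' - y)\<bar>"
        using s by (simp add: right_diff_distrib[symmetric] abs_mult)
      ultimately have "exp (- s * ((x - y) \<bullet> (x - y))) \<le> exp (- s * ((x' - y) \<bullet> (x' - y))) + s * (4 * R * norm (x - x'))"
        using ex[of "s * ((x - y) \<bullet> (x - y))" "s * ((x' - y) \<bullet> (x' - y))"] s by simp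
      then have "ennreal (exp (- s * ((x - y) \<bullet> (x - y)))) \<le> ennreal (exp (- s * ((x' - y) \<bullet> (x' - y))) + s * (4 * R * norm (x - x')))"
        by (rule ennreal_leI)
      also have "\<dots> = ennreal (exp (- s * ((x' - y) \<bullet> (x' - y)))) + ennreal (s * (4 * R * norm (x - x')))"
        by (rule ennreal_plus) (use s R in auto)
      finally have "ennreal (exp (- s * ((x - y) \<bullet> (x - y)))) \<le> ennreal (exp (- s * ((x' - y) \<bullet> (x' - y)))) + ennreal (s * (4 * R * norm (x - x')))" .
      from mult_right_mono[OF this, of "f y"] show ?thesis by (simp add: distrib_right)
    qed simp
  qed
  also have "\<dots> = gauss_pot s f x' + ennreal (s * (4 * R * norm (x - x'))) * (\<integral>\<^sup>+y. f y \<partial>lborel)"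
    unfolding gauss_pot_def by (subst nn_integral_add) (auto simp: nn_integral_cmult)
  finally show ?thesis .
qed

text \<open>The weight times \<open>s\<close> is at most \<open>S powr (DIM('a) / 2 - 1)\<close>,
  and the interval of scales has length \<open>S\<close>. The density enters through its mass only,
  so the estimate is uniform over densities without a common bound.\<close>

lemma pot_low_lipschitz:
  fixes f :: "'a::euclidean_space \<Rightarrow> ennreal"
  assumes d: "DIM('a) \<ge> 3" and fm[measurable]: "f \<in> borel_measurable borel" and S: "S \<ge> 0" and R: "R \<ge> 0"
    and near: "\<And>y. f y \<noteq> 0 \<Longrightarrow> y \<in> cball a R" and x: "x \<in> cball a R" "x' \<in> cball a R"
  shows "pot {0<..S} f x \<le> pot {0<..S} f x' + ennreal (S powr (DIM('a) / 2 - 1) * S * (4 * R * norm (x - x'))) * (\<integral>\<^sup>+y. f y \<partial>lborel)"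
proof -
  define m where "m = DIM('a) / 2 - 1"
  have m: "m > 0" using d by (simp add: m_def)
  have m1: "DIM('a) / 2 - 2 = m - 1" by (simp add: m_def)
  define N where "N = 4 * R * norm (x - x')"
  have N: "N \<ge> 0" using R by (simp add: N_def)
  define M where "M = (\<integral>\<^sup>+y. f y \<partial>lborel)"
  have "pot {0<..S} f x \<le> (\<integral>\<^sup>+s. indicator {0<..S} s * ennreal (s powr (m - 1)) * gauss_pot s f x' + indicator {0<..S} s * (ennreal (S powr m * N) * M) \<partial>lborel)"
    unfolding pot_def m1
  proof (rule nn_integral_mono)
    fix s :: real
    show "indicator {0<..S} s * ennreal (s powr (m - 1)) * gauss_pot s f x \<le> indicator {0<..S} s * ennreal (s powr (m - 1)) * gauss_pot s f x' + indicator {0<..S} s * (ennreal (S powr m * N) * M)"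
    proof (cases "0 < s \<and> s \<le> S")
      case True
      have "ennreal (s powr (m - 1)) * gauss_pot s f x \<le> ennreal (s powr (m - 1)) * (gauss_pot s f x' + ennreal (s * N) * M)"
        unfolding N_def M_def using True by (intro mult_left_mono gauss_pot_lipschitz[where a=a] fm near x R) auto
      also have "\<dots> = ennreal (s powr (m - 1)) * gauss_pot s f x' + ennreal (s powr m * N) * M"
        using True N by (simp add: distrib_left mult.assoc[symmetric] ennreal_mult[symmetric] powr_mult_base mult.commute[of _ s])
      also have "\<dots> \<le> ennreal (s powr (m - 1)) * gauss_pot s f x' + ennreal (S powr m * N) * M"
        using True N m by (intro add_left_mono mult_right_mono ennreal_leI powr_mono2) auto
      finally show ?thesis using True by simp
    qed (auto simp: indicator_def)
  qed
  also have "\<dots> = pot {0<..S} f x' + (\<integral>\<^sup>+s. indicator {0<..S} s * (ennreal (S powr m * N) * M) \<partial>lborel)"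
    unfolding pot_def m1 by (rule nn_integral_add) measurable
  also have "(\<integral>\<^sup>+s. indicator {0<..S} s * (ennreal (S powr m * N) * M) \<partial>lborel) = ennreal (S powr m * S * N) * M"
  proof -
    have "(\<integral>\<^sup>+s. indicator {0<..S} s * (ennreal (S powr m * N) * M) \<partial>lborel) = ennreal S * (ennreal (S powr m * N) * M)"
      using S by (subst nn_integral_multc) simp_all
    also have "\<dots> = ennreal (S * (S powr m * N)) * M" using S N by (simp add: mult.assoc[symmetric] ennreal_mult)
    also have "S * (S powr m * N) = S powr m * S * N" by simp
    finally show ?thesis .
  qed
  finally show ?thesis by (simp add: N_def M_def m_def)
qed

lemma pot_split:
  fixes f :: "'a::euclidean_space \<Rightarrow> ennreal"
  assumes [measurable]: "f \<in> borel_measurable borel" and "S \<ge> 0"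
  shows "pot {0<..} f x = pot {0<..S} f x + pot {S<..} f x"
proof -
  have "indicator {0<..} s = (indicator {0<..S} s + indicator {S<..} s :: ennreal)" for s
    using assms(2) by (auto simp: indicator_def)
  then show ?thesis by (simp add: pot_def distrib_right nn_integral_add[symmetric])
qed

lemma pot_lipschitz_tail:
  fixes f :: "'a::euclidean_space \<Rightarrow> ennreal"
  assumes d: "DIM('a) \<ge> 3" and fm: "f \<in> borel_measurable borel" and S: "S \<ge> 0" and R: "R \<ge> 0"
    and near: "\<And>y. f y \<noteq> 0 \<Longrightarrow> y \<in> cball a R" and x: "x \<in> cball a R" "x' \<in> cball a R"
    and tail: "pot {S<..} f x \<le> \<tau>"
  shows "pot {0<..} f x \<le> pot {0<..} f x' + ennreal (S powr (DIM('a) / 2 - 1) * S * (4 * R * norm (x - x'))) * (\<integral>\<^sup>+y. f y \<partial>lborel) + \<tau>"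
proof -
  have "pot {0<..} f x = pot {0<..S} f x + pot {S<..} f x" by (rule pot_split[OF fm S])
  also have "\<dots> \<le> (pot {0<..S} f x' + ennreal (S powr (DIM('a) / 2 - 1) * S * (4 * R * norm (x - x'))) * (\<integral>\<^sup>+y. f y \<partial>lborel)) + \<tau>"
    by (intro add_mono pot_low_lipschitz[OF d fm S R near x] tail)
  also have "pot {0<..S} f x' \<le> pot {0<..} f x'" unfolding pot_split[OF fm S] by simp
  finally show ?thesis by (simp add: add_mono add.assoc)
qed

subsection \<open>Compact sets of large energy are polar\<close>

text \<open>Real values are needed for the ball defect. The value is 0 where the potential is
  infinite, so finiteness is shown before anything is concluded from \<open>potr\<close>.\<close>

definition potr :: "('a::euclidean_space \<Rightarrow> ennreal) \<Rightarrow> 'a \<Rightarrow> real" where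
  "potr f x = enn2real (pot {0<..} f x)"

lemma potr_nonneg [simp]: "potr f x \<ge> 0" by (simp add: potr_def)

lemma pot_eq_potr: "pot {0<..} f x < \<infinity> \<Longrightarrow> pot {0<..} f x = ennreal (potr f x)"
  by (simp add: potr_def)

text \<open>Seen from a point \<open>x\<close> of the ball, the density lies below \<open>B\<close>
  times the indicator of the ball of radius \<open>2 * R\<close> about \<open>x\<close>. Translation
  to the origin makes the bound independent of \<open>x\<close>, which yields finiteness and
  uniformly small tails.\<close>

lemma gauss_pot_bounded_density:
  fixes f :: "'a::euclidean_space \<Rightarrow> ennreal"
  assumes [measurable]: "f \<in> borel_measurable borel" and B: "\<And>y. f y \<le> B"
    and near: "\<And>y. f y \<noteq> 0 \<Longrightarrow> y \<in> cball a R" and x: "x \<in> cball a R"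
  shows "gauss_pot s f x \<le> B * gauss_pot s (indicator (cball 0 (2 * R))) (0::'a)"
proof -
  have "gauss_pot s f x \<le> (\<integral>\<^sup>+y. B * (ennreal (exp (- s * ((y - x) \<bullet> (y - x)))) * indicator (cball 0 (2 * R)) (y - x)) \<partial>lborel)"
    unfolding gauss_pot_def
  proof (rule nn_integral_mono)
    fix y
    show "ennreal (exp (- s * ((x - y) \<bullet> (x - y)))) * f y \<le> B * (ennreal (exp (- s * ((y - x) \<bullet> (y - x)))) * indicator (cball 0 (2 * R)) (y - x))"
    proof (cases "f y = 0")
      case False
      have "dist a y \<le> R" "dist a x \<le> R" using near[OF False] x by auto
      then have "norm (y - x) \<le> 2 * R" using dist_triangle3[of y x a] by (simp add: dist_norm)
      moreover have "(x - y) \<bullet> (x - y) = (y - x) \<bullet> (y - x)" by (simp add: inner_simps inner_commute)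
      ultimately show ?thesis using mult_left_mono[OF B[of y], of "ennreal (exp (- s * ((y - x) \<bullet> (y - x))))"]
        by (simp add: mult.commute)
    qed simp
  qed
  also have "\<dots> = B * (\<integral>\<^sup>+y. ennreal (exp (- s * ((y - x) \<bullet> (y - x)))) * indicator (cball 0 (2 * R)) (y - x) \<partial>lborel)"
    by (rule nn_integral_cmult) measurable
  also have "(\<integral>\<^sup>+y. ennreal (exp (- s * ((y - x) \<bullet> (y - x)))) * indicator (cball 0 (2 * R)) (y - x) \<partial>lborel) = gauss_pot s (indicator (cball 0 (2 * R))) (0::'a)"
    using nn_integral_lborel_shift[of "\<lambda>y. ennreal (exp (- s * (y \<bullet> y))) * indicator (cball 0 (2 * R)) y" x]
    by (simp add: gauss_pot_def)
  finally show ?thesis .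
qed

lemma pot_bounded_density:
  fixes f :: "'a::euclidean_space \<Rightarrow> ennreal"
  assumes f[measurable]: "f \<in> borel_measurable borel" and B: "\<And>y. f y \<le> B"
    and near: "\<And>y. f y \<noteq> 0 \<Longrightarrow> y \<in> cball a R" and x: "x \<in> cball a R" and [measurable]: "J \<in> sets borel"
  shows "pot J f x \<le> B * pot J (indicator (cball 0 (2 * R))) (0::'a)"
proof -
  have "pot J f x \<le> (\<integral>\<^sup>+s. B * (indicator J s * ennreal (s powr (DIM('a) / 2 - 2)) * gauss_pot s (indicator (cball 0 (2 * R))) (0::'a)) \<partial>lborel)"
    unfolding pot_def
  proof (rule nn_integral_mono)
    fix s :: real
    have "indicator J s * ennreal (s powr (DIM('a) / 2 - 2)) * gauss_pot s f x \<le> indicator J s * ennreal (s powr (DIM('a) / 2 - 2)) * (B * gauss_pot s (indicator (cball 0 (2 * R))) (0::'a))"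
      by (intro mult_left_mono gauss_pot_bounded_density[OF f B near x]) auto
    then show "indicator J s * ennreal (s powr (DIM('a) / 2 - 2)) * gauss_pot s f x \<le> B * (indicator J s * ennreal (s powr (DIM('a) / 2 - 2)) * gauss_pot s (indicator (cball 0 (2 * R))) (0::'a))"
      by (simp add: mult_ac)
  qed
  also have "\<dots> = B * pot J (indicator (cball 0 (2 * R))) (0::'a)"
    unfolding pot_def by (rule nn_integral_cmult) measurable
  finally show ?thesis .
qed

text \<open>\<open>newton_mean_le\<close> excludes the pole as centre, but a ball of radius
  \<open>\<bar>R\<bar> + 1\<close> about a unit vector contains the given ball, and the kernel is
  finite at that vector.\<close>

lemma pot_indicator_finite:
  assumes d: "DIM('a::euclidean_space) \<ge> 3"
  shows "pot {0<..} (indicator (cball 0 R)) (0::'a) < \<infinity>"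
proof -
  obtain b :: 'a where b: "b \<in> Basis" using nonempty_Basis by blast
  then have b1: "norm b = 1" "b \<noteq> 0" by auto
  define G where "G = Gamma (DIM('a) / 2 - 1)"
  have G: "G \<ge> 0" using d by (simp add: G_def Gamma_real_pos less_imp_le)
  define r where "r = \<bar>R\<bar> + 1"
  have "pot {0<..} (indicator (cball 0 R)) (0::'a) = (\<integral>\<^sup>+y. ennreal (G * newton (0 - y)) * indicator (cball (0::'a) R) y \<partial>lborel)"
    unfolding G_def by (rule pot_newton[OF d]) measurable
  also have "\<dots> \<le> (\<integral>\<^sup>+y. ennreal G * (indicator (cball b r) y * ennreal (newton (y::'a))) \<partial>lborel)"
  proof (rule nn_integral_mono)
    fix y :: 'a
    have "y \<in> cball b r" if "y \<in> cball 0 R"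
      using that norm_triangle_ineq4[of b y] b1 by (simp add: dist_norm r_def)
    then show "ennreal (G * newton (0 - y)) * indicator (cball 0 R) y \<le> ennreal G * (indicator (cball b r) y * ennreal (newton y))"
      using G by (auto simp: indicator_def newton_def ennreal_mult)
  qed
  also have "\<dots> = ennreal G * (\<integral>\<^sup>+y. indicator (cball b r) y * ennreal (newton (y::'a)) \<partial>lborel)"
    by (rule nn_integral_cmult) measurable
  also have "\<dots> < \<infinity>"
    using le_less_trans[OF newton_mean_le[OF d b1(2), of r] ennreal_less_top] by (simp add: r_def ennreal_mult_less_top)
  finally show ?thesis .
qed

lemma pot_finite:
  fixes f :: "'a::euclidean_space \<Rightarrow> ennreal"
  assumes d: "DIM('a) \<ge> 3" and f: "f \<in> borel_measurable borel" and B: "\<And>y. f y \<le> ennreal B"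
    and near: "\<And>y. f y \<noteq> 0 \<Longrightarrow> y \<in> cball a R"
  shows "pot {0<..} f x < \<infinity>"
proof -
  define R' where "R' = max R (dist a x)"
  have "pot {0<..} f x \<le> ennreal B * pot {0<..} (indicator (cball 0 (2 * R'))) (0::'a)"
    by (rule pot_bounded_density[OF f B, of a]) (use near in \<open>force simp: R'_def\<close>)+
  also have "\<dots> < \<infinity>" using pot_indicator_finite[OF d, of "2 * R'"] by (simp add: ennreal_mult_less_top)
  finally show ?thesis .
qed

lemma pot_tail_uniform:
  fixes f :: "'a::euclidean_space \<Rightarrow> ennreal"
  assumes d: "DIM('a) \<ge> 3" and f: "f \<in> borel_measurable borel" and B: "\<And>y. f y \<le> ennreal B"
    and near: "\<And>y. f y \<noteq> 0 \<Longrightarrow> y \<in> cball a R" and t: "\<tau> > 0"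
  obtains S where "S > 0" "\<And>x. x \<in> cball a R \<Longrightarrow> pot {S<..} f x \<le> ennreal \<tau>"
proof -
  define F where "F = (\<lambda>s. ennreal (s powr (DIM('a) / 2 - 2)) * gauss_pot s (indicator (cball 0 (2 * R))) (0::'a))"
  have Fm: "F \<in> borel_measurable borel" unfolding F_def by measurable
  have P: "pot J (indicator (cball 0 (2 * R))) (0::'a) = (\<integral>\<^sup>+s. indicator J s * F s \<partial>lborel)" for J
    by (simp add: pot_def F_def mult.assoc)
  define B' where "B' = \<bar>B\<bar> + 1"
  have B': "B' > 0" "B \<le> B'" by (auto simp: B'_def)
  have "(\<integral>\<^sup>+s. indicator {0<..} s * F s \<partial>lborel) < \<infinity>" using pot_indicator_finite[OF d, of "2 * R"] by (simp only: P)
  then obtain S where S: "S > 0" "(\<integral>\<^sup>+s. indicator {S<..} s * F s \<partial>lborel) < ennreal (\<tau> / B')"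
    using nn_integral_tail[OF Fm, of "ennreal (\<tau> / B')"] t B' by auto
  have "pot {S<..} f x \<le> ennreal \<tau>" if x: "x \<in> cball a R" for x
  proof -
    have "pot {S<..} f x \<le> ennreal B * pot {S<..} (indicator (cball 0 (2 * R))) (0::'a)"
      by (rule pot_bounded_density[OF f B near x]) auto
    also have "\<dots> \<le> ennreal B' * ennreal (\<tau> / B')"
      unfolding P using S(2) B' by (intro mult_mono ennreal_leI) auto
    also have "\<dots> = ennreal \<tau>" using B' t by (simp add: ennreal_mult[symmetric])
    finally show ?thesis .
  qed
  then show ?thesis using that S by blast
qed

lemma potr_difference:
  fixes f :: "'a::euclidean_space \<Rightarrow> ennreal"
  assumes d: "DIM('a) \<ge> 3" and f: "f \<in> borel_measurable borel" and S: "S \<ge> 0" and R: "R \<ge> 0"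
    and near: "\<And>y. f y \<noteq> 0 \<Longrightarrow> y \<in> cball a R" and x: "x \<in> cball a R" "x' \<in> cball a R"
    and fin: "\<And>x. pot {0<..} f x < \<infinity>" and mass: "(\<integral>\<^sup>+y. f y \<partial>lborel) \<le> ennreal M" "M \<ge> 0" 
    and tail: "\<And>x. x \<in> cball a R \<Longrightarrow> pot {S<..} f x \<le> ennreal \<tau>" and t: "\<tau> \<ge> 0"
  shows "\<bar>potr f x - potr f x'\<bar> \<le> S powr (DIM('a) / 2 - 1) * S * (4 * R) * M * norm (x - x') + \<tau>"
proof -
  define L where "L = S powr (DIM('a) / 2 - 1) * S * (4 * R)"
  have L: "L \<ge> 0" using S R by (simp add: L_def)
  have "potr f x \<le> potr f x' + L * M * norm (x - x') + \<tau>" if x: "x \<in> cball a R" "x' \<in> cball a R" for x x'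
  proof -
    have "ennreal (potr f x) \<le> ennreal (potr f x') + ennreal (L * norm (x - x')) * (\<integral>\<^sup>+y. f y \<partial>lborel) + ennreal \<tau>"
      using pot_lipschitz_tail[OF d f S R near x tail[OF x(1)]]
      by (simp add: pot_eq_potr[OF fin, symmetric] L_def mult.assoc)
    also have "\<dots> \<le> ennreal (potr f x') + ennreal (L * norm (x - x')) * ennreal M + ennreal \<tau>"
      by (intro add_mono mult_left_mono mass) auto
    also have "\<dots> = ennreal (potr f x' + L * M * norm (x - x') + \<tau>)"
      using L mass t by (simp add: ennreal_mult[symmetric] ennreal_plus[symmetric] mult_ac del: ennreal_plus)
    finally show ?thesis using L mass t by (subst (asm) ennreal_le_iff) auto
  qed
  from this[OF x] this[OF x(2,1)] show ?thesis by (simp add: L_def norm_minus_commute abs_le_iff)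
qed

lemma potr_continuous:
  fixes f :: "'a::euclidean_space \<Rightarrow> ennreal"
  assumes d: "DIM('a) \<ge> 3" and f: "f \<in> borel_measurable borel" and B: "\<And>y. f y \<le> ennreal B"
    and near: "\<And>y. f y \<noteq> 0 \<Longrightarrow> y \<in> cball a R" and mass: "(\<integral>\<^sup>+y. f y \<partial>lborel) \<le> ennreal M" "M \<ge> 0" 
  shows "continuous_on UNIV (potr f)"
proof -
  note fin = pot_finite[OF d f B near]
  have "isCont (potr f) x" for x
    unfolding continuous_at_eps_delta
  proof (intro allI impI)
    fix e :: real assume e: "e > 0"
    define R' where "R' = max R (dist a x + 1)"
    have R': "R' \<ge> 0" by (rule order_trans[of 0 "dist a x + 1"]) (auto simp: R'_def)
    have near': "y \<in> cball a R'" if "f y \<noteq> 0" for y using near[OF that] by (auto simp: R'_def)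
    have "e / 2 > 0" using e by simp
    then obtain S where S: "S > 0" "\<And>x. x \<in> cball a R' \<Longrightarrow> pot {S<..} f x \<le> ennreal (e / 2)"
      using pot_tail_uniform[OF d f B near'] by blast
    define L where "L = S powr (DIM('a) / 2 - 1) * S * (4 * R') * M"
    have L: "L \<ge> 0" using S R' mass by (simp add: L_def)
    define dl where "dl = min 1 (e / 2 / (L + 1))"
    have dl: "dl > 0" "dl \<le> 1" "dl \<le> e / 2 / (L + 1)" using e L by (auto simp: dl_def)
    have "dist (potr f x') (potr f x) < e" if x': "dist x' x < dl" for x'
    proof -
      have xr: "x \<in> cball a R'" by (simp add: R'_def)
      have "dist a x' \<le> dist a x + dist x' x" by (metis dist_triangle dist_commute)
      then have xr': "x' \<in> cball a R'" using x' dl by (auto simp: R'_def)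
      have "\<bar>potr f x' - potr f x\<bar> \<le> L * norm (x' - x) + e / 2"
        unfolding L_def by (rule potr_difference[OF d f _ R' near' xr' xr fin mass S(2)]) (use S e in auto)
      moreover have "L * norm (x' - x) < e / 2"
      proof -
        have "L * norm (x' - x) \<le> L * dl" using x' L by (intro mult_left_mono) (auto simp: dist_norm)
        also have "\<dots> < (L + 1) * dl" using dl by simp
        also have "\<dots> \<le> e / 2" using dl(3) L by (simp add: pos_le_divide_eq algebra_simps)
        finally show ?thesis .
      qed
      ultimately show ?thesis by (simp add: dist_real_def)
    qed
    then show "\<exists>dl>0. \<forall>x'. dist x' x < dl \<longrightarrow> dist (potr f x') (potr f x) < e" using dl by blast
  qed
  then show ?thesis by (simp add: continuous_on_eq_continuous_at)
qed

lemma potr_defect: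
  fixes f :: "'a::euclidean_space \<Rightarrow> ennreal"
  assumes d: "DIM('a) \<ge> 3" and f: "f \<in> borel_measurable borel" and c: "continuous_on UNIV (potr f)"
    and fin: "\<And>x. pot {0<..} f x < \<infinity>" and r: "r > 0"
  shows "ball_defect r (\<lambda>x. - potr f x) x \<ge> 0"
    and "(\<And>y. f y \<noteq> 0 \<Longrightarrow> r < dist x y) \<Longrightarrow> ball_defect r (potr f) x = 0"
proof -
  have c': "continuous_on (cball x r) (potr f)" by (rule continuous_on_subset[OF c]) simp
  have i: "ennreal (integral (cball x r) (potr f)) = (\<integral>\<^sup>+z. indicator (cball x r) z * pot {0<..} f z \<partial>lborel)"
    unfolding pot_eq_potr[OF fin] by (rule nn_integral_cball[OF c', symmetric]) simp
  have rhs: "ennreal (measure lborel (cball x r)) * pot {0<..} f x = ennreal (measure lborel (cball x r) * potr f x)"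
    unfolding pot_eq_potr[OF fin] by (simp add: ennreal_mult)
  have nn: "integral (cball x r) (potr f) \<ge> 0" by (rule integral_nonneg) (use c' in \<open>auto intro: integrable_continuous set_borel_integral_eq_integral(1)[OF cball_integrable_continuous]\<close>)
  show "ball_defect r (\<lambda>x. - potr f x) x \<ge> 0"
    using pot_mean_le[OF d f r, of x] unfolding i[symmetric] rhs ball_defect_minus ball_defect_eq[OF c']
    by (simp add: mult.commute)
  show "ball_defect r (potr f) x = 0" if "\<And>y. f y \<noteq> 0 \<Longrightarrow> r < dist x y"
    using pot_mean_eq[OF d f r that] nn unfolding i[symmetric] rhs ball_defect_eq[OF c']
    by (simp add: mult.commute)
qed

text \<open>Substitutes for probability measures on \<open>K\<close>: bounded densities near
  \<open>K\<close>, so that all potentials are finite and continuous. The bound \<open>B\<close> is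
  not shared within the class. The minimal energies increase with \<open>k\<close>, and their limit
  plays the role of the reciprocal capacity of \<open>K\<close>.\<close>

definition densities :: "'a::euclidean_space set \<Rightarrow> nat \<Rightarrow> ('a \<Rightarrow> ennreal) set" where
  "densities K k = {f. f \<in> borel_measurable borel \<and> (\<exists>B\<ge>0. \<forall>x. f x \<le> ennreal B) \<and>
     (\<forall>x. f x \<noteq> 0 \<longrightarrow> infdist x K \<le> inverse (real (Suc k))) \<and> (\<integral>\<^sup>+x. f x \<partial>lborel) = 1}"

lemma densities_mono: "k \<le> l \<Longrightarrow> densities K l \<subseteq> densities K k"
proof -
  assume "k \<le> l"
  then have "inverse (real (Suc l)) \<le> inverse (real (Suc k))" by (intro le_imp_inverse_le) auto
  then show ?thesis unfolding densities_def by (auto intro: order_trans)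
qed

lemma densities_convex:
  assumes f: "f \<in> densities K k" and g: "g \<in> densities K k" and t: "0 \<le> t" "t \<le> 1"
  shows "(\<lambda>x. ennreal (1 - t) * f x + ennreal t * g x) \<in> densities K k"
proof -
  from f g have [measurable]: "f \<in> borel_measurable borel" "g \<in> borel_measurable borel" by (auto simp: densities_def)
  obtain B1 B2 where B: "B1 \<ge> 0" "B2 \<ge> 0" "\<And>x. f x \<le> ennreal B1" "\<And>x. g x \<le> ennreal B2" using f g by (auto simp: densities_def)
  have "ennreal (1 - t) * f x + ennreal t * g x \<le> ennreal (B1 + B2)" for x
  proof -
    have "ennreal (1 - t) * f x + ennreal t * g x \<le> 1 * ennreal B1 + 1 * ennreal B2"
      using t B by (intro add_mono mult_mono) auto
    then show ?thesis using B by simp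
  qed
  moreover have "(\<integral>\<^sup>+x. ennreal (1 - t) * f x + ennreal t * g x \<partial>lborel) = 1"
  proof -
    have "(\<integral>\<^sup>+x. ennreal (1 - t) * f x + ennreal t * g x \<partial>lborel) = ennreal (1 - t) * (\<integral>\<^sup>+x. f x \<partial>lborel) + ennreal t * (\<integral>\<^sup>+x. g x \<partial>lborel)"
      by (simp add: nn_integral_add nn_integral_cmult)
    also have "\<dots> = ennreal (1 - t) + ennreal t" using f g by (simp add: densities_def)
    also have "\<dots> = 1" using t by (simp add: ennreal_plus[symmetric] del: ennreal_plus)
    finally show ?thesis .
  qed
  moreover have "infdist x K \<le> inverse (real (Suc k))" if "ennreal (1 - t) * f x + ennreal t * g x \<noteq> 0" for x
    using that f g by (cases "f x = 0"; cases "g x = 0") (auto simp: densities_def)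
  ultimately show ?thesis using B unfolding densities_def by (auto intro!: exI[of _ "B1 + B2"])
qed

definition ball_density :: "'a::euclidean_space \<Rightarrow> real \<Rightarrow> 'a \<Rightarrow> ennreal" where
  "ball_density x r y = ennreal (1 / measure lborel (cball x r)) * indicator (cball x r) y"

lemma ball_density_mem:
  assumes "x \<in> K" shows "ball_density x (inverse (real (Suc k))) \<in> densities K k"
proof -
  let ?r = "inverse (real (Suc k))"
  have V: "measure lborel (cball x ?r) > 0" by (rule measure_cball_pos) simp
  have e: "emeasure lborel (cball x ?r) = ennreal (measure lborel (cball x ?r))"
    using emeasure_lborel_cball_finite[of x ?r] by (simp add: emeasure_eq_ennreal_measure)
  have "(\<integral>\<^sup>+y. ball_density x ?r y \<partial>lborel) = ennreal (1 / measure lborel (cball x ?r)) * ennreal (measure lborel (cball x ?r))"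
    unfolding ball_density_def by (subst nn_integral_cmult) (simp_all add: e del: of_nat_Suc)
  also have "\<dots> = 1" using V by (simp add: ennreal_mult[symmetric])
  finally have i: "(\<integral>\<^sup>+y. ball_density x ?r y \<partial>lborel) = 1" .
  have "infdist y K \<le> ?r" if "ball_density x ?r y \<noteq> 0" for y
    using infdist_le[OF assms, of y] that by (auto simp: ball_density_def indicator_def dist_commute split: if_splits)
  moreover have "ball_density x ?r y \<le> ennreal (1 / measure lborel (cball x ?r))" for y
    by (auto simp: ball_density_def indicator_def)
  moreover have "ball_density x ?r \<in> borel_measurable borel" unfolding ball_density_def by measurable
  ultimately show ?thesis using i V unfolding densities_def by (auto intro!: exI[of _ "1 / measure lborel (cball x ?r)"])
qed

text \<open>One bound for all centres: the perturbation size in \<open>near_minimizer\<close> has to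
  be fixed before the point of \<open>K\<close> is.\<close>

lemma ball_density_energy:
  assumes d: "DIM('a::euclidean_space) \<ge> 3" and r: "r > 0"
  obtains E where "E \<ge> 0" "\<And>x::'a. energy {0<..} (ball_density x r) (ball_density x r) \<le> ennreal E"
proof -
  define V where "V = 1 / measure lborel (cball (0::'a) r)"
  have V: "1 / measure lborel (cball x r) = V" for x :: 'a using r by (simp add: V_def content_cball)
  define P where "P = ennreal V * pot {0<..} (indicator (cball 0 (2 * r))) (0::'a)"
  have P: "P < \<infinity>" unfolding P_def using pot_indicator_finite[OF d, of "2 * r"] by (simp add: ennreal_mult_less_top)
  have "energy {0<..} (ball_density x r) (ball_density x r) \<le> P" for x :: 'a
  proof -
    have m[measurable]: "ball_density x r \<in> borel_measurable borel" unfolding ball_density_def by measurable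
    have "ball_density x r y * pot {0<..} (ball_density x r) y \<le> ball_density x r y * P" for y
    proof (cases "y \<in> cball x r")
      case True
      have "pot {0<..} (ball_density x r) y \<le> P" unfolding P_def
        by (rule pot_bounded_density[of "ball_density x r" _ x r y]) (use True in \<open>auto simp: ball_density_def V indicator_def split: if_splits\<close>)
      then show ?thesis by (rule mult_left_mono) simp
    qed (simp add: ball_density_def)
    then have "energy {0<..} (ball_density x r) (ball_density x r) \<le> (\<integral>\<^sup>+y. ball_density x r y * P \<partial>lborel)"
      unfolding energy_def by (rule nn_integral_mono)
    also have "\<dots> = (\<integral>\<^sup>+y. ball_density x r y \<partial>lborel) * P" by (rule nn_integral_multc) measurable
    also have "(\<integral>\<^sup>+y. ball_density x r y \<partial>lborel) = ennreal (1 / measure lborel (cball x r)) * emeasure lborel (cball x r)"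
      unfolding ball_density_def by (subst nn_integral_cmult) simp_all
    also have "\<dots> = 1" using measure_cball_pos[OF r, of x] emeasure_lborel_cball_finite[of x r]
      by (simp add: emeasure_eq_ennreal_measure ennreal_mult[symmetric])
    finally show ?thesis by simp
  qed
  moreover have "P = ennreal (enn2real P)" using P by simp
  ultimately show ?thesis using that[of "enn2real P"] by simp
qed

text \<open>First variation of the energy at a near minimizer in the direction of the uniform density on a small ball, followed by the
  super-mean-value property of the potential.\<close>

lemma near_minimizer:
  fixes K :: "'a::euclidean_space set"
  assumes d: "DIM('a) \<ge> 3" and I: "I > 0" and K: "K \<noteq> {}"
    and inf: "(INF f\<in>densities K k. energy {0<..} f f) = ennreal I"
  obtains f where "f \<in> densities K k" "\<And>x. x \<in> K \<Longrightarrow> ennreal (I / 4) \<le> pot {0<..} f x"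
proof -
  define r where "r = inverse (real (Suc k))"
  have r: "r > 0" by (simp add: r_def)
  obtain E where E: "E \<ge> 0" "\<And>x::'a. energy {0<..} (ball_density x r) (ball_density x r) \<le> ennreal E"
    by (rule ball_density_energy[OF d r]) blast
  have low: "ennreal I \<le> energy {0<..} h h" if "h \<in> densities K k" for h
    unfolding inf[symmetric] by (rule INF_lower[OF that])
  obtain x0 where "x0 \<in> K" using K by blast
  then have "ennreal I \<le> energy {0<..} (ball_density x0 r) (ball_density x0 r)" unfolding r_def by (intro low ball_density_mem)
  also have "\<dots> \<le> ennreal E" by (rule E)
  finally have IE: "I \<le> E" using E(1) by simp
  \<comment> \<open>The competitor \<open>(1 - t) f + t g\<close> has energy at least
    \<open>I\<close>. If the mixed energy were below \<open>I / 4\<close>, its three terms would be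
    at most \<open>(1 - t)\<^sup>2 I + t I / 4\<close>, \<open>t I / 2\<close> and, because
    \<open>t E = I / 4\<close>, \<open>t I / 4\<close>. The sum \<open>I - t (1 - t) I\<close> is
    too small.\<close>
  define t where "t = I / (4 * E)"
  have t: "0 < t" "t \<le> 1/4" "t * E = I / 4" using I IE by (auto simp: t_def field_simps)
  define \<delta> where "\<delta> = t * I / 4"
  have \<delta>: "\<delta> > 0" using t I by (simp add: \<delta>_def)
  have "ennreal I < ennreal (I + \<delta>)" using I \<delta> by (intro ennreal_lessI) auto
  then obtain f where f: "f \<in> densities K k" "energy {0<..} f f < ennreal (I + \<delta>)"
    unfolding inf[symmetric] by (auto simp: INF_less_iff)
  then have fm[measurable]: "f \<in> borel_measurable borel" by (simp add: densities_def)
  have "ennreal (I / 4) \<le> pot {0<..} f x" if x: "x \<in> K" for x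
  proof -
    define g where "g = ball_density x r"
    have g: "g \<in> densities K k" using ball_density_mem[OF x] by (simp add: g_def r_def)
    then have gm[measurable]: "g \<in> borel_measurable borel" by (simp add: densities_def)
    obtain ef where ef: "ef \<ge> 0" "energy {0<..} f f = ennreal ef" using f(2) by (cases "energy {0<..} f f") auto
    obtain eg where eg: "eg \<ge> 0" "energy {0<..} g g = ennreal eg" using E(2)[of x] unfolding g_def[symmetric] by (cases "energy {0<..} g g") (auto simp: top_unique)
    have "2 * energy {0<..} f g \<le> ennreal ef + ennreal eg" unfolding ef(2)[symmetric] eg(2)[symmetric] by (rule energy_pos_def) auto
    then have "2 * energy {0<..} f g < \<infinity>" by (rule le_less_trans) simp
    then have "energy {0<..} f g \<noteq> \<infinity>" by auto
    then obtain c where c: "c \<ge> 0" "energy {0<..} f g = ennreal c" by (cases "energy {0<..} f g") auto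
    have efI: "ef < I + \<delta>" using f(2) unfolding ef(2) using ef(1) by (simp add: ennreal_less_iff del: ennreal_plus)
    have egE: "eg \<le> E" using E(2)[of x] eg E(1) by (simp add: g_def)
    have "ennreal I \<le> ennreal (1 - t) * ennreal (1 - t) * energy {0<..} f f + 2 * ennreal (1 - t) * ennreal t * energy {0<..} f g + ennreal t * ennreal t * energy {0<..} g g"
      using low[OF densities_convex[OF f(1) g, of t]] t energy_quadratic[OF fm gm, of "{0<..}" "ennreal (1 - t)" "ennreal t"] by simp
    then have q: "I \<le> (1 - t) * (1 - t) * ef + 2 * (1 - t) * t * c + t * t * eg"
      using t ef(1) eg(1) c(1) unfolding ef(2) eg(2) c(2)
      by (simp add: ennreal_mult[symmetric] ennreal_plus[symmetric] ennreal_numeral[symmetric] del: ennreal_plus ennreal_numeral)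
    have cI: "I / 4 \<le> c"
    proof (rule ccontr)
      assume "\<not> I / 4 \<le> c"
      then have cc: "c < I / 4" by simp
      have "(1 - t) * (1 - t) * ef \<le> (1 - t) * (1 - t) * (I + \<delta>)" using efI t by (intro mult_left_mono) auto
      also have "\<dots> \<le> (1 - t) * (1 - t) * I + \<delta>"
      proof -
        have "(1 - t) * (1 - t) * \<delta> \<le> 1 * \<delta>" using t \<delta> by (intro mult_right_mono mult_le_one) auto
        then show ?thesis by (simp add: algebra_simps)
      qed
      finally have 1: "(1 - t) * (1 - t) * ef \<le> (1 - t) * (1 - t) * I + t * I / 4" by (simp add: \<delta>_def)
      have 2: "2 * (1 - t) * t * c \<le> t * I / 2"
      proof -
        have "2 * (1 - t) * t * c \<le> 2 * 1 * t * (I / 4)" using t cc c by (intro mult_mono) auto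
        also have "\<dots> = t * I / 2" by simp
        finally show ?thesis .
      qed
      have "t * (t * eg) \<le> t * (t * E)" using egE t by (intro mult_left_mono) auto
      then have 3: "t * t * eg \<le> t * I / 4" using t by (simp add: mult.assoc)
      have "I \<le> (1 - t) * (1 - t) * I + t * I" using q 1 2 3 by linarith
      moreover have "(1 - t) * (1 - t) * I + t * I = I - t * (1 - t) * I" by (simp add: algebra_simps)
      moreover have "t * (1 - t) * I > 0" using t I by (intro mult_pos_pos) auto
      ultimately show False by linarith
    qed
    define V where "V = measure lborel (cball x r)"
    have V: "V > 0" unfolding V_def by (rule measure_cball_pos[OF r])
    have "ennreal (I / 4) \<le> energy {0<..} f g" using cI c by (simp add: ennreal_leI)
    also have "\<dots> = energy {0<..} g f" by (rule energy_commute) auto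
    also have "\<dots> = (\<integral>\<^sup>+y. ennreal (1 / V) * (indicator (cball x r) y * pot {0<..} f y) \<partial>lborel)"
      by (simp add: energy_def g_def ball_density_def V_def mult.assoc)
    also have "\<dots> = ennreal (1 / V) * (\<integral>\<^sup>+y. indicator (cball x r) y * pot {0<..} f y \<partial>lborel)"
      by (rule nn_integral_cmult) measurable
    also have "\<dots> \<le> ennreal (1 / V) * (ennreal V * pot {0<..} f x)"
      unfolding V_def by (intro mult_left_mono pot_mean_le[OF d fm r]) auto
    also have "\<dots> = pot {0<..} f x" using V by (simp add: mult.assoc[symmetric] ennreal_mult[symmetric])
    finally show ?thesis .
  qed
  then show ?thesis using that f(1) by blast
qed

text \<open>The consequence of vanishing capacity that the thinning uses, taken as definition. The
  set \<open>X\<close> will be the sequence of bad points together with its limit; the strict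
  inequality on \<open>K\<close> makes the region covered by \<open>W\<close> open.\<close>

definition polar_compact :: "'a::euclidean_space set \<Rightarrow> bool" where
  "polar_compact K \<longleftrightarrow> (\<forall>X \<beta>. compact X \<and> X \<inter> K = {} \<and> \<beta> > 0 \<longrightarrow>
     (\<exists>W. continuous_on UNIV W \<and> subharmonic_on UNIV (\<lambda>x. - W x) \<and> (\<forall>x. W x \<ge> 0) \<and>
        (\<forall>x\<in>K. W x > 1) \<and> (\<forall>x\<in>X. W x \<le> \<beta>)))"

lemma infdist_less_obtain:
  assumes "K \<noteq> {}" "infdist y K < t" obtains z where "z \<in> K" "dist y z < t"
proof -
  have "(INF z\<in>K. dist y z) < t" using assms by (simp add: infdist_notempty)
  then have "\<exists>z\<in>K. dist y z < t" by (subst (asm) cINF_less_iff) (use assms in \<open>auto intro: bdd_belowI[of _ 0]\<close>)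
  then show ?thesis using that by blast
qed

lemma densities_support:
  assumes "K \<noteq> {}" "K \<subseteq> cball a R" "R \<ge> 0" "f \<in> densities K k" "f y \<noteq> 0"
  shows "y \<in> cball a (R + 2)"
proof -
  have "infdist y K \<le> inverse (real (Suc k))" using assms by (simp add: densities_def)
  also have "\<dots> < 2" by (rule le_less_trans[of _ 1]) (auto simp: inverse_le_1_iff)
  finally have "infdist y K < 2" .
  then obtain x where "x \<in> K" "dist y x < 2" using infdist_less_obtain[OF assms(1)] by blast
  then show ?thesis using assms(2) dist_triangle[of a y x] by (auto simp: dist_commute)
qed

lemma densities_potr:
  fixes K :: "'a::euclidean_space set"
  assumes d: "DIM('a) \<ge> 3" and K: "K \<noteq> {}" "compact K" and f: "f \<in> densities K k"
  shows "\<And>x. pot {0<..} f x < \<infinity>" "continuous_on UNIV (potr f)" "f \<in> borel_measurable borel"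
    "subharmonic_on UNIV (\<lambda>x. - potr f x)"
proof -
  show fm: "f \<in> borel_measurable borel" using f by (simp add: densities_def)
  obtain B where B: "\<And>x. f x \<le> ennreal B" using f by (auto simp: densities_def)
  have mass: "(\<integral>\<^sup>+x. f x \<partial>lborel) \<le> ennreal 1" using f by (simp add: densities_def)
  obtain R where "R > 0" "\<forall>x\<in>K. norm x \<le> R" using compact_imp_bounded[OF K(2)] unfolding bounded_pos by blast
  then have R: "R \<ge> 0" "K \<subseteq> cball 0 R" by auto
  have near: "y \<in> cball 0 (R + 2)" if "f y \<noteq> 0" for y by (rule densities_support[OF K(1) R(2,1) f that])
  show fin: "pot {0<..} f x < \<infinity>" for x by (rule pot_finite[OF d fm B near])
  show c: "continuous_on UNIV (potr f)" by (rule potr_continuous[OF d fm B near mass]) auto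
  show "subharmonic_on UNIV (\<lambda>x. - potr f x)"
    by (rule subharmonic_onI_defect) (auto intro!: continuous_intros c potr_defect(1)[OF d fm c fin])
qed

lemma polar_compact_of_large_energy:
  fixes K :: "'a::euclidean_space set"
  assumes d: "DIM('a) \<ge> 3" and K: "K \<noteq> {}" "compact K" 
    and inf: "(SUP k. INF f\<in>densities K k. energy {0<..} f f) = \<infinity>"
  shows "polar_compact K"
  unfolding polar_compact_def
proof (intro allI impI)
  fix X and \<beta> :: real assume X: "compact X \<and> X \<inter> K = {} \<and> \<beta> > 0"
  obtain \<delta> where \<delta>: "\<delta> > 0" "\<And>x y. x \<in> X \<Longrightarrow> y \<in> K \<Longrightarrow> \<delta> \<le> dist x y"
    using separate_compact_closed[of X K] X compact_imp_closed[OF K(2)] by blast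
  define t where "t = \<delta> / 2"
  have t: "t > 0" using \<delta> by (simp add: t_def)
  define C where "C = Gamma (DIM('a) / 2 - 1) * (t\<^sup>2) powr (- (DIM('a) / 2 - 1))"
  have C: "C \<ge> 0" using d by (simp add: C_def Gamma_real_pos less_imp_le)
  define e where "e = (\<lambda>k. INF f\<in>densities K k. energy {0<..} f f)"
  have mono: "e k \<le> e l" if "k \<le> l" for k l unfolding e_def by (rule INF_superset_mono[OF densities_mono[OF that]]) simp
  obtain x0 where x0: "x0 \<in> K" using K by blast
  have fin: "e k < \<infinity>" for k
  proof -
    obtain E where E: "\<And>x::'a. energy {0<..} (ball_density x (inverse (real (Suc k)))) (ball_density x (inverse (real (Suc k)))) \<le> ennreal E"
      using ball_density_energy[OF d, of "inverse (real (Suc k))"] by auto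
    have "e k \<le> energy {0<..} (ball_density x0 (inverse (real (Suc k)))) (ball_density x0 (inverse (real (Suc k))))"
      unfolding e_def by (rule INF_lower[OF ball_density_mem[OF x0]])
    also have "\<dots> \<le> ennreal E" by (rule E)
    finally have "e k \<le> ennreal E" .
    then show ?thesis by (rule le_less_trans) simp
  qed
  \<comment> \<open>The potential is at least \<open>I / 4\<close> on \<open>K\<close> and at most
    \<open>C\<close> on \<open>X\<close>. Scaling by \<open>8 / I\<close> gives at least 2 on
    \<open>K\<close> and at most \<open>8 * C / I\<close> on \<open>X\<close>, so \<open>I\<close>
    must exceed \<open>8 * C / \<beta>\<close>; the extra 1 keeps \<open>I\<close> positive.\<close>
  have "ennreal (8 * C / \<beta> + 1) < (SUP k. e k)" unfolding e_def inf by simp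
  then obtain k1 where k1: "ennreal (8 * C / \<beta> + 1) < e k1" by (auto simp: less_SUP_iff)
  obtain k2 where k2: "inverse (real (Suc k2)) < t" using reals_Archimedean[OF t] by blast
  define k where "k = max k1 k2"
  have ek: "ennreal (8 * C / \<beta> + 1) < e k" using k1 mono[of k1 k] by (simp add: k_def)
  have kt: "inverse (real (Suc k)) < t"
  proof -
    have "inverse (real (Suc k)) \<le> inverse (real (Suc k2))" by (rule le_imp_inverse_le) (auto simp: k_def)
    then show ?thesis using k2 by linarith
  qed
  obtain I where I: "I \<ge> 0" "e k = ennreal I" using fin[of k] by (cases "e k") auto
  have I1: "8 * C / \<beta> + 1 < I" using ek I C X unfolding I(2) by (subst (asm) ennreal_less_iff) auto
  have "0 \<le> 8 * C / \<beta>" using C X by simp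
  then have I0: "I > 0" using I1 by linarith
  obtain f where f: "f \<in> densities K k" "\<And>x. x \<in> K \<Longrightarrow> ennreal (I / 4) \<le> pot {0<..} f x"
    using near_minimizer[OF d I0 K(1)] I(2) unfolding e_def by blast
  note dp = densities_potr[OF d K f(1)]
  define W where "W = (\<lambda>x. 8 / I * potr f x)"
  have "continuous_on UNIV W" unfolding W_def by (intro continuous_intros dp)
  moreover have "subharmonic_on UNIV (\<lambda>x. - W x)"
    using subharmonic_on_cmult[OF dp(4), of "8 / I"] I0 by (simp add: W_def)
  moreover have "\<forall>x. W x \<ge> 0" using I0 by (simp add: W_def)
  moreover have "\<forall>x\<in>K. W x > 1"
  proof
    fix x assume "x \<in> K"
    then have "ennreal (I / 4) \<le> ennreal (potr f x)" using f(2) pot_eq_potr[OF dp(1)] by simp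
    then have "I / 4 \<le> potr f x" by simp
    then have "8 / I * (I / 4) \<le> W x" unfolding W_def using I0 by (intro mult_left_mono) auto
    then show "W x > 1" using I0 by simp
  qed
  moreover have "\<forall>x\<in>X. W x \<le> \<beta>"
  proof
    fix x assume x: "x \<in> X"
    have far: "t \<le> dist x y" if "f y \<noteq> 0" for y
    proof -
      have "infdist y K < t" using f(1) that kt by (auto simp: densities_def intro: le_less_trans)
      then obtain z where "z \<in> K" "dist y z < t" using infdist_less_obtain[OF K(1)] by blast
      then show ?thesis using \<delta>(2)[OF x, of z] dist_triangle[of x z y] by (simp add: t_def)
    qed
    have "ennreal (potr f x) \<le> ennreal C * (\<integral>\<^sup>+y. f y \<partial>lborel)"
      unfolding pot_eq_potr[OF dp(1), symmetric] C_def by (rule pot_upper[OF d dp(3) t far])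
    also have "(\<integral>\<^sup>+y. f y \<partial>lborel) = 1" using f(1) by (simp add: densities_def)
    finally have "potr f x \<le> C" using C by simp
    then have "W x \<le> 8 / I * C" unfolding W_def using I0 by (intro mult_left_mono) auto
    also have "\<dots> \<le> \<beta>"
    proof -
      have "8 * C / \<beta> \<le> I" using I1 by linarith
      then show ?thesis using X I0 by (simp add: field_simps)
    qed
    finally show "W x \<le> \<beta>" .
  qed
  ultimately show "\<exists>W. continuous_on UNIV W \<and> subharmonic_on UNIV (\<lambda>x. - W x) \<and> (\<forall>x. W x \<ge> 0) \<and>
        (\<forall>x\<in>K. W x > 1) \<and> (\<forall>x\<in>X. W x \<le> \<beta>)" by blast
qed

subsection \<open>Densities with uniformly small tails\<close>

lemma energy_antimono:
  assumes "S \<le> T" shows "energy {T<..} f (g :: 'a::euclidean_space \<Rightarrow> ennreal) \<le> energy {S<..} f g"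
  unfolding energy_def pot_def
  by (intro nn_integral_mono mult_left_mono mult_right_mono) (use assms in \<open>auto simp: indicator_def\<close>)

lemma energy_tail:
  fixes f :: "'a::euclidean_space \<Rightarrow> ennreal"
  assumes f[measurable]: "f \<in> borel_measurable borel" and fin: "energy {0<..} f f < \<infinity>" and t: "\<tau> > 0"
  obtains S where "S > 0" "energy {S<..} f f \<le> ennreal \<tau>"
proof -
  define F where "F = (\<lambda>s. ennreal (s powr (DIM('a) / 2 - 2)) * gauss_energy s f f)"
  have Fm: "F \<in> borel_measurable borel" unfolding F_def by measurable
  have E: "energy J f f = (\<integral>\<^sup>+s. indicator J s * F s \<partial>lborel)" if "J \<in> sets borel" for J
    using that by (simp add: energy_eq F_def mult.assoc)
  have fin': "(\<integral>\<^sup>+s. indicator {0<..} s * F s \<partial>lborel) < \<infinity>" using fin E[of "{0<..}"] by simp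
  have "ennreal \<tau> > 0" using t by simp
  from nn_integral_tail[OF Fm fin' this] obtain S where "S > 0" "(\<integral>\<^sup>+s. indicator {S<..} s * F s \<partial>lborel) < ennreal \<tau>" by blast
  then show ?thesis using that[of S] E[of "{S<..}"] by simp
qed

text \<open>Since the minimal energies converge, from some \<open>k\<close> on all
  \<open>f m\<close> are almost optimal within \<open>densities K k\<close>, and so is the midpoint
  with \<open>f k\<close>. The tail estimate then transfers the tail of \<open>f k\<close> to every
  later \<open>f m\<close>; finitely many earlier ones are handled by a maximum of scales.\<close>

lemma uniform_energy_tail:
  fixes K :: "'a::euclidean_space set"
  assumes f: "\<And>m. f m \<in> densities K m" 
    and i: "\<And>m. (INF f\<in>densities K m. energy {0<..} f f) = ennreal (i m)" "\<And>m. i m \<ge> 0" "\<And>m. i m \<le> I" "i \<longlonglongrightarrow> I"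
    and near: "\<And>m. energy {0<..} (f m) (f m) \<le> ennreal (i m + inverse (real (Suc m)))" and t: "\<tau> > 0"
  obtains S where "S > 0" "\<And>m. energy {S<..} (f m) (f m) \<le> ennreal \<tau>"
proof -
  have fm[measurable]: "f m \<in> borel_measurable borel" for m using f[of m] by (simp add: densities_def)
  have fin: "energy {0<..} (f m) (f m) < \<infinity>" for m using near[of m] by (rule le_less_trans) simp
  have "\<forall>m. \<exists>S>0. energy {S<..} (f m) (f m) \<le> ennreal (\<tau> / 4)"
    using energy_tail[OF fm fin, of "\<tau> / 4"] t by (metis divide_pos_pos zero_less_numeral)
  then obtain S where S: "\<And>m. S m > 0" "\<And>m. energy {S m<..} (f m) (f m) \<le> ennreal (\<tau> / 4)" by metis
  have "\<forall>\<^sub>F m in sequentially. I - \<tau> / 16 < i m" by (rule order_tendstoD(1)[OF i(4)]) (use t in simp)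
  moreover have "\<forall>\<^sub>F m in sequentially. inverse (real (Suc m)) < \<tau> / 32"
    by (rule order_tendstoD(2)[OF LIMSEQ_inverse_real_of_nat]) (use t in simp)
  ultimately have "\<forall>\<^sub>F m in sequentially. I - \<tau> / 16 < i m \<and> inverse (real (Suc m)) < \<tau> / 32" by (rule eventually_conj)
  \<comment> \<open>The error term of the tail estimate is \<open>4 (i m - i k)\<close> plus
    \<open>4 / (m + 1) + 4 / (k + 1)\<close>, hence at most
    \<open>4 * \<tau> / 16 + 8 * \<tau> / 32 = \<tau> / 2\<close>; the other half is twice the tail
    \<open>\<tau> / 4\<close>.\<close>
  then obtain k where k: "I - \<tau> / 16 < i k" "inverse (real (Suc k)) < \<tau> / 32"
    unfolding eventually_sequentially by blast
  define T where "T = Max (S ` {..k})"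
  have T: "S m \<le> T" if "m \<le> k" for m unfolding T_def by (rule Max_ge) (use that in auto)
  have T0: "T > 0" using S(1)[of k] T[of k] by simp
  have "energy {T<..} (f m) (f m) \<le> ennreal \<tau>" for m
  proof (cases "m \<le> k")
    case True
    have "energy {T<..} (f m) (f m) \<le> ennreal (\<tau> / 4)" by (rule order_trans[OF energy_antimono[OF T[OF True]] S(2)])
    also have "\<dots> \<le> ennreal \<tau>" using t by (intro ennreal_leI) auto
    finally show ?thesis .
  next
    case False
    have inv: "inverse (real (Suc m)) \<le> inverse (real (Suc k))" using False by (intro le_imp_inverse_le) auto
    have "f m \<in> densities K k" using densities_mono[of k m K] f[of m] False by auto
    from densities_convex[OF this f[of k], of "1/2"]
    have h: "(\<lambda>x. ennreal (1/2) * f m x + ennreal (1/2) * f k x) \<in> densities K k" by simp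
    have "energy {T<..} (f m) (f m) \<le> 2 * energy {T<..} (f k) (f k) + 
      ennreal (2 * (2 * (i m + inverse (real (Suc m))) + 2 * (i k + inverse (real (Suc k))) - 4 * i k))"
    proof (rule energy_tail_estimate[OF fm fm _ near near])
      show "ennreal (i k) \<le> energy {0<..} (\<lambda>x. ennreal (1/2) * f m x + ennreal (1/2) * f k x) (\<lambda>x. ennreal (1/2) * f m x + ennreal (1/2) * f k x)"
        unfolding i(1)[symmetric] by (rule INF_lower[OF h])
    qed (use T0 i(2) in auto)
    also have "\<dots> \<le> 2 * ennreal (\<tau> / 4) + ennreal (\<tau> / 2)"
    proof (intro add_mono mult_left_mono ennreal_leI)
      show "energy {T<..} (f k) (f k) \<le> ennreal (\<tau> / 4)" by (rule order_trans[OF energy_antimono[OF T[OF order_refl]] S(2)])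
      show "2 * (2 * (i m + inverse (real (Suc m))) + 2 * (i k + inverse (real (Suc k))) - 4 * i k) \<le> \<tau> / 2"
        using k inv i(3)[of m] by argo
    qed simp
    also have "\<dots> = ennreal (2 * (\<tau> / 4) + \<tau> / 2)"
    proof -
      have "2 * ennreal (\<tau> / 4) = ennreal 2 * ennreal (\<tau> / 4)" by simp
      also have "\<dots> = ennreal (2 * (\<tau> / 4))" by (rule ennreal_mult[symmetric]) (use t in auto)
      finally have e: "2 * ennreal (\<tau> / 4) = ennreal (2 * (\<tau> / 4))" .
      show ?thesis unfolding e by (rule ennreal_plus[symmetric]) (use t in auto)
    qed
    also have "2 * (\<tau> / 4) + \<tau> / 2 = \<tau>" by simp
    finally show ?thesis .
  qed
  then show ?thesis using that T0 by blast
qed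

text \<open>Lower semicontinuity by Fatou's lemma on scales and points at once. Closedness is what
  permits a nearest point in \<open>pot_tail_maximum\<close>.\<close>

lemma closed_pot_sublevel:
  fixes f :: "'a::euclidean_space \<Rightarrow> ennreal"
  assumes [measurable]: "f \<in> borel_measurable borel" "J \<in> sets borel" and fin: "\<And>y. f y < \<infinity>"
  shows "closed {x. pot J f x \<le> c}"
  unfolding closed_sequential_limits
proof (intro allI impI, elim conjE)
  fix x l assume x: "\<forall>n. x n \<in> {x. pot J f x \<le> c}" and l: "x \<longlonglongrightarrow> l"
  define w where "w = (\<lambda>s y. indicator J s * ennreal (s powr (DIM('a) / 2 - 2)) * f y)"
  have wf: "w s y < \<infinity>" for s y using fin[of y] by (auto simp: w_def ennreal_mult_less_top indicator_def)
  have [measurable]: "(\<lambda>(s, y). w s y) \<in> borel_measurable (lborel \<Otimes>\<^sub>M (lborel :: 'a measure))" unfolding w_def by measurable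
  have P: "pot J f z = (\<integral>\<^sup>+p. (case p of (s, y) \<Rightarrow> w s y * ennreal (exp (- s * ((z - y) \<bullet> (z - y))))) \<partial>(lborel \<Otimes>\<^sub>M lborel))" for z
  proof -
    have "pot J f z = (\<integral>\<^sup>+s. (\<integral>\<^sup>+y. w s y * ennreal (exp (- s * ((z - y) \<bullet> (z - y)))) \<partial>lborel) \<partial>lborel)"
      unfolding pot_def gauss_pot_def
    proof (rule nn_integral_cong)
      fix s
      have "(\<integral>\<^sup>+y. (indicator J s * ennreal (s powr (DIM('a) / 2 - 2))) * (ennreal (exp (- s * ((z - y) \<bullet> (z - y)))) * f y) \<partial>lborel) 
        = indicator J s * ennreal (s powr (DIM('a) / 2 - 2)) * (\<integral>\<^sup>+y. ennreal (exp (- s * ((z - y) \<bullet> (z - y)))) * f y \<partial>lborel)"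
        by (rule nn_integral_cmult) measurable
      then show "indicator J s * ennreal (s powr (DIM('a) / 2 - 2)) * (\<integral>\<^sup>+y. ennreal (exp (- s * ((z - y) \<bullet> (z - y)))) * f y \<partial>lborel) =
         (\<integral>\<^sup>+y. w s y * ennreal (exp (- s * ((z - y) \<bullet> (z - y)))) \<partial>lborel)" by (simp add: w_def mult_ac)
    qed
    also have "\<dots> = (\<integral>\<^sup>+p. (case p of (s, y) \<Rightarrow> w s y * ennreal (exp (- s * ((z - y) \<bullet> (z - y))))) \<partial>(lborel \<Otimes>\<^sub>M lborel))"
      by (subst lborel.nn_integral_fst[symmetric]) simp_all
    finally show ?thesis .
  qed
  have "pot J f l = (\<integral>\<^sup>+p. liminf (\<lambda>n. case p of (s, y) \<Rightarrow> w s y * ennreal (exp (- s * ((x n - y) \<bullet> (x n - y))))) \<partial>(lborel \<Otimes>\<^sub>M lborel))"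
    unfolding P
  proof (rule nn_integral_cong)
    fix p :: "real \<times> 'a"
    obtain s y where p: "p = (s, y)" by (cases p)
    have "(\<lambda>n. w s y * ennreal (exp (- s * ((x n - y) \<bullet> (x n - y))))) \<longlonglongrightarrow> w s y * ennreal (exp (- s * ((l - y) \<bullet> (l - y))))"
      by (intro ennreal_tendsto_cmult tendsto_ennrealI tendsto_intros l) (use wf in simp)
    then show "(case p of (s, y) \<Rightarrow> w s y * ennreal (exp (- s * ((l - y) \<bullet> (l - y))))) = liminf (\<lambda>n. case p of (s, y) \<Rightarrow> w s y * ennreal (exp (- s * ((x n - y) \<bullet> (x n - y)))))"
      by (simp add: p lim_imp_Liminf)
  qed
  also have "\<dots> \<le> liminf (\<lambda>n. pot J f (x n))"
    unfolding P by (rule nn_integral_liminf) measurable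
  also have "\<dots> \<le> c" by (rule Liminf_le) (use x in auto)
  finally show "l \<in> {x. pot J f x \<le> c}" by simp
qed

text \<open>The point \<open>z\<close> of \<open>C\<close> nearest to \<open>x\<close> is at most twice as far from any point of the support as \<open>x\<close> is; rescaling the Gaussian parameter by \<open>4\<close> absorbs this factor.\<close>

lemma pot_tail_maximum:
  fixes f :: "'a::euclidean_space \<Rightarrow> ennreal"
  assumes f[measurable]: "f \<in> borel_measurable borel" and C: "closed C" "C \<noteq> {}" and supp: "\<And>y. f y \<noteq> 0 \<Longrightarrow> y \<in> C"
    and le: "\<And>x. x \<in> C \<Longrightarrow> pot {S<..} f x \<le> c" and S: "S > 0"
  shows "pot {4 * S<..} f x \<le> ennreal (4 powr (DIM('a) / 2 - 1)) * c"
proof -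
  define p where "p = DIM('a) / 2 - 2"
  obtain z where z: "z \<in> C" "infdist x C = dist x z" using infdist_attains_inf[OF C] by blast
  have gp: "gauss_pot s f x \<le> gauss_pot (s / 4) f z" if s: "s > 0" for s
    unfolding gauss_pot_def
  proof (rule nn_integral_mono)
    fix y
    show "ennreal (exp (- s * ((x - y) \<bullet> (x - y)))) * f y \<le> ennreal (exp (- (s / 4) * ((z - y) \<bullet> (z - y)))) * f y"
    proof (cases "f y = 0")
      case False
      have "dist x z \<le> dist x y" using infdist_le[OF supp[OF False], of x] z by simp
      then have "norm (z - y) \<le> 2 * norm (x - y)" using dist_triangle[of z y x] by (simp add: dist_norm norm_minus_commute)
      then have "(norm (z - y))\<^sup>2 \<le> (2 * norm (x - y))\<^sup>2" by (intro power_mono) auto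
      then have "(z - y) \<bullet> (z - y) \<le> 4 * ((x - y) \<bullet> (x - y))" by (simp add: power_mult_distrib dot_square_norm)
      then have "(s / 4) * ((z - y) \<bullet> (z - y)) \<le> (s / 4) * (4 * ((x - y) \<bullet> (x - y)))" using s by (intro mult_left_mono) auto
      then show ?thesis by (intro mult_right_mono ennreal_leI) auto
    qed simp
  qed
  have "pot {4 * S<..} f x \<le> (\<integral>\<^sup>+s. indicator {4 * S<..} s * ennreal (s powr p) * gauss_pot (s / 4) f z \<partial>lborel)"
    unfolding pot_def p_def by (rule nn_integral_mono) (use S gp in \<open>auto simp: indicator_def intro!: mult_left_mono\<close>)
  also have "\<dots> = ennreal \<bar>4\<bar> * (\<integral>\<^sup>+s. indicator {4 * S<..} (0 + 4 * s) * ennreal ((0 + 4 * s) powr p) * gauss_pot ((0 + 4 * s) / 4) f z \<partial>lborel)"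
  proof (rule nn_integral_real_affine)
    have [measurable]: "(\<lambda>s. gauss_pot (s / 4) f z) \<in> borel_measurable borel"
      by (rule measurable_compose[OF _ measurable_gauss_pot(2)[OF f]]) measurable
    show "(\<lambda>s. indicator {4 * S<..} s * ennreal (s powr p) * gauss_pot (s / 4) f z) \<in> borel_measurable borel"
      by measurable
  qed simp
  also have "(\<integral>\<^sup>+s. indicator {4 * S<..} (0 + 4 * s) * ennreal ((0 + 4 * s) powr p) * gauss_pot ((0 + 4 * s) / 4) f z \<partial>lborel)
     = (\<integral>\<^sup>+s. ennreal (4 powr p) * (indicator {S<..} s * ennreal (s powr p) * gauss_pot s f z) \<partial>lborel)"
    by (rule nn_integral_cong) (use S in \<open>auto simp: indicator_def powr_mult ennreal_mult mult_ac\<close>)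
  also have "\<dots> = ennreal (4 powr p) * pot {S<..} f z"
    unfolding pot_def p_def[symmetric] by (rule nn_integral_cmult) measurable
  also have "ennreal \<bar>4\<bar> * (ennreal (4 powr p) * pot {S<..} f z) = ennreal (4 powr (p + 1)) * pot {S<..} f z"
    by (simp add: mult.assoc[symmetric] ennreal_mult[symmetric] powr_add mult.commute[of 4] ennreal_numeral[symmetric] del: ennreal_numeral)
  also have "\<dots> \<le> ennreal (4 powr (p + 1)) * c" by (intro mult_left_mono le z) auto
  finally show ?thesis by (simp add: p_def)
qed

lemma pot_mono: "(\<And>y. f y \<le> g y) \<Longrightarrow> pot J f x \<le> pot J g x"
  unfolding pot_def gauss_pot_def by (intro nn_integral_mono mult_left_mono) auto

text \<open>Chebyshev's inequality: the mass of \<open>f\<close> where the tail potential at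
  \<open>S j\<close> exceeds \<open>(1/2) ^ j\<close> is at most
  \<open>2 ^ j * (1/4) ^ (j + 1)\<close>, and these numbers add up to \<open>1/2\<close>. At least
  half the mass survives on the closed set \<open>C\<close> where all tails are small, and
  \<open>pot_tail_maximum\<close> carries the bound from \<open>C\<close> to the whole
  space.\<close>

lemma restricted_density:
  fixes f :: "'a::euclidean_space \<Rightarrow> ennreal"
  assumes f[measurable]: "f \<in> borel_measurable borel" and B: "\<And>y. f y \<le> ennreal B" and mass: "(\<integral>\<^sup>+x. f x \<partial>lborel) = 1"
    and S: "\<And>j. S j > 0" "\<And>j. energy {S j<..} f f \<le> ennreal ((1/4) ^ (j + 1))"
  obtains g where "g \<in> borel_measurable borel" "\<And>y. g y \<le> f y" "ennreal (1/2) \<le> (\<integral>\<^sup>+x. g x \<partial>lborel)"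
    "\<And>x j. pot {4 * S j<..} g x \<le> ennreal (4 powr (DIM('a) / 2 - 1) * (1/2) ^ j)"
proof -
  define C where "C = (\<Inter>j. {x. pot {S j<..} f x \<le> ennreal ((1/2) ^ j)})"
  have fin: "f y < \<infinity>" for y using B[of y] by (rule le_less_trans) simp
  have Cc: "closed C" unfolding C_def by (intro closed_INT ballI closed_pot_sublevel f fin) auto
  then have Cm[measurable]: "C \<in> sets borel" by (rule borel_closed)
  define g where "g = (\<lambda>y. f y * indicator C y)"
  have gm[measurable]: "g \<in> borel_measurable borel" unfolding g_def by measurable
  have gf: "g y \<le> f y" for y by (auto simp: g_def indicator_def)
  have "(\<integral>\<^sup>+x. f x * indicator (- C) x \<partial>lborel) \<le> (\<integral>\<^sup>+x. (\<Sum>j. ennreal (2 ^ j) * (f x * pot {S j<..} f x)) \<partial>lborel)"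
  proof (rule nn_integral_mono)
    fix x
    show "f x * indicator (- C) x \<le> (\<Sum>j. ennreal (2 ^ j) * (f x * pot {S j<..} f x))"
    proof (cases "x \<in> C")
      case False
      then obtain j where j: "ennreal ((1/2) ^ j) < pot {S j<..} f x" by (auto simp: C_def not_le)
      have "1 = ennreal (2 ^ j) * ennreal ((1/2) ^ j)" by (simp add: ennreal_mult[symmetric] power_mult_distrib[symmetric])
      also have "\<dots> \<le> ennreal (2 ^ j) * pot {S j<..} f x" using j by (intro mult_left_mono) auto
      finally have "f x * 1 \<le> f x * (ennreal (2 ^ j) * pot {S j<..} f x)" by (rule mult_left_mono) simp
      also have "\<dots> = (\<Sum>i\<in>{j}. ennreal (2 ^ i) * (f x * pot {S i<..} f x))" by (simp add: mult_ac)
      also have "\<dots> \<le> (\<Sum>i. ennreal (2 ^ i) * (f x * pot {S i<..} f x))" by (rule sum_le_suminf) auto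
      finally show ?thesis using False by simp
    qed simp
  qed
  also have "\<dots> = (\<Sum>j. \<integral>\<^sup>+x. ennreal (2 ^ j) * (f x * pot {S j<..} f x) \<partial>lborel)"
    by (rule nn_integral_suminf) measurable
  also have "\<dots> = (\<Sum>j. ennreal (2 ^ j) * energy {S j<..} f f)"
    unfolding energy_def by (intro suminf_cong nn_integral_cmult) measurable
  also have "\<dots> \<le> (\<Sum>j. ennreal ((1/2) ^ j * (1/4)))"
  proof (intro suminf_le allI)
    fix j
    have "ennreal (2 ^ j) * energy {S j<..} f f \<le> ennreal (2 ^ j) * ennreal ((1/4) ^ (j + 1))" by (intro mult_left_mono S) auto
    also have "\<dots> = ennreal (2 ^ j * (1/4) ^ (j + 1))" by (simp only: ennreal_mult[symmetric] zero_le_power zero_le_numeral zero_le_divide_1_iff)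
    also have "2 ^ j * (1/4) ^ (j + 1) = (1/2) ^ j * (1/4 :: real)"
      by (simp add: power_mult_distrib[symmetric])
    finally show "ennreal (2 ^ j) * energy {S j<..} f f \<le> ennreal ((1/2) ^ j * (1/4))" .
  qed auto
  also have "\<dots> = ennreal (1/2)"
  proof -
    have "(\<lambda>j. (1/2::real) ^ j * (1/4)) sums (1 / (1 - 1/2) * (1/4))" by (intro sums_mult2 geometric_sums) simp
    then have sm: "summable (\<lambda>j. (1/2::real) ^ j * (1/4))" and su: "(\<Sum>j. (1/2::real) ^ j * (1/4)) = 1/2"
      by (simp_all only: sums_iff) auto
    have "(\<Sum>j. ennreal ((1/2) ^ j * (1/4))) = ennreal (\<Sum>j. (1/2::real) ^ j * (1/4))"
      by (rule suminf_ennreal2[OF _ sm]) simp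
    then show ?thesis by (simp only: su)
  qed
  finally have bad: "(\<integral>\<^sup>+x. f x * indicator (- C) x \<partial>lborel) \<le> ennreal (1/2)" .
  have "ennreal 1 = (\<integral>\<^sup>+x. g x + f x * indicator (- C) x \<partial>lborel)"
    unfolding mass[symmetric] ennreal_1 by (rule nn_integral_cong) (auto simp: g_def indicator_def)
  also have "\<dots> = (\<integral>\<^sup>+x. g x \<partial>lborel) + (\<integral>\<^sup>+x. f x * indicator (- C) x \<partial>lborel)"
    by (rule nn_integral_add) measurable
  also have "\<dots> \<le> (\<integral>\<^sup>+x. g x \<partial>lborel) + ennreal (1/2)" by (intro add_left_mono bad)
  finally have "ennreal 1 \<le> (\<integral>\<^sup>+x. g x \<partial>lborel) + ennreal (1/2)" .
  moreover have "ennreal 1 = ennreal (1/2) + ennreal (1/2)"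
  proof -
    have "ennreal (1/2 + 1/2) = ennreal (1/2) + ennreal (1/2)" by (rule ennreal_plus) auto
    then show ?thesis by simp
  qed
  ultimately have "ennreal (1/2) + ennreal (1/2) \<le> ennreal (1/2) + (\<integral>\<^sup>+x. g x \<partial>lborel)"
    by (simp only: add.commute)
  then have half: "ennreal (1/2) \<le> (\<integral>\<^sup>+x. g x \<partial>lborel)"
    unfolding ennreal_add_left_cancel_le by simp
  have Cne: "C \<noteq> {}"
  proof
    assume "C = {}" then have "g = (\<lambda>_. 0)" by (simp add: g_def)
    then show False using half by simp
  qed
  have "pot {4 * S j<..} g x \<le> ennreal (4 powr (DIM('a) / 2 - 1) * (1/2) ^ j)" for x j
  proof -
    have "pot {4 * S j<..} g x \<le> ennreal (4 powr (DIM('a) / 2 - 1)) * ennreal ((1/2) ^ j)"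
    proof (rule pot_tail_maximum[OF gm Cc Cne])
      show "y \<in> C" if "g y \<noteq> 0" for y using that by (auto simp: g_def indicator_def split: if_splits)
      show "pot {S j<..} g x \<le> ennreal ((1/2) ^ j)" if "x \<in> C" for x
      proof -
        have "pot {S j<..} g x \<le> pot {S j<..} f x" by (rule pot_mono[OF gf])
        also have "\<dots> \<le> ennreal ((1/2) ^ j)" using that by (simp add: C_def)
        finally show ?thesis .
      qed
    qed (rule S)
    then show ?thesis by (simp add: ennreal_mult)
  qed
  then show ?thesis using that gm gf half by blast
qed

subsection \<open>Non-polar compact sets carry continuous potentials\<close>

lemma newton_shift_superharmonic:
  fixes a :: "'a::euclidean_space"
  assumes d: "DIM('a) \<ge> 3"
  shows "subharmonic_on (- {a}) (\<lambda>x. - newton (x - a))"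
proof -
  have "(+) a ` (- {0}) = - {a}" 
  proof (intro set_eqI iffI)
    fix x assume "x \<in> - {a}" then show "x \<in> (+) a ` (- {0})" by (intro image_eqI[of _ _ "x - a"]) auto
  qed auto
  then show ?thesis using subharmonic_on_translate[OF newton_harmonic(2)[OF d], of a] by simp
qed

lemma continuous_newton_shift: "a \<notin> A \<Longrightarrow> continuous_on A (\<lambda>x. newton (x - a))"
  by (rule continuous_on_compose2[OF continuous_newton]) (auto intro!: continuous_intros)

lemma ball_defect_close:
  fixes f g :: "'a::euclidean_space \<Rightarrow> real"
  assumes f: "continuous_on (cball x r) f" and g: "continuous_on (cball x r) g" and r: "r > 0"
    and close: "\<And>y. y \<in> cball x r \<Longrightarrow> \<bar>f y - g y\<bar> \<le> e"
  shows "ball_defect r g x - 2 * e * measure lborel (cball x r) \<le> ball_defect r f x"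
proof -
  have i: "h integrable_on cball x r" if "continuous_on (cball x r) h" for h :: "'a \<Rightarrow> real"
    by (rule set_borel_integral_eq_integral(1)[OF cball_integrable_continuous[OF that]])
  have c: "continuous_on (cball x r) (\<lambda>y. g y - e)" by (intro continuous_intros g)
  have k: "integral (cball x r) (\<lambda>y. e) = e * measure lborel (cball x r)"
    using ball_defect_eq[of x r "\<lambda>_. e"] by (simp add: ball_defect_const)
  have "integral (cball x r) g - e * measure lborel (cball x r) = integral (cball x r) (\<lambda>y. g y - e)"
    by (subst Henstock_Kurzweil_Integration.integral_diff) (auto intro!: i g continuous_intros simp: k)
  also have "\<dots> \<le> integral (cball x r) f"
  proof (rule integral_le)
    show "g y - e \<le> f y" if "y \<in> cball x r" for y using close[OF that] by linarith
  qed (intro i f c)+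
  finally have 1: "integral (cball x r) g - e * measure lborel (cball x r) \<le> integral (cball x r) f" .
  have "f x \<le> g x + e" using close[of x] r by simp
  then have "f x * measure lborel (cball x r) \<le> (g x + e) * measure lborel (cball x r)" by (intro mult_right_mono) auto
  then show ?thesis unfolding ball_defect_eq[OF f] ball_defect_eq[OF g] using 1 by (simp add: algebra_simps)
qed

text \<open>The point is the order of the quantifiers: the scales \<open>S j\<close> serve all
  \<open>m\<close> at once, although the bounds \<open>B m\<close> may grow.\<close>

lemma nonpolar_restricted_densities:
  fixes K :: "'a::euclidean_space set"
  assumes d: "DIM('a) \<ge> 3" and K: "K \<noteq> {}" 
    and fin: "(SUP k. INF f\<in>densities K k. energy {0<..} f f) \<noteq> \<infinity>"
  obtains S :: "nat \<Rightarrow> real" and g B where "\<And>j. S j > 0" "\<And>m. g m \<in> borel_measurable borel" "\<And>m y. g m y \<le> ennreal (B m)"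
    "\<And>m y. g m y \<noteq> 0 \<Longrightarrow> infdist y K \<le> inverse (real (Suc m))" "\<And>m. (\<integral>\<^sup>+x. g m x \<partial>lborel) \<le> 1"
    "\<And>m. ennreal (1/2) \<le> (\<integral>\<^sup>+x. g m x \<partial>lborel)"
    "\<And>m x j. pot {4 * S j<..} (g m) x \<le> ennreal (4 powr (DIM('a) / 2 - 1) * (1/2) ^ j)"
proof -
  define e where "e = (\<lambda>k. INF f\<in>densities K k. energy {0<..} f f)"
  have inc: "incseq e" unfolding e_def by (intro monoI INF_superset_mono densities_mono) auto
  have le: "e k \<le> (SUP k. e k)" for k by (rule SUP_upper) simp
  have sf: "(SUP k. e k) < \<infinity>"
    using fin unfolding e_def infinity_ennreal_def by (rule top.not_eq_extremum[THEN iffD1])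
  have ef: "e k < \<infinity>" for k using le_less_trans[OF le sf] .
  define i where "i = (\<lambda>k. enn2real (e k))"
  define I where "I = enn2real (SUP k. e k)"
  have ei: "e k = ennreal (i k)" for k using ef[of k] by (simp add: i_def)
  have i0: "i k \<ge> 0" for k by (simp add: i_def)
  have iI: "i k \<le> I" for k unfolding i_def I_def by (rule enn2real_mono[OF le]) (use sf in simp)
  have "e \<longlonglongrightarrow> (SUP k. e k)" by (rule LIMSEQ_SUP[OF inc])
  then have il: "i \<longlonglongrightarrow> I" unfolding i_def I_def using sf by (intro tendsto_enn2real) auto
  have "\<exists>f\<in>densities K m. energy {0<..} f f \<le> ennreal (i m + inverse (real (Suc m)))" for m
  proof -
    have "e m < ennreal (i m + inverse (real (Suc m)))" unfolding ei using i0[of m] by (intro ennreal_lessI) (auto intro: add_nonneg_pos)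
    then show ?thesis unfolding e_def INF_less_iff by (auto intro: less_imp_le)
  qed
  then obtain f where f: "\<And>m. f m \<in> densities K m" "\<And>m. energy {0<..} (f m) (f m) \<le> ennreal (i m + inverse (real (Suc m)))" by metis
  have "\<exists>S>0. \<forall>m. energy {S<..} (f m) (f m) \<le> ennreal ((1/4) ^ (j + 1))" for j :: nat
    using uniform_energy_tail[OF f(1) ei[unfolded e_def] i0 iI il f(2), of "(1/4) ^ (j + 1)"] by (metis zero_less_power zero_less_divide_1_iff zero_less_numeral)
  then obtain S where S: "\<And>j. S j > 0" "\<And>j m. energy {S j<..} (f m) (f m) \<le> ennreal ((1/4) ^ (j + 1))" by metis
  have fm: "f m \<in> borel_measurable borel" "(\<integral>\<^sup>+x. f m x \<partial>lborel) = 1" "\<And>y. f m y \<noteq> 0 \<Longrightarrow> infdist y K \<le> inverse (real (Suc m))" for m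
    using f(1)[of m] by (auto simp: densities_def)
  have "\<exists>B. \<forall>y. f m y \<le> ennreal B" for m using f(1)[of m] unfolding densities_def by blast
  then obtain B where B: "\<And>m y. f m y \<le> ennreal (B m)" by metis
  have "\<exists>g. g \<in> borel_measurable borel \<and> (\<forall>y. g y \<le> f m y) \<and> ennreal (1/2) \<le> (\<integral>\<^sup>+x. g x \<partial>lborel) \<and>
    (\<forall>x j. pot {4 * S j<..} g x \<le> ennreal (4 powr (DIM('a) / 2 - 1) * (1/2) ^ j))" for m
    by (rule restricted_density[OF fm(1) B fm(2) S(1) S(2), of m]) blast
  then obtain g where g: "\<And>m. g m \<in> borel_measurable borel" "\<And>m y. g m y \<le> f m y" "\<And>m. ennreal (1/2) \<le> (\<integral>\<^sup>+x. g m x \<partial>lborel)"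
    "\<And>m x j. pot {4 * S j<..} (g m) x \<le> ennreal (4 powr (DIM('a) / 2 - 1) * (1/2) ^ j)" by metis
  show ?thesis
  proof (rule that[OF S(1) g(1)])
    show "g m y \<le> ennreal (B m)" for m y using g(2) B by (rule order_trans)
    show "infdist y K \<le> inverse (real (Suc m))" if "g m y \<noteq> 0" for m y
    proof (rule fm(3))
      show "f m y \<noteq> 0" using g(2)[of m y] that by auto
    qed
    show "(\<integral>\<^sup>+x. g m x \<partial>lborel) \<le> 1" for m unfolding fm(2)[of m, symmetric] by (rule nn_integral_mono) (rule g(2))
  qed (rule g)+
qed

text \<open>The common tails make the potentials equicontinuous and a subsequence converges
  uniformly. The supports eventually leave any closed ball disjoint from \<open>K\<close>, so the
  mean value equality survives there. Mass at least \<open>1/2\<close> keeps the limit away from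
  zero on \<open>K\<close>.\<close>

lemma nonpolar_limit_potential:
  fixes K :: "'a::euclidean_space set"
  assumes d: "DIM('a) \<ge> 3" and K: "K \<noteq> {}" "compact K" "K \<subseteq> cball a \<rho>" and \<rho>: "\<rho> > 0" and R: "R \<ge> 26 * \<rho>"
    and fin: "(SUP k. INF f\<in>densities K k. energy {0<..} f f) \<noteq> \<infinity>"
  obtains G c where "continuous_on (cball a R) G" "subharmonic_on (ball a R - K) G" "c > 0" "\<And>x. x \<in> K \<Longrightarrow> c \<le> G x"
    "\<And>x. dist a x = R \<Longrightarrow> G x \<le> c / 4"
proof -
  obtain S g B where S: "\<And>j::nat. S j > (0::real)" and g: "\<And>m::nat. g m \<in> borel_measurable borel" "\<And>m y. g m y \<le> ennreal (B m)"
    "\<And>m y. g m y \<noteq> 0 \<Longrightarrow> infdist y K \<le> inverse (real (Suc m))" "\<And>m. (\<integral>\<^sup>+x. g m x \<partial>lborel) \<le> 1"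
    "\<And>m. ennreal (1/2) \<le> (\<integral>\<^sup>+x. g m x \<partial>lborel)"
    and tail: "\<And>m x j. pot {4 * S j<..} (g m) x \<le> ennreal (4 powr (DIM('a) / 2 - 1) * (1/2) ^ j)"
    using nonpolar_restricted_densities[OF d K(1) fin] by metis
  define m where "m = DIM('a) / 2 - 1"
  have m: "m \<ge> 1/2" using d by (simp add: m_def)
  define \<gamma> where "\<gamma> = Gamma m"
  have \<gamma>: "\<gamma> > 0" using m by (simp add: \<gamma>_def Gamma_real_pos)
  define q where "q = (4::real) powr m"
  have q: "q > 0" by (simp add: q_def)
  have R0: "R > 0" "R \<ge> 2 * \<rho>" "R - 2 * \<rho> > 0" using R \<rho> by auto
  \<comment> \<open>Dropping the first densities puts all supports into the ball of radius
    \<open>2 * \<rho>\<close>.\<close>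
  obtain m0 where m0: "inverse (real (Suc m0)) < \<rho>" using reals_Archimedean[OF \<rho>] by blast
  define h where "h = (\<lambda>n. g (m0 + n))"
  have hm: "h n \<in> borel_measurable borel" for n by (simp add: h_def g)
  have hB: "h n y \<le> ennreal (B (m0 + n))" for n y by (simp add: h_def g)
  have hi: "infdist y K \<le> inverse (real (Suc (m0 + n)))" if "h n y \<noteq> 0" for n y
    using g(3)[of "m0 + n" y] that by (simp add: h_def)
  have hs: "y \<in> cball a (2 * \<rho>)" if "h n y \<noteq> 0" for n y
  proof -
    have "inverse (real (Suc (m0 + n))) \<le> inverse (real (Suc m0))" by (rule le_imp_inverse_le) auto
    then have "infdist y K < \<rho>" using hi[OF that] m0 by linarith
    then obtain z where z: "z \<in> K" "dist y z < \<rho>" using infdist_less_obtain[OF K(1)] by blast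
    then have "dist a z \<le> \<rho>" using K(3) by auto
    then show ?thesis using z dist_triangle[of a y z] by (simp add: dist_commute)
  qed
  have hR: "y \<in> cball a R" if "h n y \<noteq> 0" for n y using hs[OF that] R0 by simp
  have mass: "(\<integral>\<^sup>+x. h n x \<partial>lborel) \<le> ennreal 1" for n by (simp add: h_def g)
  have mass2: "ennreal (1/2) \<le> (\<integral>\<^sup>+x. h n x \<partial>lborel)" for n by (simp only: h_def g)
  have pf: "pot {0<..} (h n) x < \<infinity>" for n x by (rule pot_finite[OF d hm hB hR])
  have pc: "continuous_on UNIV (potr (h n))" for n by (rule potr_continuous[OF d hm hB hR mass]) auto
  define L where "L = (\<lambda>j. (4 * S j) powr m * (4 * S j) * (4 * R))"
  have L: "L j \<ge> 0" for j using S[of j] R0 by (simp add: L_def)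
  have diff: "\<bar>potr (h n) x - potr (h n) y\<bar> \<le> L j * norm (x - y) + q * (1/2) ^ j" if "x \<in> cball a R" "y \<in> cball a R" for n x y j
  proof -
    have "\<bar>potr (h n) x - potr (h n) y\<bar> \<le> (4 * S j) powr (DIM('a) / 2 - 1) * (4 * S j) * (4 * R) * 1 * norm (x - y) + q * (1/2) ^ j"
    proof (rule potr_difference[OF d hm _ _ hR that pf mass])
      show "pot {4 * S j<..} (h n) x \<le> ennreal (q * (1/2) ^ j)" for x using tail[of j] by (simp add: h_def q_def m_def)
    qed (use S[of j] R0 q in auto)
    then show ?thesis by (simp add: L_def m_def)
  qed
  define \<theta> where "\<theta> = \<gamma> * ((R - 2 * \<rho>)\<^sup>2) powr (-m)"
  have \<theta>: "\<theta> \<ge> 0" using \<gamma> by (simp add: \<theta>_def)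
  have outer: "potr (h n) x \<le> \<theta>" if x: "dist a x = R" for n x
  proof -
    have "pot {0<..} (h n) x \<le> ennreal (Gamma (DIM('a) / 2 - 1) * ((R - 2 * \<rho>)\<^sup>2) powr (- (DIM('a) / 2 - 1))) * (\<integral>\<^sup>+y. h n y \<partial>lborel)"
    proof (rule pot_upper[OF d hm R0(3)])
      fix y assume "h n y \<noteq> 0"
      then have "dist a y \<le> 2 * \<rho>" using hs by auto
      then show "R - 2 * \<rho> \<le> dist x y" using x dist_triangle[of a x y] by (simp add: dist_commute)
    qed
    also have "\<dots> \<le> ennreal \<theta> * ennreal 1" unfolding \<theta>_def \<gamma>_def m_def by (intro mult_left_mono mass) auto
    finally show ?thesis unfolding pot_eq_potr[OF pf] using \<theta> by simp
  qed
  define c where "c = \<gamma> * ((3 * \<rho>)\<^sup>2) powr (-m) / 2"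
  have c: "c > 0" using \<gamma> \<rho> by (simp add: c_def)
  have inner: "c \<le> potr (h n) x" if x: "x \<in> K" for n x
  proof -
    have "ennreal (Gamma (DIM('a) / 2 - 1) * ((3 * \<rho>)\<^sup>2) powr (- (DIM('a) / 2 - 1))) * (\<integral>\<^sup>+y. h n y \<partial>lborel) \<le> pot {0<..} (h n) x"
    proof (rule pot_lower[OF d hm])
      fix y assume "h n y \<noteq> 0"
      then have "dist a y \<le> 2 * \<rho>" using hs by auto
      moreover have "dist a x \<le> \<rho>" using x K by auto
      ultimately show "dist x y \<le> 3 * \<rho>" using dist_triangle3[of x y a] by simp
    qed (use \<rho> in simp)
    moreover have "ennreal (\<gamma> * ((3 * \<rho>)\<^sup>2) powr (-m)) * ennreal (1/2) \<le> ennreal (\<gamma> * ((3 * \<rho>)\<^sup>2) powr (-m)) * (\<integral>\<^sup>+y. h n y \<partial>lborel)"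
      by (intro mult_left_mono mass2) auto
    ultimately have "ennreal (\<gamma> * ((3 * \<rho>)\<^sup>2) powr (-m)) * ennreal (1/2) \<le> ennreal (potr (h n) x)"
      unfolding pot_eq_potr[OF pf, symmetric] \<gamma>_def m_def by (rule order_trans[rotated])
    moreover have "ennreal (\<gamma> * ((3 * \<rho>)\<^sup>2) powr (-m)) * ennreal (1/2) = ennreal c"
      unfolding c_def using \<gamma> by (subst ennreal_mult[symmetric]) auto
    ultimately show ?thesis by simp
  qed
  \<comment> \<open>From \<open>R \<ge> 26 * \<rho>\<close> the support is at distance at least
    \<open>24 * \<rho>\<close>, eight times \<open>3 * \<rho>\<close>, from the outer sphere. In
    squares this is a factor 64, and \<open>64 powr (-m) \<le> 1/8\<close>; the factor
    \<open>1/2\<close> in \<open>c\<close> turns \<open>1/8\<close> into \<open>1/4\<close>.\<close>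
  have \<theta>c: "\<theta> \<le> c / 4"
  proof -
    have "(24 * \<rho>)\<^sup>2 \<le> (R - 2 * \<rho>)\<^sup>2" using R \<rho> by (intro power_mono) auto
    then have "64 * (3 * \<rho>)\<^sup>2 \<le> (R - 2 * \<rho>)\<^sup>2" by (simp add: power_mult_distrib)
    then have "((R - 2 * \<rho>)\<^sup>2) powr (-m) \<le> (64 * (3 * \<rho>)\<^sup>2) powr (-m)" using \<rho> m by (intro powr_mono2') auto
    also have "\<dots> = 64 powr (-m) * ((3 * \<rho>)\<^sup>2) powr (-m)" by (rule powr_mult; simp)
    also have "\<dots> \<le> (1/8) * ((3 * \<rho>)\<^sup>2) powr (-m)"
    proof (rule mult_right_mono)
      have "(64::real) powr (-m) \<le> 64 powr (- (1/2))" using m by (intro powr_mono) auto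
      also have "\<dots> = 1 / 8"
      proof -
        have "(64::real) powr (1/2) = sqrt 64" by (simp add: powr_half_sqrt)
        also have "sqrt 64 = 8" by (rule real_sqrt_unique) auto
        finally show ?thesis by (simp add: powr_minus_divide)
      qed
      finally show "(64::real) powr (-m) \<le> 1 / 8" .
    qed simp
    finally have "\<gamma> * ((R - 2 * \<rho>)\<^sup>2) powr (-m) \<le> \<gamma> * ((1/8) * ((3 * \<rho>)\<^sup>2) powr (-m))" using \<gamma> by (intro mult_left_mono) auto
    then show ?thesis by (simp add: \<theta>_def c_def)
  qed
  \<comment> \<open>A reference point on the outer sphere: the potentials are bounded there, and the
    common modulus extends the bound to the whole ball.\<close>
  obtain b :: 'a where b: "b \<in> Basis" using nonempty_Basis by blast
  define p where "p = a + R *\<^sub>R b"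
  have p: "dist a p = R" using b R0 by (simp add: p_def dist_norm)
  have bound: "norm (potr (h n) x) \<le> \<theta> + L 0 * (2 * R) + q" if x: "x \<in> cball a R" for n x
  proof -
    have "norm (x - p) \<le> 2 * R" using x p dist_triangle3[of x p a] by (auto simp: dist_norm)
    then have "L 0 * norm (x - p) \<le> L 0 * (2 * R)" using L by (rule mult_left_mono)
    moreover have "\<bar>potr (h n) x - potr (h n) p\<bar> \<le> L 0 * norm (x - p) + q" using diff[OF x, of p n 0] p by simp
    ultimately show ?thesis using outer[OF p, of n] potr_nonneg[of "h n" x] by auto
  qed
  have equi: "\<exists>dl. 0 < dl \<and> (\<forall>n y. y \<in> cball a R \<and> norm (x - y) < dl \<longrightarrow> norm (potr (h n) x - potr (h n) y) < e)"
    if x: "x \<in> cball a R" and e: "0 < e" for x e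
  proof -
    have "(\<lambda>j. q * (1/2::real) ^ j) \<longlonglongrightarrow> q * 0" by (intro tendsto_mult tendsto_const LIMSEQ_power_zero) simp
    then have "\<forall>\<^sub>F j in sequentially. q * (1/2) ^ j < e / 2" by (intro order_tendstoD(2)) (use e in auto)
    then obtain j where j: "q * (1/2) ^ j < e / 2" unfolding eventually_sequentially by blast
    define dl where "dl = e / 2 / (L j + 1)"
    have dl: "dl > 0" using e L[of j] by (simp add: dl_def)
    have "norm (potr (h n) x - potr (h n) y) < e" if y: "y \<in> cball a R" "norm (x - y) < dl" for n y
    proof -
      have "L j * norm (x - y) \<le> (L j + 1) * dl" using y L[of j] by (intro mult_mono) auto
      also have "\<dots> = e / 2"
      proof -
        have "L j + 1 \<noteq> 0" using L[of j] by linarith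
        then show ?thesis unfolding dl_def by (metis nonzero_mult_div_cancel_left times_divide_eq_right)
      qed
      finally show ?thesis using diff[OF x y(1), of n j] j by simp
    qed
    then show ?thesis using dl by blast
  qed
  obtain G k where Gc: "continuous_on (cball a R) G" and k: "strict_mono (k :: nat \<Rightarrow> nat)"
    and lim: "\<And>e. 0 < e \<Longrightarrow> \<exists>N. \<forall>n x. n \<ge> N \<and> x \<in> cball a R \<longrightarrow> norm (potr (h (k n)) x - G x) < e"
    using Arzela_Ascoli[OF compact_cball bound equi] by metis
  have ptlim: "(\<lambda>n. potr (h (k n)) x) \<longlonglongrightarrow> G x" if "x \<in> cball a R" for x
    unfolding lim_sequentially dist_norm using lim that by blast
  have Kin: "K \<subseteq> cball a R" using K(3) R0 \<rho> by (auto intro: order_trans)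
  have sub: "subharmonic_on (ball a R - K) G"
  proof (rule subharmonic_onI_defect)
    show "continuous_on (ball a R - K) G" by (rule continuous_on_subset[OF Gc]) auto
    fix x and r :: real assume r: "0 < r" "cball x r \<subseteq> ball a R - K"
    have cR: "cball x r \<subseteq> cball a R" using r(2) ball_subset_cball[of a R] by blast
    have "cball x r \<inter> K = {}" using r(2) by blast
    then obtain \<delta> where \<delta>: "\<delta> > 0" "\<And>y z. y \<in> cball x r \<Longrightarrow> z \<in> K \<Longrightarrow> \<delta> \<le> dist y z"
      using separate_compact_closed[OF compact_cball compact_imp_closed[OF K(2)]] by metis
    obtain N1 where N1: "inverse (real (Suc N1)) < \<delta>" using reals_Archimedean[OF \<delta>(1)] by blast
    have far: "r < dist x y" if n: "n \<ge> N1" and y: "h (k n) y \<noteq> 0" for n y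
    proof (rule ccontr)
      assume "\<not> r < dist x y"
      then have yc: "y \<in> cball x r" by simp
      have "N1 \<le> k n" using n seq_suble[OF k, of n] by linarith
      then have "inverse (real (Suc (m0 + k n))) \<le> inverse (real (Suc N1))" by (intro le_imp_inverse_le) auto
      then have "infdist y K < \<delta>" using hi[OF y] N1 by linarith
      then obtain z where "z \<in> K" "dist y z < \<delta>" using infdist_less_obtain[OF K(1)] by blast
      then show False using \<delta>(2)[OF yc] by fastforce
    qed
    define V where "V = measure lborel (cball x r)"
    have V: "V > 0" unfolding V_def by (rule measure_cball_pos[OF r(1)])
    have "0 \<le> ball_defect r G x + e" if e: "e > 0" for e
    proof -
      have "e / (2 * V) > 0" using e V by simp
      then obtain N where N: "\<And>n x. n \<ge> N \<Longrightarrow> x \<in> cball a R \<Longrightarrow> norm (potr (h (k n)) x - G x) < e / (2 * V)" using lim by blast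
      define n where "n = max N N1"
      have "ball_defect r (potr (h (k n))) x - 2 * (e / (2 * V)) * V \<le> ball_defect r G x"
        unfolding V_def
      proof (rule ball_defect_close[OF _ _ r(1)])
        show "continuous_on (cball x r) G" by (rule continuous_on_subset[OF Gc cR])
        show "continuous_on (cball x r) (potr (h (k n)))" by (rule continuous_on_subset[OF pc]) simp
        show "\<bar>G y - potr (h (k n)) y\<bar> \<le> e / (2 * measure lborel (cball x r))" if "y \<in> cball x r" for y
          using N[of n y] that cR by (auto simp: n_def V_def abs_minus_commute)
      qed
      moreover have "ball_defect r (potr (h (k n))) x = 0"
        by (rule potr_defect(2)[OF d hm pc pf r(1)]) (use far[of n] in \<open>auto simp: n_def\<close>)
      ultimately show ?thesis using V by simp
    qed
    then show "0 \<le> ball_defect r G x" by (rule field_le_epsilon)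
  qed
  show ?thesis
  proof (rule that[OF Gc sub c])
    show "c \<le> G x" if "x \<in> K" for x
      by (rule LIMSEQ_le_const[OF ptlim]) (use that Kin inner in auto)
    show "G x \<le> c / 4" if "dist a x = R" for x
    proof (rule LIMSEQ_le_const2[OF ptlim])
      show "x \<in> cball a R" using that by simp
      show "\<exists>N. \<forall>n\<ge>N. potr (h (k n)) x \<le> c / 4" using outer[OF that] \<theta>c by (meson order_trans)
    qed
  qed
qed

text \<open>The limit potential divided by its maximum over \<open>K\<close>, which by the maximum
  principle is also the maximum over the large ball. The value 1 is attained at a point of
  \<open>K\<close>, where the lower function built from \<open>v\<close> will be evaluated.\<close>

lemma nonpolar_function:
  fixes K :: "'a::euclidean_space set"
  assumes d: "DIM('a) \<ge> 3" and K: "K \<noteq> {}" "compact K" "K \<subseteq> cball a \<rho>" and \<rho>: "\<rho> > 0" and R: "R \<ge> 26 * \<rho>"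
    and np: "\<not> polar_compact K"
  obtains v z where "continuous_on (cball a R) v" "subharmonic_on (ball a R - K) v" "\<And>x. x \<in> cball a R \<Longrightarrow> v x \<le> 1"
    "z \<in> K" "v z = 1" "\<And>x. x \<in> cball a R \<Longrightarrow> 2 * \<rho> \<le> dist a x \<Longrightarrow> v x \<le> 3/4"
proof -
  have F: "(SUP k. INF f\<in>densities K k. energy {0<..} f f) \<noteq> \<infinity>" using polar_compact_of_large_energy[OF d K(1,2)] np by blast
  obtain G c where G: "continuous_on (cball a R) G" "subharmonic_on (ball a R - K) G" "c > 0" "\<And>x. x \<in> K \<Longrightarrow> c \<le> G x"
    "\<And>x. dist a x = R \<Longrightarrow> G x \<le> c / 4"
    by (rule nonpolar_limit_potential[OF d K \<rho> R F]) (rule that)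
  have R0: "R > 2 * \<rho>" "R > 0" using R \<rho> by auto
  have Kin: "K \<subseteq> ball a R" using K(3) R0 \<rho> by (auto intro: le_less_trans)
  have KR: "K \<subseteq> cball a R" using Kin ball_subset_cball by blast
  obtain z where z: "z \<in> K" "\<And>x. x \<in> K \<Longrightarrow> G x \<le> G z"
    using continuous_attains_sup[OF K(2,1) continuous_on_subset[OF G(1) KR]] by blast
  define M where "M = G z"
  have M: "M \<ge> c" "M > 0" using G(3) G(4)[OF z(1)] by (auto simp: M_def)
  have op: "open (ball a R - K)" using compact_imp_closed[OF K(2)] by (intro open_Diff) auto
  have clos: "closure (ball a R - K) \<subseteq> cball a R" by (rule closure_minimal) (auto)
  have le: "G x \<le> M" if x: "x \<in> cball a R" for x
  proof -
    consider "x \<in> K" | "dist a x = R" | "x \<in> ball a R - K" using x by (auto simp: less_le)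
    then show ?thesis
    proof cases
      case 3
      show ?thesis
      proof (rule subharmonic_maximum_principle[OF _ op _ G(2)])
        show "bounded (ball a R - K)" by (rule bounded_subset[OF bounded_ball]) auto
        show "continuous_on (closure (ball a R - K)) G" by (rule continuous_on_subset[OF G(1) clos])
        show "x \<in> closure (ball a R - K)" by (rule subsetD[OF closure_subset 3])
        fix y assume y: "y \<in> frontier (ball a R - K)"
        then have "y \<in> cball a R" "y \<notin> ball a R - K" using clos op by (auto simp: frontier_def interior_open)
        then have "y \<in> K \<or> dist a y = R" by auto
        then show "G y \<le> M" using z(2) G(5)[of y] M by (auto simp: M_def[symmetric])
      qed
    qed (use z G(5)[of x] M in \<open>auto simp: M_def[symmetric]\<close>)
  qed
  define v where "v = (\<lambda>x. (1 / M) * G x)"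
  have vc: "continuous_on (cball a R) v" unfolding v_def by (intro continuous_intros G)
  have vs: "subharmonic_on (ball a R - K) v" unfolding v_def using subharmonic_on_cmult[OF G(2), of "1 / M"] M by simp
  have v1: "v x \<le> 1" if "x \<in> cball a R" for x using le[OF that] M by (simp add: v_def)
  have vz: "v z = 1" using M by (simp add: v_def M_def)
  have vR: "v x \<le> 1/4" if "dist a x = R" for x using G(5)[OF that] M by (simp add: v_def field_simps)
  define m where "m = DIM('a) / 2 - 1"
  have m: "m \<ge> 1/2" using d by (simp add: m_def)
  define A where "A = (\<rho>\<^sup>2) powr m"
  have A: "A > 0" using \<rho> by (simp add: A_def)
  define U where "U = ball a R - cball a \<rho>"
  have Uo: "open U" by (auto simp: U_def)
  have Uc: "closure U \<subseteq> cball a R - ball a \<rho>" unfolding U_def by (rule closure_minimal) (auto intro: closed_Diff)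
  have aU: "a \<notin> cball a R - ball a \<rho>" using \<rho> by simp
  note shift = newton_shift_superharmonic[OF d, of a]
  \<comment> \<open>On the annulus \<open>v\<close> is compared with \<open>1/4\<close> plus the
    Newton kernel normalized to 1 on the sphere of radius \<open>\<rho>\<close>. At distance at
    least \<open>2 * \<rho>\<close> this kernel is at most \<open>1/2\<close>, whence
    \<open>3/4\<close>.\<close>
  define w where "w = (\<lambda>x. v x + A * (- newton (x - a)))"
  have "v x \<le> 3/4" if x: "x \<in> cball a R" "2 * \<rho> \<le> dist a x" for x
  proof (cases "dist a x = R")
    case True then show ?thesis using vR by fastforce
  next
    case False
    then have xU: "x \<in> U" using x \<rho> by (auto simp: U_def)
    have "w x \<le> 1/4"
    proof (rule subharmonic_maximum_principle[OF _ Uo])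
      show "bounded U" unfolding U_def by (rule bounded_subset[OF bounded_ball]) auto
      show "continuous_on (closure U) w" unfolding w_def
      proof (intro continuous_intros)
        show "continuous_on (closure U) v" by (rule continuous_on_subset[OF vc]) (use Uc in auto)
        show "continuous_on (closure U) (\<lambda>x. newton (x - a))"
          by (rule continuous_newton_shift) (use Uc aU in auto)
      qed
      show "subharmonic_on U w" unfolding w_def
      proof (intro subharmonic_on_add subharmonic_on_cmult)
        show "subharmonic_on U v" by (rule subharmonic_on_subset[OF vs]) (use K(3) in \<open>auto simp: U_def\<close>)
        show "subharmonic_on U (\<lambda>x. - newton (x - a))" by (rule subharmonic_on_subset[OF shift]) (use \<rho> in \<open>auto simp: U_def\<close>)
      qed (use A in simp)
      show "x \<in> closure U" by (rule subsetD[OF closure_subset xU])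
      fix y assume y: "y \<in> frontier U"
      then have y1: "y \<in> cball a R" "\<rho> \<le> dist a y" "y \<notin> U" using Uc Uo by (auto simp: frontier_def interior_open)
      then have "dist a y = \<rho> \<or> dist a y = R" by (auto simp: U_def)
      then show "w y \<le> 1/4"
      proof
        assume e: "dist a y = \<rho>"
        have "newton (y - a) = (\<rho>\<^sup>2) powr (-m)" using e by (simp add: newton_def m_def dist_norm norm_minus_commute dot_square_norm)
        then have "A * newton (y - a) = 1" using \<rho> by (simp add: A_def powr_add[symmetric])
        then show ?thesis using v1[OF y1(1)] by (simp add: w_def)
      next
        assume "dist a y = R"
        moreover have "0 \<le> A * newton (y - a)" using A by (intro mult_nonneg_nonneg) auto
        ultimately show ?thesis using vR[of y] by (simp add: w_def)
      qed
    qed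
    moreover have "A * newton (x - a) \<le> 1/2"
    proof -
      have "(2 * \<rho>)\<^sup>2 \<le> (dist a x)\<^sup>2" using x \<rho> by (intro power_mono) auto
      then have "4 * \<rho>\<^sup>2 \<le> (x - a) \<bullet> (x - a)" by (simp add: dist_norm norm_minus_commute dot_square_norm power_mult_distrib)
      then have "newton (x - a) \<le> (4 * \<rho>\<^sup>2) powr (-m)" unfolding newton_def m_def[symmetric] using \<rho> m by (intro powr_mono2') auto
      then have "A * newton (x - a) \<le> A * (4 * \<rho>\<^sup>2) powr (-m)" using A by simp
      also have "\<dots> = 4 powr (-m)" using \<rho> by (simp add: A_def powr_mult powr_add[symmetric])
      also have "\<dots> \<le> 4 powr (- (1/2))" using m by (intro powr_mono) auto
      also have "\<dots> = 1/2"
      proof -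
        have "(4::real) powr (1/2) = sqrt 4" by (simp add: powr_half_sqrt)
        then show ?thesis by (simp add: powr_minus_divide)
      qed
      finally show ?thesis .
    qed
    ultimately show ?thesis by (simp add: w_def)
  qed
  then show ?thesis using that[OF vc vs v1 z(1) vz] by blast
qed

subsection \<open>Regularity of boundary points and Kellogg's theorem\<close>

definition lower_class :: "'a::euclidean_space set \<Rightarrow> ('a \<Rightarrow> real) \<Rightarrow> ('a \<Rightarrow> real) set" where
  "lower_class U \<phi> = {v. continuous_on (closure U) v \<and> subharmonic_on U v \<and> (\<forall>z\<in>frontier U. v z \<le> \<phi> z)}"

lemma perron_solution_lower_class: "perron_solution U \<phi> x = Sup {v x | v. v \<in> lower_class U \<phi>}"
  by (simp add: perron_solution_def lower_class_def)

lemma lower_class_const: "(\<And>z. z \<in> frontier U \<Longrightarrow> c \<le> \<phi> z) \<Longrightarrow> (\<lambda>_. c) \<in> lower_class U \<phi>"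
  by (simp add: lower_class_def subharmonic_on_const)

lemma lower_class_max:
  "u \<in> lower_class U \<phi> \<Longrightarrow> v \<in> lower_class U \<phi> \<Longrightarrow> (\<lambda>x. max (u x) (v x)) \<in> lower_class U \<phi>"
  by (auto simp: lower_class_def intro: subharmonic_on_max continuous_on_max)

lemma lower_class_le:
  assumes "bounded U" "open U" "v \<in> lower_class U \<phi>" "\<And>z. z \<in> frontier U \<Longrightarrow> \<phi> z \<le> c" "x \<in> closure U"
  shows "v x \<le> c"
  by (rule subharmonic_maximum_principle[OF assms(1,2)]) (use assms in \<open>force simp: lower_class_def\<close>)+

definition neg_sqdist :: "'a::euclidean_space \<Rightarrow> 'a \<Rightarrow> real" where
  "neg_sqdist z x = - (dist x z)\<^sup>2"

lemma continuous_neg_sqdist: "continuous_on A (neg_sqdist z)"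
  unfolding neg_sqdist_def[abs_def] by (intro continuous_intros)

lemma neg_sqdist_nonpos [simp]: "neg_sqdist z x \<le> 0" by (simp add: neg_sqdist_def)

lemma boundary_modulus:
  fixes z :: "'a::euclidean_space"
  assumes K: "compact K" "z \<in> K" and c: "continuous_on K \<phi>" and e: "e > 0"
  obtains C where "C \<ge> 0" "\<And>y. y \<in> K \<Longrightarrow> \<bar>\<phi> y - \<phi> z\<bar> \<le> e - C * neg_sqdist z y"
proof -
  obtain r where r: "r > 0" "\<And>y. y \<in> K \<Longrightarrow> dist y z < r \<Longrightarrow> dist (\<phi> y) (\<phi> z) < e"
    using c K(2) e unfolding continuous_on_iff by metis
  have "bounded (\<phi> ` K)" by (rule compact_imp_bounded[OF compact_continuous_image[OF c K(1)]])
  then obtain M where M: "M > 0" "\<And>y. y \<in> K \<Longrightarrow> \<bar>\<phi> y\<bar> \<le> M" unfolding bounded_pos by auto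
  \<comment> \<open>At distance at least \<open>r\<close> the quadratic term is at least
    \<open>2 * M\<close>, the largest possible difference of two boundary values.\<close>
  define C where "C = 2 * M / r\<^sup>2"
  have C: "C \<ge> 0" using M by (simp add: C_def)
  have "\<bar>\<phi> y - \<phi> z\<bar> \<le> e - C * neg_sqdist z y" if y: "y \<in> K" for y
  proof (cases "dist y z < r")
    case True
    have "0 \<le> - (C * neg_sqdist z y)" using C by (simp add: neg_sqdist_def)
    then show ?thesis using r(2)[OF y True] by (simp add: dist_real_def)
  next
    case False
    have "r\<^sup>2 \<le> (dist y z)\<^sup>2" using False r by (intro power_mono) auto
    then have "C * r\<^sup>2 \<le> C * (dist y z)\<^sup>2" using C by (intro mult_left_mono)
    moreover have "C * r\<^sup>2 = 2 * M" using r by (simp add: C_def)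
    moreover have "\<bar>\<phi> y - \<phi> z\<bar> \<le> 2 * M" using M(2)[OF y] M(2)[OF K(2)] by linarith
    ultimately show ?thesis using e by (simp add: neg_sqdist_def)
  qed
  then show ?thesis using that C by blast
qed

text \<open>A lower function \<open>v\<close> for \<open>neg_sqdist z\<close> serves twice. The
  function \<open>\<phi> z - e + C * v\<close> is a lower function for \<open>\<phi>\<close> and
  bounds the Perron solution from below; the maximum principle for \<open>u + C * v\<close> bounds
  every competitor \<open>u\<close> from above.\<close>

lemma regular_point_criterion:
  fixes U :: "'a::euclidean_space set"
  assumes U: "open U" "bounded U" and z: "z \<in> frontier U"
    and low: "\<And>\<delta>. \<delta> > 0 \<Longrightarrow> \<exists>d>0. \<forall>x\<in>U. dist x z < d \<longrightarrow> (\<exists>v\<in>lower_class U (neg_sqdist z). v x > - \<delta>)"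
  shows "regular_point U z"
  unfolding regular_point_def
proof (intro conjI z allI impI)
  fix \<phi> :: "'a \<Rightarrow> real" assume c: "continuous_on (frontier U) \<phi>"
  have K: "compact (frontier U)" using U by (simp add: compact_frontier_bounded)
  show "(perron_solution U \<phi> \<longlongrightarrow> \<phi> z) (at z within U)"
  proof (rule tendstoI)
    fix e0 :: real assume e0: "e0 > 0"
    define e where "e = e0 / 3"
    have e: "e > 0" using e0 by (simp add: e_def)
    obtain C where C: "C \<ge> 0" "\<And>y. y \<in> frontier U \<Longrightarrow> \<bar>\<phi> y - \<phi> z\<bar> \<le> e - C * neg_sqdist z y"
      using boundary_modulus[OF K z c e] by blast
    have "e / (C + 1) > 0" using e C by simp
    then obtain d where d: "d > 0" "\<And>x. x \<in> U \<Longrightarrow> dist x z < d \<Longrightarrow> \<exists>v\<in>lower_class U (neg_sqdist z). v x > - (e / (C + 1))"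
      using low by meson
    have "dist (perron_solution U \<phi> x) (\<phi> z) < e0" if x: "x \<in> U" "dist x z < d" for x
    proof -
      have xc: "x \<in> closure U" by (rule subsetD[OF closure_subset x(1)])
      obtain v where v: "v \<in> lower_class U (neg_sqdist z)" "v x > - (e / (C + 1))" using d(2)[OF x] by blast
      have vc: "continuous_on (closure U) v" "subharmonic_on U v" "\<And>y. y \<in> frontier U \<Longrightarrow> v y \<le> neg_sqdist z y"
        using v(1) by (auto simp: lower_class_def)
      have "C * (- (e / (C + 1))) \<le> C * v x" using v(2) C by (intro mult_left_mono) auto
      moreover have "- e \<le> C * (- (e / (C + 1)))" using C e by (simp add: field_simps)
      ultimately have Cv: "- e \<le> C * v x" by linarith
      define w where "w = (\<lambda>y. \<phi> z - e + C * v y)"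
      have Cs: "C * v y \<le> C * neg_sqdist z y" if "y \<in> frontier U" for y using vc(3)[OF that] C by (intro mult_left_mono) auto
      have w: "w \<in> lower_class U \<phi>"
        unfolding lower_class_def w_def
      proof (intro CollectI conjI ballI)
        show "continuous_on (closure U) (\<lambda>y. \<phi> z - e + C * v y)" by (intro continuous_intros vc)
        show "subharmonic_on U (\<lambda>y. \<phi> z - e + C * v y)" by (intro subharmonic_on_add subharmonic_on_const subharmonic_on_cmult vc C)
        show "\<phi> z - e + C * v y \<le> \<phi> y" if "y \<in> frontier U" for y using C(2)[OF that] Cs[OF that] by linarith
      qed
      have up: "u x \<le> \<phi> z + 2 * e" if u: "u \<in> lower_class U \<phi>" for u
      proof -
        have "u x + C * v x \<le> \<phi> z + e"
        proof (rule subharmonic_maximum_principle[OF U(2,1) _ _ _ xc])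
          show "continuous_on (closure U) (\<lambda>x. u x + C * v x)" using u vc by (intro continuous_intros) (auto simp: lower_class_def)
          show "subharmonic_on U (\<lambda>x. u x + C * v x)" using u by (intro subharmonic_on_add subharmonic_on_cmult vc C) (auto simp: lower_class_def)
          show "u y + C * v y \<le> \<phi> z + e" if y: "y \<in> frontier U" for y
          proof -
            have "u y \<le> \<phi> y" using u y by (simp add: lower_class_def)
            then show ?thesis using C(2)[OF y] Cs[OF y] by linarith
          qed
        qed
        then show ?thesis using Cv by linarith
      qed
      have "perron_solution U \<phi> x \<le> \<phi> z + 2 * e"
        unfolding perron_solution_lower_class by (rule cSup_least) (use w up in auto)
      moreover have "w x \<le> perron_solution U \<phi> x"
        unfolding perron_solution_lower_class by (rule cSup_upper) (use w up in \<open>auto intro!: bdd_aboveI[of _ "\<phi> z + 2 * e"]\<close>)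
      ultimately show ?thesis using Cv e by (simp add: w_def dist_real_def e_def abs_if)
    qed
    then show "\<forall>\<^sub>F x in at z within U. dist (perron_solution U \<phi> x) (\<phi> z) < e0"
      unfolding eventually_at using d by blast
  qed
qed

lemma singular_point_criterion:
  fixes U :: "'a::euclidean_space set"
  assumes U: "open U" "bounded U" and z: "z \<in> frontier U" and x: "\<And>n. x n \<in> U" "x \<longlonglongrightarrow> z" and \<delta>: "\<delta> > 0"
    and le: "\<And>n v. v \<in> lower_class U (neg_sqdist z) \<Longrightarrow> v (x n) \<le> - \<delta>"
  shows "singular_point U z"
proof -
  have zU: "z \<notin> U" using z U by (simp add: frontier_def interior_open)
  have "\<not> regular_point U z"
  proof
    assume "regular_point U z"
    then have "(perron_solution U (neg_sqdist z) \<longlongrightarrow> neg_sqdist z z) (at z within U)"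
      using continuous_neg_sqdist by (auto simp: regular_point_def)
    then have lim: "(perron_solution U (neg_sqdist z) \<circ> x) \<longlonglongrightarrow> 0"
      unfolding tendsto_at_iff_sequentially using x zU by (auto simp: neg_sqdist_def)
    have K: "compact (frontier U)" using U by (simp add: compact_frontier_bounded)
    \<comment> \<open>The minimum of the boundary data is a constant lower function, so the supremum
      is over a nonempty set and has its usual meaning.\<close>
    obtain y where y: "\<And>u. u \<in> frontier U \<Longrightarrow> neg_sqdist z y \<le> neg_sqdist z u"
      using continuous_attains_inf[OF K _ continuous_neg_sqdist] z by (metis empty_iff)
    have c: "(\<lambda>_. neg_sqdist z y) \<in> lower_class U (neg_sqdist z)" by (rule lower_class_const[OF y])
    have "perron_solution U (neg_sqdist z) (x n) \<le> - \<delta>" for n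
      unfolding perron_solution_lower_class by (rule cSup_least) (use c le in auto)
    then have "0 \<le> - \<delta>" by (intro LIMSEQ_le_const2[OF lim]) auto
    then show False using \<delta> by simp
  qed
  then show ?thesis using z by (simp add: singular_point_def)
qed

section \<open>Unions of polar sets and Kellogg's theorem\<close>

lemma polar_compact_empty: "polar_compact {}"
  unfolding polar_compact_def
proof (intro allI impI, intro exI conjI)
  show "continuous_on UNIV (\<lambda>_. 0)" "subharmonic_on UNIV (\<lambda>x. - 0)" using subharmonic_on_const[of UNIV 0] by simp_all
qed auto

lemma polar_compact_Un:
  assumes A: "polar_compact A" and B: "polar_compact B" shows "polar_compact (A \<union> B)"
  unfolding polar_compact_def
proof (intro allI impI)
  fix X and \<beta> :: real assume X: "compact X \<and> X \<inter> (A \<union> B) = {} \<and> \<beta> > 0"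
  have XA: "compact X \<and> X \<inter> A = {} \<and> \<beta> / 2 > 0" and XB: "compact X \<and> X \<inter> B = {} \<and> \<beta> / 2 > 0" using X by auto
  from A[unfolded polar_compact_def, rule_format, OF XA] obtain W1 where W1: "continuous_on UNIV W1" "subharmonic_on UNIV (\<lambda>x. - W1 x)" "\<And>x. W1 x \<ge> 0"
     "\<And>x. x \<in> A \<Longrightarrow> W1 x > 1" "\<And>x. x \<in> X \<Longrightarrow> W1 x \<le> \<beta> / 2" by blast
  from B[unfolded polar_compact_def, rule_format, OF XB] obtain W2 where W2: "continuous_on UNIV W2" "subharmonic_on UNIV (\<lambda>x. - W2 x)" "\<And>x. W2 x \<ge> 0"
     "\<And>x. x \<in> B \<Longrightarrow> W2 x > 1" "\<And>x. x \<in> X \<Longrightarrow> W2 x \<le> \<beta> / 2" by blast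
  show "\<exists>W. continuous_on UNIV W \<and> subharmonic_on UNIV (\<lambda>x. - W x) \<and> (\<forall>x. 0 \<le> W x) \<and> (\<forall>x\<in>A \<union> B. 1 < W x) \<and> (\<forall>x\<in>X. W x \<le> \<beta>)"
  proof (intro exI conjI)
    show "continuous_on UNIV (\<lambda>x. W1 x + W2 x)" by (intro continuous_intros W1 W2)
    show "subharmonic_on UNIV (\<lambda>x. - (W1 x + W2 x))" using subharmonic_on_add[OF W1(2) W2(2)] by simp
    show "\<forall>x. 0 \<le> W1 x + W2 x" using W1(3) W2(3) by (simp add: add_nonneg_nonneg)
    show "\<forall>x\<in>A \<union> B. 1 < W1 x + W2 x"
    proof
      fix x assume "x \<in> A \<union> B"
      then show "1 < W1 x + W2 x" using W1(3)[of x] W1(4)[of x] W2(3)[of x] W2(4)[of x] by auto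
    qed
    show "\<forall>x\<in>X. W1 x + W2 x \<le> \<beta>" using W1(5) W2(5) by (metis add_mono field_sum_of_halves)
  qed
qed

lemma polar_compact_UN:
  "finite I \<Longrightarrow> (\<And>i. i \<in> I \<Longrightarrow> polar_compact (A i)) \<Longrightarrow> polar_compact (\<Union>i\<in>I. A i)"
  by (induction I rule: finite_induct) (auto intro: polar_compact_empty polar_compact_Un)

text \<open>The pieces are so small that the boundary data are almost constant on them. On a
  non-polar piece the function of \<open>nonpolar_function\<close>, scaled and shifted, is a lower
  function that comes within \<open>e / 2\<close> of the data at a point of \<open>K\<close>,
  against the assumed gap \<open>e\<close>. Finitely many pieces cover \<open>K\<close>.\<close>

lemma irregular_set_polar:
  fixes \<Omega> :: "'a::euclidean_space set"
  assumes d: "DIM('a) \<ge> 3" and \<Omega>: "open \<Omega>" "bounded \<Omega>" and e: "e > 0" and K: "compact K" "K \<subseteq> frontier \<Omega>"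
    and irr: "\<And>v y. v \<in> lower_class \<Omega> (neg_sqdist z) \<Longrightarrow> y \<in> K \<Longrightarrow> v y \<le> neg_sqdist z y - e"
  shows "polar_compact K"
proof -
  have "bounded (closure \<Omega>)" by (rule bounded_closure[OF \<Omega>(2)])
  then obtain D0 where D0: "\<And>y. y \<in> closure \<Omega> \<Longrightarrow> dist z y \<le> D0" unfolding bounded_any_center[of _ z] by blast
  define D where "D = \<bar>D0\<bar> + 1"
  have D: "D \<ge> 1" "\<And>y. y \<in> closure \<Omega> \<Longrightarrow> dist z y \<le> D" using D0 by (force simp: D_def)+
  have Kc: "K \<subseteq> closure \<Omega>" using K(2) by (auto simp: frontier_def)
  \<comment> \<open>Within distance \<open>2 * \<rho>\<close> the data vary by at most
    \<open>2 * \<rho> * (2 * D)\<close>, which is \<open>e / 4\<close>.\<close>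
  define \<rho> where "\<rho> = e / (16 * D)"
  have \<rho>: "\<rho> > 0" using e D by (simp add: \<rho>_def)
  have osc: "\<bar>neg_sqdist z x - neg_sqdist z y\<bar> \<le> e / 4" if "x \<in> closure \<Omega>" "y \<in> closure \<Omega>" "dist x y \<le> 2 * \<rho>" for x y
  proof -
    have "neg_sqdist z x - neg_sqdist z y = (dist z y - dist z x) * (dist z y + dist z x)"
      by (simp add: neg_sqdist_def dist_commute power2_eq_square algebra_simps)
    then have "\<bar>neg_sqdist z x - neg_sqdist z y\<bar> = \<bar>dist z y - dist z x\<bar> * (dist z y + dist z x)" by (simp add: abs_mult)
    also have "\<dots> \<le> (2 * \<rho>) * (2 * D)"
    proof (intro mult_mono)
      show "\<bar>dist z y - dist z x\<bar> \<le> 2 * \<rho>" using that(3) dist_triangle[of z y x] dist_triangle[of z x y] by (auto simp: dist_commute abs_le_iff)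
      show "dist z y + dist z x \<le> 2 * D" using D(2)[OF that(1)] D(2)[OF that(2)] by simp
    qed (use \<rho> in auto)
    also have "\<dots> = e / 4" using D by (simp add: \<rho>_def)
    finally show ?thesis .
  qed
  have piece: "polar_compact (K \<inter> cball a \<rho>)" if a: "a \<in> K" for a
  proof (rule ccontr)
    assume np: "\<not> polar_compact (K \<inter> cball a \<rho>)"
    have ne: "K \<inter> cball a \<rho> \<noteq> {}" using a \<rho> by auto
    have cp: "compact (K \<inter> cball a \<rho>)" using K by (intro compact_Int) auto
    have ac: "a \<in> closure \<Omega>" using a Kc by blast
    \<comment> \<open>The second summand makes the ball contain the closure of \<Omega>, whose
      points have distance at most \<open>2 * D\<close> from \<open>a\<close>.\<close>
    define R where "R = 26 * \<rho> + 2 * D"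
    have cR: "closure \<Omega> \<subseteq> ball a R"
    proof
      fix x assume "x \<in> closure \<Omega>"
      then have "dist a x \<le> 2 * D" using D(2)[of x] D(2)[OF ac] dist_triangle3[of a x z] by simp
      then show "x \<in> ball a R" using \<rho> by (simp add: R_def)
    qed
    have Rr: "26 * \<rho> \<le> R" using D by (simp add: R_def)
    obtain v w where v: "continuous_on (cball a R) v" "subharmonic_on (ball a R - (K \<inter> cball a \<rho>)) v" "\<And>x. x \<in> cball a R \<Longrightarrow> v x \<le> 1"
      "w \<in> K \<inter> cball a \<rho>" "v w = 1" "\<And>x. x \<in> cball a R \<Longrightarrow> 2 * \<rho> \<le> dist a x \<Longrightarrow> v x \<le> 3/4"
      by (rule nonpolar_function[OF d ne cp _ \<rho> Rr np]) auto
    \<comment> \<open>Beyond \<open>2 * \<rho>\<close> the bound \<open>v \<le> 3/4\<close> lowers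
      \<open>b\<close> by \<open>A / 4 = D\<^sup>2\<close>, which is the range of the data on the
      closure.\<close>
    define A where "A = 4 * D\<^sup>2"
    have A: "A \<ge> 0" by (simp add: A_def)
    define b where "b = (\<lambda>x. (neg_sqdist z a - e / 4 - A) + A * v x)"
    have cR': "closure \<Omega> \<subseteq> cball a R" using cR ball_subset_cball by blast
    have b: "b \<in> lower_class \<Omega> (neg_sqdist z)"
      unfolding lower_class_def b_def
    proof (intro CollectI conjI ballI)
      show "continuous_on (closure \<Omega>) (\<lambda>x. (neg_sqdist z a - e / 4 - A) + A * v x)"
        by (intro continuous_intros continuous_on_subset[OF v(1) cR'])
      have "\<Omega> \<inter> K = {}" using K(2) \<Omega> by (auto simp: frontier_def interior_open)
      then have "\<Omega> \<subseteq> ball a R - (K \<inter> cball a \<rho>)" using cR closure_subset[of \<Omega>] by blast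
      then have "subharmonic_on \<Omega> v" by (rule subharmonic_on_subset[OF v(2)])
      then show "subharmonic_on \<Omega> (\<lambda>x. (neg_sqdist z a - e / 4 - A) + A * v x)"
        by (intro subharmonic_on_add subharmonic_on_const subharmonic_on_cmult A)
      fix y assume y: "y \<in> frontier \<Omega>"
      then have yc: "y \<in> closure \<Omega>" by (simp add: frontier_def)
      then have yR: "y \<in> cball a R" using cR' by blast
      show "(neg_sqdist z a - e / 4 - A) + A * v y \<le> neg_sqdist z y"
      proof (cases "2 * \<rho> \<le> dist a y")
        case True
        have "A * v y \<le> A * (3/4)" using v(6)[OF yR True] A by (intro mult_left_mono)
        moreover have "(dist z y)\<^sup>2 \<le> D\<^sup>2" using D(2)[OF yc] by (intro power_mono) auto
        moreover have "neg_sqdist z y = - (dist z y)\<^sup>2" by (simp add: neg_sqdist_def dist_commute)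
        moreover have "A * (3/4) = A - D\<^sup>2" by (simp add: A_def)
        ultimately show ?thesis using e neg_sqdist_nonpos[of z a] by linarith
      next
        case False
        have "A * v y \<le> A * 1" using v(3)[OF yR] A by (intro mult_left_mono)
        moreover have "\<bar>neg_sqdist z a - neg_sqdist z y\<bar> \<le> e / 4" by (rule osc[OF ac yc]) (use False in auto)
        ultimately show ?thesis by linarith
      qed
    qed
    have wK: "w \<in> K" "dist a w \<le> \<rho>" using v(4) by auto
    have "b w \<le> neg_sqdist z w - e" by (rule irr[OF b wK(1)])
    moreover have "b w = neg_sqdist z a - e / 4" using v(5) by (simp add: b_def)
    moreover have "\<bar>neg_sqdist z a - neg_sqdist z w\<bar> \<le> e / 4" using wK \<rho> Kc by (intro osc[OF ac]) auto
    ultimately show False using e by linarith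
  qed
  have cov: "K \<subseteq> (\<Union>a\<in>K. ball a \<rho>)" using \<rho> by auto
  obtain I where I: "I \<subseteq> K" "finite I" "K \<subseteq> (\<Union>a\<in>I. ball a \<rho>)"
    by (rule compactE_image[OF K(1) _ cov]) auto
  have "K = (\<Union>a\<in>I. K \<inter> cball a \<rho>)" using I(3) ball_subset_cball by blast
  moreover have "polar_compact (\<Union>a\<in>I. K \<inter> cball a \<rho>)" using I piece by (intro polar_compact_UN) auto
  ultimately show ?thesis by simp
qed

subsection \<open>Thinning the domain\<close>

lemma newton_unbounded:
  assumes d: "DIM('a::euclidean_space) \<ge> 3" and T: "T > 0"
  obtains r where "r > 0" "\<And>y::'a. y \<noteq> 0 \<Longrightarrow> norm y < r \<Longrightarrow> newton y \<ge> T"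
proof -
  define m where "m = DIM('a) / 2 - 1"
  have m: "m > 0" using d by (simp add: m_def)
  define r where "r = sqrt (T powr (- (1 / m)))"
  have r: "r > 0" using T by (simp add: r_def)
  have "newton y \<ge> T" if "y \<noteq> 0" "norm y < r" for y :: 'a
  proof -
    have "(norm y)\<^sup>2 \<le> r\<^sup>2" using that by (intro power_mono) auto
    then have "y \<bullet> y \<le> T powr (- (1 / m))" by (simp add: dot_square_norm r_def)
    then have "(T powr (- (1 / m))) powr (-m) \<le> newton y" unfolding newton_def m_def[symmetric] using that m by (intro powr_mono2') auto
    then show ?thesis using m T by (simp add: powr_powr)
  qed
  then show ?thesis using that r by blast
qed

lemma lower_class_upper_bound:
  assumes "finite Q" "Q \<subseteq> lower_class U \<phi>" "\<And>z. z \<in> frontier U \<Longrightarrow> c \<le> \<phi> z"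
  obtains b where "b \<in> lower_class U \<phi>" "\<And>y. c \<le> b y" "\<And>v y. v \<in> Q \<Longrightarrow> v y \<le> b y"
proof -
  have "\<exists>b\<in>lower_class U \<phi>. (\<forall>y. c \<le> b y) \<and> (\<forall>v\<in>Q. \<forall>y. v y \<le> b y)"
    using assms(1,2)
  proof (induction Q rule: finite_induct)
    case empty
    show ?case by (rule bexI[OF _ lower_class_const[OF assms(3)]]) auto
  next
    case (insert w Q)
    then obtain b where b: "b \<in> lower_class U \<phi>" "\<forall>y. c \<le> b y" "\<forall>v\<in>Q. \<forall>y. v y \<le> b y" by auto
    have "w \<in> lower_class U \<phi>" using insert by simp
    then have "(\<lambda>x. max (b x) (w x)) \<in> lower_class U \<phi>" by (rule lower_class_max[OF b(1)])
    then show ?case by (rule bexI[rotated]) (use b in \<open>auto simp: le_max_iff_disj\<close>)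
  qed
  then show ?thesis using that by blast
qed

text \<open>Near every point outside \<open>V\<close> the function \<open>b\<close> wins strictly,
  so the glued function is locally either a maximum of two subharmonic functions or \<open>b\<close>
  itself, and \<open>subharmonic_on_local\<close> applies. Asking for a neighbourhood rather than
  for boundary values of \<open>g\<close> admits a \<open>g\<close> that tends to minus infinity at
  a boundary point.\<close>

lemma lower_class_glue:
  fixes \<Omega> :: "'a::euclidean_space set"
  assumes d: "DIM('a) \<ge> 3" and \<Omega>: "open \<Omega>" and V: "open V" "V \<subseteq> \<Omega>" and b: "b \<in> lower_class \<Omega> \<phi>"
    and g: "subharmonic_on V g"
    and near: "\<And>y. y \<in> closure \<Omega> \<Longrightarrow> y \<notin> V \<Longrightarrow> \<exists>N. open N \<and> y \<in> N \<and> (\<forall>u\<in>N \<inter> V. g u < b u)"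
  shows "(\<lambda>y. if y \<in> V then max (b y) (g y) else b y) \<in> lower_class \<Omega> \<phi>"
proof -
  define h where "h = (\<lambda>y. if y \<in> V then max (b y) (g y) else b y)"
  have bc: "continuous_on (closure \<Omega>) b" and bs: "subharmonic_on \<Omega> b" and bf: "\<And>z. z \<in> frontier \<Omega> \<Longrightarrow> b z \<le> \<phi> z"
    using b by (auto simp: lower_class_def)
  have VC: "V \<subseteq> closure \<Omega>" using V closure_subset by blast
  have hb: "\<exists>N. open N \<and> y \<in> N \<and> (\<forall>u\<in>N. h u = b u)" if y: "y \<in> closure \<Omega>" "y \<notin> V" for y
  proof -
    obtain N where N: "open N" "y \<in> N" "\<And>u. u \<in> N \<Longrightarrow> u \<in> V \<Longrightarrow> g u < b u" using near[OF y] by blast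
    have "h u = b u" if "u \<in> N" for u
    proof (cases "u \<in> V")
      case True then show ?thesis using N(3)[OF that True] by (simp add: h_def)
    qed (simp add: h_def)
    then show ?thesis using N by blast
  qed
  have hV: "h u = max (b u) (g u)" if "u \<in> V" for u using that by (simp add: h_def)
  have mV: "subharmonic_on V (\<lambda>u. max (b u) (g u))"
    by (rule subharmonic_on_max[OF subharmonic_on_subset[OF bs V(2)] g])
  have "continuous_on (closure \<Omega>) h"
    unfolding continuous_on_topological
  proof (intro ballI allI impI)
    fix y B assume y: "y \<in> closure \<Omega>" and B: "open B" "h y \<in> B"
    show "\<exists>A. open A \<and> y \<in> A \<and> (\<forall>u\<in>closure \<Omega>. u \<in> A \<longrightarrow> h u \<in> B)"
    proof (cases "y \<in> V")
      case True
      have "max (b y) (g y) \<in> B" using B True by (simp add: h_def)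
      then obtain A where A: "open A" "y \<in> A" "\<And>u. u \<in> V \<Longrightarrow> u \<in> A \<Longrightarrow> max (b u) (g u) \<in> B"
        using subharmonic_on_continuous[OF mV] B(1) True unfolding continuous_on_topological by meson
      show ?thesis
      proof (intro exI[of _ "A \<inter> V"] conjI ballI impI)
        show "open (A \<inter> V)" using A V by (intro open_Int)
        show "h u \<in> B" if "u \<in> A \<inter> V" for u using A(3)[of u] that hV by simp
      qed (use A True in auto)
    next
      case False
      obtain N where N: "open N" "y \<in> N" "\<And>u. u \<in> N \<Longrightarrow> h u = b u" using hb[OF y False] by blast
      have "b y \<in> B" using B N by simp
      then obtain A where A: "open A" "y \<in> A" "\<And>u. u \<in> closure \<Omega> \<Longrightarrow> u \<in> A \<Longrightarrow> b u \<in> B"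
        using bc B(1) y unfolding continuous_on_topological by meson
      show ?thesis
      proof (intro exI[of _ "A \<inter> N"] conjI ballI impI)
        show "open (A \<inter> N)" using A N by (intro open_Int)
        show "h u \<in> B" if "u \<in> closure \<Omega>" "u \<in> A \<inter> N" for u using A(3)[of u] that N(3)[of u] by simp
      qed (use A N in auto)
    qed
  qed
  moreover have "subharmonic_on \<Omega> h"
  proof (rule subharmonic_on_local[OF d \<Omega>])
    fix y assume y: "y \<in> \<Omega>"
    show "\<exists>N. open N \<and> y \<in> N \<and> subharmonic_on N h"
    proof (cases "y \<in> V")
      case True
      have "subharmonic_on V h" using mV subharmonic_on_cong[of V h "\<lambda>u. max (b u) (g u)"] hV by blast
      then show ?thesis using True V by blast
    next
      case False
      obtain N where N: "open N" "y \<in> N" "\<And>u. u \<in> N \<Longrightarrow> h u = b u" using hb[OF subsetD[OF closure_subset y] False] by blast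
      have "subharmonic_on (N \<inter> \<Omega>) b" by (rule subharmonic_on_subset[OF bs]) auto
      then have "subharmonic_on (N \<inter> \<Omega>) h" using subharmonic_on_cong[of "N \<inter> \<Omega>" h b] N(3) by blast
      then show ?thesis using N y \<Omega> by (intro exI[of _ "N \<inter> \<Omega>"]) auto
    qed
  qed
  moreover have "h z \<le> \<phi> z" if z: "z \<in> frontier \<Omega>" for z
  proof -
    have "z \<notin> \<Omega>" using z \<Omega> by (simp add: frontier_def interior_open)
    then have "h z = b z" using V by (auto simp: h_def)
    then show ?thesis using bf[OF z] by simp
  qed
  ultimately show ?thesis unfolding h_def[symmetric] by (simp add: lower_class_def)
qed

text \<open>\<open>V\<close> consists of the points of \<Omega> closer to \<open>F\<close> than to
  the boundary. A limit point of \<open>V\<close> on the boundary of \<Omega> has distance 0 from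
  \<open>F\<close>, so it can only be \<open>z0\<close>; a point of \<open>F\<close> inside \<Omega>
  lies in the open set \<open>V\<close> and hence not on its frontier.\<close>

lemma thinned_domain:
  fixes \<Omega> F :: "'a::euclidean_space set"
  assumes \<Omega>: "open \<Omega>" and F: "closed F" "F \<inter> frontier \<Omega> = {z0}"
  defines "V \<equiv> {y \<in> \<Omega>. infdist y F < infdist y (frontier \<Omega>)}"
  shows "open V" "closure V \<subseteq> \<Omega> \<union> {z0}" "F \<inter> \<Omega> \<subseteq> V" "frontier V \<inter> F \<subseteq> {z0}"
proof -
  have fr: "frontier \<Omega> \<noteq> {}" "closed (frontier \<Omega>)" "F \<noteq> {}" using F(2) by auto
  have fO: "y \<notin> frontier \<Omega>" if "y \<in> \<Omega>" for y using that \<Omega> by (simp add: frontier_def interior_open)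
  have pos: "infdist y (frontier \<Omega>) > 0" if "y \<in> \<Omega>" for y by (rule infdist_pos_not_in_closed[OF fr(2,1) fO[OF that]])
  have zero: "infdist y F = 0 \<longleftrightarrow> y \<in> F" for y using in_closed_iff_infdist_zero[OF F(1) fr(3)] by simp
  have "V = \<Omega> \<inter> {y. infdist y F < infdist y (frontier \<Omega>)}" by (auto simp: V_def)
  then show Vo: "open V" using \<Omega> by (simp add: open_Int open_Collect_less continuous_on_infdist)
  have cl: "closure V \<subseteq> closure \<Omega> \<inter> {y. infdist y F \<le> infdist y (frontier \<Omega>)}"
  proof (rule closure_minimal)
    show "V \<subseteq> closure \<Omega> \<inter> {y. infdist y F \<le> infdist y (frontier \<Omega>)}" using closure_subset[of \<Omega>] by (auto simp: V_def)
    show "closed (closure \<Omega> \<inter> {y. infdist y F \<le> infdist y (frontier \<Omega>)})"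
      by (intro closed_Int closed_Collect_le continuous_on_infdist continuous_on_id) auto
  qed
  show cV: "closure V \<subseteq> \<Omega> \<union> {z0}"
  proof
    fix y assume "y \<in> closure V"
    then have y: "y \<in> closure \<Omega>" "infdist y F \<le> infdist y (frontier \<Omega>)" using cl by auto
    show "y \<in> \<Omega> \<union> {z0}"
    proof (cases "y \<in> \<Omega>")
      case False
      then have yf: "y \<in> frontier \<Omega>" using y \<Omega> by (simp add: frontier_def interior_open)
      then have "infdist y F = 0" using y infdist_nonneg[of y F] by (simp add: order_antisym)
      then show ?thesis using zero yf F(2) by auto
    qed simp
  qed
  show FV: "F \<inter> \<Omega> \<subseteq> V" using pos by (auto simp: V_def)
  show "frontier V \<inter> F \<subseteq> {z0}"
  proof
    fix y assume y: "y \<in> frontier V \<inter> F"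
    then have "y \<in> closure V" "y \<notin> V" using Vo by (auto simp: frontier_def interior_open)
    then show "y \<in> {z0}" using cV FV y by auto
  qed
qed

section \<open>Singularity of the thinned domain at the given point\<close>

theorem theorem5p2:
  fixes \<Omega> :: "'a::euclidean_space set" and z0 :: 'a
  assumes "DIM('a) \<ge> 3"
    and "open \<Omega>" and "bounded \<Omega>"
    and "z0 \<in> frontier \<Omega>"
    and "singular_point \<Omega> z0"
  shows "\<exists>\<Omega>0 :: 'a set. open \<Omega>0 \<and> closure \<Omega>0 \<subseteq> \<Omega> \<union> {z0} \<and>
           z0 \<in> frontier \<Omega>0 \<and> singular_point \<Omega>0 z0"
proof -
  note d = assms(1) and \<Omega> = assms(2,3) and z0 = assms(4)
  define P where "P = lower_class \<Omega> (neg_sqdist z0)"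
  have z0\<Omega>: "z0 \<notin> \<Omega>" using z0 \<Omega> by (simp add: frontier_def interior_open)
  have Kfr: "compact (frontier \<Omega>)" using \<Omega> by (simp add: compact_frontier_bounded)
  have frc: "frontier \<Omega> \<subseteq> closure \<Omega>" by (simp add: frontier_def)
  have fO: "y \<notin> frontier \<Omega>" if "y \<in> \<Omega>" for y using that \<Omega> by (simp add: frontier_def interior_open)
  have Pc: "continuous_on (closure \<Omega>) b" if "b \<in> P" for b using that by (simp add: P_def lower_class_def)
  have "\<not> regular_point \<Omega> z0" using assms(5) by (simp add: singular_point_def)
  then obtain \<delta> where \<delta>: "\<delta> > 0" "\<And>r. r > 0 \<Longrightarrow> \<exists>x\<in>\<Omega>. dist x z0 < r \<and> (\<forall>v\<in>P. v x \<le> - \<delta>)"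
    using regular_point_criterion[OF \<Omega> z0] unfolding P_def by (meson not_le)
  \<comment> \<open>The final comparison costs \<open>2 * \<epsilon>\<close> for the shift,
    \<open>\<epsilon>\<close> for the potentials and \<open>\<delta> / 8\<close> for the Newton
    kernel, together \<open>\<delta> / 2\<close>. Also \<open>2 * \<epsilon>\<close> is below the
    gap \<open>\<delta> / 2\<close> between the data and the lower functions at
    \<open>x n\<close>.\<close>
  define \<epsilon> where "\<epsilon> = \<delta> / 8"
  have \<epsilon>: "\<epsilon> > 0" using \<delta> by (simp add: \<epsilon>_def)
  \<comment> \<open>The distance is at most 1 and at most \<open>\<delta> / 2\<close>, so its square
    is at most \<open>\<delta> / 2\<close>; the data at \<open>x n\<close> stay well above
    \<open>- \<delta>\<close>.\<close>
  have "\<exists>x\<in>\<Omega>. dist x z0 < min (inverse (real (Suc n))) (\<delta> / 2) \<and> (\<forall>v\<in>P. v x \<le> - \<delta>)" for n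
    using \<delta> by (intro \<delta>(2)) simp
  then obtain x where x: "\<And>n. x n \<in> \<Omega>" "\<And>n. dist (x n) z0 < min (inverse (real (Suc n))) (\<delta> / 2)" "\<And>n v. v \<in> P \<Longrightarrow> v (x n) \<le> - \<delta>"
    by metis
  have xl: "x \<longlonglongrightarrow> z0"
    by (rule metric_LIMSEQ_I, rule LIMSEQ_norm_0[THEN metric_LIMSEQ_D, of "\<lambda>n. dist (x n) z0", simplified]) (use x(2) in \<open>auto simp: inverse_eq_divide\<close>)
  have xs: "neg_sqdist z0 (x n) \<ge> - \<delta> / 2" for n
  proof -
    have "inverse (real (Suc n)) \<le> 1" by (simp add: inverse_le_1_iff)
    then have "dist (x n) z0 \<le> 1" "dist (x n) z0 \<le> \<delta> / 2" using x(2)[of n] by auto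
    then have "dist (x n) z0 * dist (x n) z0 \<le> 1 * (\<delta> / 2)" by (intro mult_mono) auto
    then show ?thesis by (simp add: neg_sqdist_def power2_eq_square)
  qed
  define X where "X = insert z0 (range x)"
  have Xc: "compact X" unfolding X_def by (rule compact_sequence_with_limit[OF xl])
  obtain M0 where M0: "\<And>y. y \<in> frontier \<Omega> \<Longrightarrow> \<bar>neg_sqdist z0 y\<bar> \<le> M0"
    using compact_imp_bounded[OF compact_continuous_image[OF continuous_neg_sqdist Kfr]] unfolding bounded_iff by (metis imageI real_norm_def)
  define M where "M = \<bar>M0\<bar>"
  have M: "M \<ge> 0" "\<And>y. y \<in> frontier \<Omega> \<Longrightarrow> - M \<le> neg_sqdist z0 y" using M0 by (force simp: M_def)+
  \<comment> \<open>Where a potential exceeds 1, subtracting \<open>C\<close> times it pushes any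
    nonpositive function below \<open>- M\<close>, a value that a lower function of \<Omega> always
    reaches.\<close>
  define C where "C = M + 1"
  have C: "C > 0" using M by (simp add: C_def)
  define \<kappa> where "\<kappa> = min (\<epsilon> / C) 1"
  have \<kappa>: "\<kappa> > 0" "\<kappa> \<le> 1" "C * \<kappa> \<le> \<epsilon>" using \<epsilon> C by (auto simp: \<kappa>_def min_def field_simps)
  define K where "K = frontier \<Omega> \<inter> (\<Inter>v\<in>P. {y \<in> frontier \<Omega>. v y \<le> neg_sqdist z0 y - \<epsilon>})"
  have Kc: "compact K" unfolding K_def
    by (intro compact_Int_closed Kfr closed_INT ballI continuous_on_closed_Collect_le continuous_intros continuous_neg_sqdist)
       (auto intro: continuous_on_subset[OF Pc frc])
  \<comment> \<open>By continuity every lower function is at most \<open>- \<delta>\<close> at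
    \<open>z0\<close>, so \<open>z0\<close> lies in \<open>K\<close> as well as in \<open>X\<close>.
    Removing balls about \<open>z0\<close> makes the pieces disjoint from \<open>X\<close>, and they
    exhaust \<open>K\<close> up to \<open>z0\<close>.\<close>
  define S where "S = (\<lambda>j. K - ball z0 (inverse (real (Suc j))))"
  have "polar_compact (S j)" for j
  proof (rule irregular_set_polar[OF d \<Omega> \<epsilon>])
    show "compact (S j)" unfolding S_def by (rule compact_diff[OF Kc]) simp
    show "S j \<subseteq> frontier \<Omega>" by (auto simp: S_def K_def)
    show "v y \<le> neg_sqdist z0 y - \<epsilon>" if "v \<in> lower_class \<Omega> (neg_sqdist z0)" "y \<in> S j" for v y
      using that by (auto simp: S_def K_def P_def)
  qed
  moreover have "compact X \<and> X \<inter> S j = {} \<and> \<kappa> * (1/2) ^ Suc j > 0" for j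
    using Xc \<kappa> x(1) fO by (auto simp: X_def S_def K_def)
  ultimately have "\<exists>W. continuous_on UNIV W \<and> subharmonic_on UNIV (\<lambda>x. - W x) \<and> (\<forall>x. W x \<ge> 0) \<and>
        (\<forall>y\<in>S j. W y > 1) \<and> (\<forall>y\<in>X. W y \<le> \<kappa> * (1/2) ^ Suc j)" for j
    unfolding polar_compact_def by blast
  then obtain W where W: "\<And>j. continuous_on UNIV (W j)" "\<And>j. subharmonic_on UNIV (\<lambda>x. - W j x)" "\<And>j x. W j x \<ge> 0"
     "\<And>j y. y \<in> S j \<Longrightarrow> W j y > 1" "\<And>j y. y \<in> X \<Longrightarrow> W j y \<le> \<kappa> * (1/2) ^ Suc j" by metis
  \<comment> \<open>Apart from \<open>z0\<close>, the points where no barrier is active: no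
    potential exceeds 1 and no lower function comes within \<open>2 * \<epsilon>\<close> of the
    data. These points, among them all \<open>x n\<close>, must not become boundary of the thinned
    domain.\<close>
  define F where "F = insert z0 (closure \<Omega> \<inter> (\<Inter>j. {y. W j y \<le> 1}) \<inter> (\<Inter>b\<in>P. {y \<in> closure \<Omega>. b y \<le> neg_sqdist z0 y - 2 * \<epsilon>}))"
  have Fc: "closed F" unfolding F_def
    by (intro closed_insert closed_Int closed_INT ballI continuous_on_closed_Collect_le closed_Collect_le continuous_intros continuous_neg_sqdist W Pc) auto
  \<comment> \<open>A boundary point in \<open>F\<close> belongs to \<open>K\<close>. If it differs
    from \<open>z0\<close> it lies in some \<open>S j\<close>, where \<open>W j\<close> exceeds 1,
    contrary to membership in \<open>F\<close>.\<close>
  have Ffr: "F \<inter> frontier \<Omega> = {z0}"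
  proof (intro equalityI subsetI)
    fix y assume y: "y \<in> F \<inter> frontier \<Omega>"
    show "y \<in> {z0}"
    proof (rule ccontr)
      assume "y \<notin> {z0}"
      then have yn: "y \<noteq> z0" and le: "\<And>j. W j y \<le> 1" "\<And>b. b \<in> P \<Longrightarrow> b y \<le> neg_sqdist z0 y - 2 * \<epsilon>"
        using y by (auto simp: F_def)
      have "y \<in> K" using y le(2) \<epsilon> by (fastforce simp: K_def)
      moreover obtain j where "inverse (real (Suc j)) < dist z0 y" using reals_Archimedean[of "dist z0 y"] yn by auto
      ultimately have "y \<in> S j" by (auto simp: S_def)
      then show False using W(4) le(1)[of j] by fastforce
    qed
  qed (use z0 in \<open>auto simp: F_def\<close>)
  have xF: "x n \<in> F" for n
  proof -
    have "W j (x n) \<le> 1" for j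
    proof -
      have "W j (x n) \<le> \<kappa> * (1/2) ^ Suc j" by (rule W(5)) (simp add: X_def)
      also have "\<dots> \<le> 1 * 1" using \<kappa> by (intro mult_mono power_le_one) auto
      finally show ?thesis by simp
    qed
    moreover have "x n \<in> closure \<Omega>" by (rule subsetD[OF closure_subset x(1)])
    moreover have "b (x n) \<le> neg_sqdist z0 (x n) - 2 * \<epsilon>" if "b \<in> P" for b
      using x(3)[OF that, of n] xs[of n] \<delta>(1) by (simp add: \<epsilon>_def)
    ultimately show ?thesis by (auto simp: F_def)
  qed
  define V where "V = {y \<in> \<Omega>. infdist y F < infdist y (frontier \<Omega>)}"
  note V = thinned_domain[OF \<Omega>(1) Fc Ffr, folded V_def]
  have V\<Omega>: "V \<subseteq> \<Omega>" by (auto simp: V_def)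
  have Vb: "bounded V" by (rule bounded_subset[OF \<Omega>(2) V\<Omega>])
  have xV: "x n \<in> V" for n using xF x(1) V(3) by blast
  have z0V: "z0 \<in> frontier V"
  proof -
    have "z0 \<in> closure V" unfolding closure_sequential using xl xV by blast
    then show ?thesis using z0\<Omega> V\<Omega> V(1) by (auto simp: frontier_def interior_open)
  qed
  have key: "v (x n) \<le> - (\<delta> / 2)" if v: "v \<in> lower_class V (neg_sqdist z0)" for v n
  proof -
    have vc: "continuous_on (closure V) v" and vs: "subharmonic_on V v" and vf: "\<And>y. y \<in> frontier V \<Longrightarrow> v y \<le> neg_sqdist z0 y"
      using v by (auto simp: lower_class_def)
    have v0: "v y \<le> 0" if "y \<in> closure V" for y
      by (rule lower_class_le[OF Vb V(1) v _ that]) simp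
    have xn0: "newton (x n - z0) \<ge> 0" by simp
    \<comment> \<open>Only the value at \<open>x n\<close> matters, so \<open>\<eta>\<close> may
      depend on \<open>n\<close>; the summand 1 guards against division by zero.\<close>
    define \<eta> where "\<eta> = \<delta> / 8 / (newton (x n - z0) + 1)"
    have \<eta>: "\<eta> > 0" "\<eta> * newton (x n - z0) \<le> \<delta> / 8"
    proof -
      show "\<eta> > 0" using \<delta>(1) xn0 by (simp add: \<eta>_def add_nonneg_pos)
      then have "\<eta> * newton (x n - z0) \<le> \<eta> * (newton (x n - z0) + 1)" by simp
      also have "\<dots> = \<delta> / 8"
      proof -
        have "newton (x n - z0) + 1 \<noteq> 0" using xn0 by linarith
        then show ?thesis unfolding \<eta>_def by (metis nonzero_mult_div_cancel_right times_divide_eq_left)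
      qed
      finally show "\<eta> * newton (x n - z0) \<le> \<delta> / 8" .
    qed
    have "(M + 1) / \<eta> > 0" using M \<eta> by (intro divide_pos_pos) auto
    then obtain r where r: "r > 0" "\<And>y::'a. y \<noteq> 0 \<Longrightarrow> norm y < r \<Longrightarrow> (M + 1) / \<eta> \<le> newton y"
      using newton_unbounded[OF d] by metis
    have nr: "M + 1 \<le> \<eta> * newton (y - z0)" if "y \<noteq> z0" "dist z0 y < r" for y
      using r(2)[of "y - z0"] that \<eta>(1) by (simp add: dist_norm norm_minus_commute pos_divide_le_eq mult.commute)
    \<comment> \<open>Outside the ball of radius \<open>r\<close> the frontier of \<open>V\<close>
      is compact and inside \<Omega>. Within the ball the kernel term exceeds \<open>M\<close> and
      needs no barrier.\<close>
    define Kf where "Kf = frontier V - ball z0 r"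
    have Kfc: "compact Kf" unfolding Kf_def using Vb by (intro compact_diff compact_frontier_bounded) auto
    \<comment> \<open>The sum type indexes both kinds of barrier in one open cover:
      \<open>Inl\<close> for potentials, \<open>Inr\<close> for lower functions.\<close>
    define A where "A = (\<lambda>i. case i of Inl j \<Rightarrow> {y. W j y > 1} | Inr b \<Rightarrow> {y \<in> \<Omega>. b y > neg_sqdist z0 y - 2 * \<epsilon>})"
    have Ao: "open (A i)" if "i \<in> range Inl \<union> Inr ` P" for i
    proof (cases i)
      case (Inl j)
      then show ?thesis using W(1)[of j] by (simp add: A_def open_Collect_less)
    next
      case (Inr b)
      then have "b \<in> P" using that by auto
      then have "continuous_on \<Omega> (\<lambda>y. b y - neg_sqdist z0 y)"
        by (intro continuous_intros continuous_neg_sqdist continuous_on_subset[OF Pc closure_subset])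
      then have "open (\<Omega> \<inter> (\<lambda>y. b y - neg_sqdist z0 y) -` {- 2 * \<epsilon><..})"
        by (rule continuous_open_preimage[OF _ \<Omega>(1)]) simp
      moreover have "\<Omega> \<inter> (\<lambda>y. b y - neg_sqdist z0 y) -` {- 2 * \<epsilon><..} = A i" using Inr by (auto simp: A_def)
      ultimately show ?thesis by simp
    qed
    have cover: "Kf \<subseteq> (\<Union>i\<in>range Inl \<union> Inr ` P. A i)"
    proof
      fix y assume y: "y \<in> Kf"
      then have yz: "y \<noteq> z0" "y \<in> frontier V" using r(1) by (auto simp: Kf_def)
      then have y\<Omega>: "y \<in> \<Omega>" using V(2) by (auto simp: frontier_def)
      have "y \<notin> F" using V(4) yz by auto
      moreover have "y \<in> closure \<Omega>" by (rule subsetD[OF closure_subset y\<Omega>])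
      ultimately consider j where "W j y > 1" | b where "b \<in> P" "b y > neg_sqdist z0 y - 2 * \<epsilon>"
        by (fastforce simp: F_def not_le)
      then show "y \<in> (\<Union>i\<in>range Inl \<union> Inr ` P. A i)"
      proof cases
        case (1 j) then have "y \<in> A (Inl j)" by (simp add: A_def)
        then show ?thesis by blast
      next
        case (2 b) then have "y \<in> A (Inr b)" using y\<Omega> by (simp add: A_def)
        then show ?thesis using 2 by blast
      qed
    qed
    obtain I where I: "I \<subseteq> range Inl \<union> Inr ` P" "finite I" "Kf \<subseteq> (\<Union>i\<in>I. A i)"
      by (rule compactE_image[OF Kfc Ao cover])
    define J where "J = Inl -` I"
    define Q where "Q = Inr -` I"
    have J: "finite J" unfolding J_def using I(2) by (intro finite_vimageI) auto
    have Q: "finite Q" "Q \<subseteq> P" unfolding Q_def using I by (auto intro!: finite_vimageI)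
    \<comment> \<open>The maximum of the selected lower functions and the constant
      \<open>- M\<close>, so that \<open>b\<close> stays above \<open>- M\<close> even when none is
      selected.\<close>
    obtain b where b: "b \<in> P" "\<And>y. - M \<le> b y" "\<And>u y. u \<in> Q \<Longrightarrow> u y \<le> b y"
      using lower_class_upper_bound[OF Q(1), of \<Omega> "neg_sqdist z0" "- M"] Q(2) M(2) unfolding P_def by metis
    define w where "w = (\<lambda>y. (\<Sum>j\<in>J. W j y))"
    have w0: "w y \<ge> 0" for y unfolding w_def by (intro sum_nonneg W)
    have wJ: "w y > 1" if "j \<in> J" "W j y > 1" for j y
      using member_le_sum[OF that(1), of "\<lambda>j. W j y"] W(3) J that(2) by (simp add: w_def)
    \<comment> \<open>The weights \<open>(1/2) ^ Suc j\<close> sum to 1, so the bound holds whatever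
      finite set \<open>J\<close> the compactness argument returns.\<close>
    have wx: "w (x n) \<le> \<kappa>"
    proof -
      have "w (x n) \<le> (\<Sum>j\<in>J. \<kappa> * (1/2) ^ Suc j)" unfolding w_def by (intro sum_mono W(5)) (simp add: X_def)
      also have "\<dots> = \<kappa> * (\<Sum>j\<in>J. (1/2) ^ Suc j)" by (simp only: sum_distrib_left)
      also have "(\<Sum>j\<in>J. (1/2::real) ^ Suc j) \<le> (\<Sum>j. (1/2) ^ Suc j)"
        by (rule sum_le_suminf) (use power_half_series J in \<open>auto simp: sums_iff\<close>)
      also have "(\<Sum>j. (1/2::real) ^ Suc j) = 1" using power_half_series by (simp add: sums_iff)
      finally show ?thesis using \<kappa> by simp
    qed
    have wc: "continuous_on UNIV w" unfolding w_def by (intro continuous_intros W)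
    have ws: "subharmonic_on UNIV (\<lambda>y. - w y)"
      using subharmonic_on_sum[OF J W(2)] by (simp add: w_def sum_negf)
    \<comment> \<open>Each subtracted term secures \<open>g < b\<close> on one part of the frontier:
      the shift where a lower function of \<Omega> is close to the data, \<open>w\<close> where a
      potential exceeds 1, the kernel near \<open>z0\<close>.\<close>
    define g where "g = (\<lambda>y. v y + (- 2 * \<epsilon> + (C * (- w y) + \<eta> * (- newton (y - z0)))))"
    have gs: "subharmonic_on V g" unfolding g_def
    proof (intro subharmonic_on_add subharmonic_on_const subharmonic_on_cmult vs)
      show "subharmonic_on V (\<lambda>y. - w y)" by (rule subharmonic_on_subset[OF ws]) simp
      show "subharmonic_on V (\<lambda>y. - newton (y - z0))"
        by (rule subharmonic_on_subset[OF newton_shift_superharmonic[OF d]]) (use V\<Omega> z0\<Omega> in auto)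
    qed (use C \<eta> in auto)
    have Cw: "0 \<le> C * w y" "0 \<le> \<eta> * newton (y - z0)" for y using C w0[of y] \<eta>(1) by (auto intro!: mult_nonneg_nonneg)
    \<comment> \<open>The point \<open>z0\<close> is excluded because the kernel has the junk value
      0 at its pole; nothing is lost, as \<open>z0\<close> is not in \<open>V\<close>.\<close>
    have g1: "g y < b y" if "y \<in> closure V" "y \<noteq> z0" "dist z0 y < r" for y
      using v0[OF that(1)] nr[OF that(2,3)] Cw(1)[of y] b(2)[of y] \<epsilon> by (simp add: g_def)
    have g2: "g y < b y" if y: "y \<in> frontier V" "y \<noteq> z0" for y
    proof (cases "dist z0 y < r")
      case True
      then show ?thesis using g1 y by (simp add: frontier_def)
    next
      case False
      then have "y \<in> Kf" using y by (simp add: Kf_def)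
      then obtain i where i: "i \<in> I" "y \<in> A i" using I(3) by blast
      show ?thesis
      proof (cases i)
        case (Inl j)
        then have "w y > 1" using i by (intro wJ[of j]) (auto simp: J_def A_def)
        then have "C * 1 \<le> C * w y" using C by (intro mult_left_mono) auto
        moreover have "v y \<le> 0" using y by (intro v0) (simp add: frontier_def)
        ultimately show ?thesis using Cw(2)[of y] b(2)[of y] \<epsilon> by (simp add: g_def C_def)
      next
        case (Inr u)
        then have "u y \<le> b y" "u y > neg_sqdist z0 y - 2 * \<epsilon>" using i b(3) by (auto simp: Q_def A_def)
        then show ?thesis using vf[OF y(1)] Cw[of y] by (simp add: g_def)
      qed
    qed
    have "(\<lambda>y. if y \<in> V then max (b y) (g y) else b y) \<in> lower_class \<Omega> (neg_sqdist z0)"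
    proof (rule lower_class_glue[OF d \<Omega>(1) V(1) V\<Omega> b(1)[unfolded P_def] gs])
      fix y assume y: "y \<in> closure \<Omega>" "y \<notin> V"
      consider "y \<notin> closure V" | "y = z0" | "y \<in> frontier V" "y \<noteq> z0" using y V(1) by (auto simp: frontier_def interior_open)
      then show "\<exists>N. open N \<and> y \<in> N \<and> (\<forall>u\<in>N \<inter> V. g u < b u)"
      proof cases
        case 1
        then show ?thesis using closure_subset[of V] by (intro exI[of _ "- closure V"]) auto
      next
        case 2
        have "g u < b u" if "u \<in> ball z0 r \<inter> V" for u
          by (rule g1) (use that closure_subset[of V] V\<Omega> z0\<Omega> in auto)
        then show ?thesis using 2 r(1) by (intro exI[of _ "ball z0 r"]) auto
      next
        case 3
        \<comment> \<open>Away from \<open>z0\<close> the function \<open>g\<close> is continuous up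
          to the frontier, so the strict inequality at \<open>y\<close> persists on a
          neighbourhood.\<close>
        define E where "E = closure V - {z0}"
        have "continuous_on E (\<lambda>u. b u - g u)" unfolding g_def
        proof (intro continuous_intros)
          show "continuous_on E b" by (rule continuous_on_subset[OF Pc[OF b(1)]]) (use closure_mono[OF V\<Omega>] in \<open>auto simp: E_def\<close>)
          show "continuous_on E v" by (rule continuous_on_subset[OF vc]) (auto simp: E_def)
          show "continuous_on E w" by (rule continuous_on_subset[OF wc]) simp
          show "continuous_on E (\<lambda>x. newton (x - z0))" by (rule continuous_newton_shift) (simp add: E_def)
        qed
        moreover have "y \<in> E" "b y - g y \<in> {0<..}" using 3 g2[of y] by (auto simp: E_def frontier_def)
        ultimately obtain N where N: "open N" "y \<in> N" "\<And>u. u \<in> E \<Longrightarrow> u \<in> N \<Longrightarrow> b u - g u \<in> {0<..}"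
          unfolding continuous_on_topological by (meson open_greaterThan)
        have "g u < b u" if "u \<in> N \<inter> V" for u
        proof -
          have "u \<in> E" using that closure_subset[of V] V\<Omega> z0\<Omega> by (auto simp: E_def)
          then show ?thesis using N(3)[of u] that by simp
        qed
        then show ?thesis using N by blast
      qed
    qed
    \<comment> \<open>At \<open>x n\<close> the glued function is at least \<open>g\<close>, so
      \<open>g (x n) \<le> - \<delta>\<close>. Undoing the subtractions raises this by at most
      \<open>2 * \<epsilon> + \<epsilon> + \<delta> / 8 = \<delta> / 2\<close>.\<close>
    from x(3)[unfolded P_def, OF this, of n] have "g (x n) \<le> - \<delta>" using xV[of n] by simp
    moreover have "C * w (x n) \<le> C * \<kappa>" using wx C by (intro mult_left_mono) auto
    then have "C * w (x n) \<le> \<epsilon>" using \<kappa>(3) by linarith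
    ultimately show ?thesis using \<eta>(2) \<delta>(1) by (simp add: g_def \<epsilon>_def)
  qed
  have "singular_point V z0"
    by (rule singular_point_criterion[OF V(1) Vb z0V xV xl, of "\<delta> / 2"]) (use \<delta>(1) key in auto)
  then show ?thesis using V(1,2) z0V by blast
qed

end
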